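(* Let $E$ and $F$ be Banach spaces, $1\le p<\infty$, $m\in\mathbb N$, and $P\in\mathcal P(^mE;F)$. Then $P$ is $p$-compact if and only if its Aron–Berner extension $\overline P\in\mathcal P(^mE'';F'')$ is $p$-compact. Moreover, $\kappa_p(P)=\kappa_p(\overline P)$.
   Context: Banach spaces are complex; $B_E$ is the closed unit ball of $E$, and $E''$ is the bidual. $\mathcal P(^mE;F)$ is the space of continuous $m$-homogeneous polynomials from $E$ to $F$. $\ell_p(F)$ is the Banach space of $p$-summable sequences in $F$ with its natural norm $\|\cdot\|_p$. For $(y_n)_n\in\ell_p(F)$ put $p\text{-co}\{y_n\}=\{\sum_n\alpha_ny_n:(\alpha_n)_n\in B_{\ell_q}\}$, $\frac1p+\frac1q=1$. A set $K\subset F$ is relatively $p$-compact if it is contained in the closure of $p\text{-co}\{y_n\}$ for some $(y_n)_n\in\ell_p(F)$, and $m_p(K)=\inf\{\|(y_n)_n\|_p:K\subset p\text{-co}\{y_n\}\}$. A polynomial $P\in\mathcal P(^mE;F)$ is $p$-compact if $P(B_E)$ is relatively $p$-compact in $F$; then $\kappa_p(P)=m_p(P(B_E))$. The Aron–Berner extension $\overline P\in\mathcal P(^mE'';F'')$ is the canonical extension of $P$ from $E$ to $E''$ by weak-star density: if $A$ is the symmetric $m$-linear map with $P(x)=A(x,\dots,x)$, then $\overline P(z)=\overline A(z,\dots,z)$, where $\overline A(z_1,\dots,z_m)=\lim_{\alpha_1}\cdots\lim_{\alpha_m}A(x_{\alpha_1},\dots,x_{\alpha_m})$ (iterated weak-star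 limits in $F''$), with $(x_{\alpha_j})$ a bounded net in $E$ weak-star convergent to $z_j\in E''$. Here $p$-compactness and $\kappa_p$ of $\overline P$ are those of a polynomial from $E''$ to $F''$. *)

theory Defs
  imports "HOL-Analysis.Analysis"
begin

section \<open>Complex Banach spaces\<close>

text \<open>The real scalar multiplication of \<^class>\<open>banach\<close> is the restriction of the complex one.\<close>

class complex_banach = banach +
  fixes scaleC :: "complex \<Rightarrow> 'a \<Rightarrow> 'a"  (infixr \<open>*\<^sub>C\<close> 75)
  assumes scaleC_add_right: "c *\<^sub>C (x + y) = c *\<^sub>C x + c *\<^sub>C y"
    and scaleC_add_left: "(c + d) *\<^sub>C x = c *\<^sub>C x + d *\<^sub>C x"
    and scaleC_scaleC: "c *\<^sub>C (d *\<^sub>C x) = (c * d) *\<^sub>C x"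
    and scaleC_of_real: "complex_of_real r *\<^sub>C x = r *\<^sub>R x"
    and norm_scaleC: "norm (c *\<^sub>C x) = cmod c * norm x"

instantiation complex :: complex_banach
begin

definition scaleC_complex :: "complex \<Rightarrow> complex \<Rightarrow> complex"
  where "scaleC_complex c x = c * x"

instance
  by standard (simp_all add: scaleC_complex_def algebra_simps scaleR_conv_of_real norm_mult)

end

definition clinear :: "('a::complex_banach \<Rightarrow> 'b::complex_banach) \<Rightarrow> bool"
  where "clinear f \<longleftrightarrow> (\<forall>x y. f (x + y) = f x + f y) \<and> (\<forall>c x. f (c *\<^sub>C x) = c *\<^sub>C f x)"


section \<open>The dual, the bidual and the weak-star topology\<close>

typedef (overloaded) 'a cdual =
  "{f :: 'a::complex_banach \<Rightarrow>\<^sub>L complex. clinear (blinfun_apply f)}"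
  morphisms blinfun_of_cdual Abs_cdual
  by (rule exI[of _ 0]) (simp add: clinear_def scaleC_complex_def)

setup_lifting type_definition_cdual

instantiation cdual :: (complex_banach) real_normed_vector
begin

lift_definition norm_cdual :: "'a cdual \<Rightarrow> real" is norm .

lift_definition minus_cdual :: "'a cdual \<Rightarrow> 'a cdual \<Rightarrow> 'a cdual" is "(-)"
  by (simp add: clinear_def scaleC_complex_def blinfun.diff_left algebra_simps)

lift_definition uminus_cdual :: "'a cdual \<Rightarrow> 'a cdual" is uminus
  by (simp add: clinear_def scaleC_complex_def blinfun.minus_left)

lift_definition zero_cdual :: "'a cdual" is 0
  by (simp add: clinear_def scaleC_complex_def)

lift_definition plus_cdual :: "'a cdual \<Rightarrow> 'a cdual \<Rightarrow> 'a cdual" is "(+)"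
  by (simp add: clinear_def scaleC_complex_def blinfun.add_left algebra_simps)

lift_definition scaleR_cdual :: "real \<Rightarrow> 'a cdual \<Rightarrow> 'a cdual" is scaleR
  by (simp add: clinear_def scaleC_complex_def blinfun.scaleR_left scaleR_add_right)

definition dist_cdual :: "'a cdual \<Rightarrow> 'a cdual \<Rightarrow> real"
  where "dist_cdual f g = norm (f - g)"

definition [code del]:
  "(uniformity :: ('a cdual \<times> 'a cdual) filter) = (INF e\<in>{0 <..}. principal {(x, y). dist x y < e})"

definition open_cdual :: "'a cdual set \<Rightarrow> bool"
  where [code del]: "open_cdual S = (\<forall>x\<in>S. \<forall>\<^sub>F (x', y) in uniformity. x' = x \<longrightarrow> y \<in> S)"

definition sgn_cdual :: "'a cdual \<Rightarrow> 'a cdual"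
  where "sgn_cdual x = scaleR (inverse (norm x)) x"

instance
proof
  fix f g h :: "'a cdual" and a b :: real
  show "f + g + h = f + (g + h)" "f + g = g + f" "0 + f = f" "- f + f = 0" "f - g = f + - g"
    by (transfer; simp)+
  show "a *\<^sub>R (f + g) = a *\<^sub>R f + a *\<^sub>R g" "(a + b) *\<^sub>R f = a *\<^sub>R f + b *\<^sub>R f"
    "a *\<^sub>R b *\<^sub>R f = (a * b) *\<^sub>R f" "1 *\<^sub>R f = f"
    by (transfer; simp add: algebra_simps)+
  show "dist f g = norm (f - g)" "sgn f = inverse (norm f) *\<^sub>R f"
    by (simp_all add: dist_cdual_def sgn_cdual_def)
  show "(uniformity :: ('a cdual \<times> 'a cdual) filter) =
      (INF e\<in>{0 <..}. principal {(x, y). dist x y < e})"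
    by (rule uniformity_cdual_def)
  show "open S = (\<forall>x\<in>S. \<forall>\<^sub>F (x', y) in uniformity. x' = x \<longrightarrow> y \<in> S)" for S :: "'a cdual set"
    by (rule open_cdual_def)
  show "(norm f = 0) = (f = 0)" "norm (f + g) \<le> norm f + norm g"
    "norm (a *\<^sub>R f) = \<bar>a\<bar> * norm f"
    by (transfer; simp add: norm_triangle_ineq)+
qed

end

instantiation cdual :: (complex_banach) complex_banach
begin

lift_definition scaleC_cdual :: "complex \<Rightarrow> 'a cdual \<Rightarrow> 'a cdual"
  is "\<lambda>c f. blinfun_compose (blinfun_mult_right c) f"
  by (simp add: clinear_def scaleC_complex_def algebra_simps)

instance
proof
  fix f g :: "'a cdual" and a :: real and c d :: complex
  show "c *\<^sub>C (f + g) = c *\<^sub>C f + c *\<^sub>C g" "(c + d) *\<^sub>C f = c *\<^sub>C f + d *\<^sub>C f"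
    "c *\<^sub>C (d *\<^sub>C f) = (c * d) *\<^sub>C f" "complex_of_real a *\<^sub>C f = a *\<^sub>R f"
    by (transfer; rule blinfun_eqI;
        simp add: blinfun.add_left blinfun.scaleR_left algebra_simps scaleR_conv_of_real)+
  have le: "norm (c *\<^sub>C f) \<le> cmod c * norm f" for c and f :: "'a cdual"
    by transfer (rule norm_blinfun_bound,
        auto simp: norm_mult mult.assoc intro!: mult_left_mono norm_blinfun)
  show "norm (c *\<^sub>C f) = cmod c * norm f"
  proof (cases "c = 0")
    case True
    then show ?thesis using le[of c f] by simp
  next
    case False
    have "inverse c *\<^sub>C c *\<^sub>C f = f"
      using False by transfer (rule blinfun_eqI; simp)
    with le[of "inverse c" "c *\<^sub>C f"] False have "cmod c * norm f \<le> norm (c *\<^sub>C f)"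
      by (simp add: norm_inverse norm_divide field_simps)
    with le[of c f] show ?thesis by simp
  qed
next
  fix X :: "nat \<Rightarrow> 'a cdual"
  assume "Cauchy X"
  have dist_eq: "dist f g = dist (blinfun_of_cdual f) (blinfun_of_cdual g)" for f g :: "'a cdual"
    by (simp add: dist_cdual_def dist_norm norm_cdual.rep_eq minus_cdual.rep_eq)
  from \<open>Cauchy X\<close> have "Cauchy (\<lambda>n. blinfun_of_cdual (X n))"
    by (simp add: Cauchy_def dist_eq)
  then obtain L where L: "(\<lambda>n. blinfun_of_cdual (X n)) \<longlonglongrightarrow> L"
    using Cauchy_convergent convergent_def by blast
  have pt: "(\<lambda>n. blinfun_of_cdual (X n) x) \<longlonglongrightarrow> L x" for x
    by (intro tendsto_intros L)
  have cl: "clinear (blinfun_apply (blinfun_of_cdual (X n)))" for n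
    using blinfun_of_cdual by blast
  have "L (c *\<^sub>C x) = c *\<^sub>C L x" for c x
  proof (rule LIMSEQ_unique[OF pt])
    show "(\<lambda>n. blinfun_of_cdual (X n) (c *\<^sub>C x)) \<longlonglongrightarrow> c *\<^sub>C L x"
      using cl tendsto_mult_left[OF pt[of x], of c] by (simp add: clinear_def scaleC_complex_def)
  qed
  then have "clinear (blinfun_apply L)"
    by (simp add: clinear_def blinfun.add_right)
  then have "blinfun_of_cdual (Abs_cdual L) = L"
    by (simp add: Abs_cdual_inverse)
  with L have "X \<longlonglongrightarrow> Abs_cdual L"
    by (simp add: tendsto_iff dist_eq)
  then show "convergent X"
    by (auto simp: convergent_def)
qed

end

definition cdual_apply :: "'a::complex_banach cdual \<Rightarrow> 'a \<Rightarrow> complex"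
  where "cdual_apply f = blinfun_apply (blinfun_of_cdual f)"

lift_definition canonical_embedding :: "'a::complex_banach \<Rightarrow> 'a cdual cdual"
  is "\<lambda>x. Blinfun (\<lambda>f. cdual_apply f x)"
proof -
  fix x :: 'a
  have "bounded_linear (\<lambda>f. cdual_apply f x)"
    by (rule bounded_linear_intro[where K = "norm x"])
      (auto simp: cdual_apply_def plus_cdual.rep_eq scaleR_cdual.rep_eq norm_cdual.rep_eq
        blinfun.add_left blinfun.scaleR_left norm_blinfun)
  then show "clinear (blinfun_apply (Blinfun (\<lambda>f. cdual_apply f x)))"
    by (simp add: bounded_linear_Blinfun_apply clinear_def cdual_apply_def plus_cdual.rep_eq
        scaleC_cdual.rep_eq blinfun.add_left scaleC_complex_def)
qed

lemma cdual_apply_canonical_embedding: "cdual_apply (canonical_embedding x) f = cdual_apply f x"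
proof -
  have "bounded_linear (\<lambda>f. cdual_apply f x)"
    by (rule bounded_linear_intro[where K = "norm x"])
      (auto simp: cdual_apply_def plus_cdual.rep_eq scaleR_cdual.rep_eq norm_cdual.rep_eq
        blinfun.add_left blinfun.scaleR_left norm_blinfun)
  then show ?thesis
    by (simp add: cdual_apply_def[of "canonical_embedding x"] canonical_embedding.rep_eq
        bounded_linear_Blinfun_apply)
qed

definition weak_star_topology :: "'a::complex_banach cdual topology"
  where "weak_star_topology = pullback_topology UNIV cdual_apply euclidean"

lemma limitin_weak_star_iff:
  "limitin weak_star_topology f l F \<longleftrightarrow>
    (\<forall>x. ((\<lambda>i. cdual_apply (f i) x) \<longlongrightarrow> cdual_apply l x) F)"
proof -
  have "limitin weak_star_topology f l F \<longleftrightarrow>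
      limitin euclidean (\<lambda>i. cdual_apply (f i)) (cdual_apply l) F"
    unfolding limitin_def weak_star_topology_def topspace_pullback_topology openin_pullback_topology
    by auto
  also have "\<dots> \<longleftrightarrow> (\<forall>x. ((\<lambda>i. cdual_apply (f i) x) \<longlongrightarrow> cdual_apply l x) F)"
    by (simp add: limitin_componentwise flip: euclidean_product_topology)
  finally show ?thesis .
qed


section \<open>Homogeneous polynomials\<close>

text \<open>An \<open>m\<close>-linear map takes the list of its \<open>m\<close> arguments; its values on lists of any other
  length carry no information.\<close>

definition multilinear :: "nat \<Rightarrow> ('a::complex_banach list \<Rightarrow> 'b::complex_banach) \<Rightarrow> bool"
  where "multilinear m A \<longleftrightarrow>
    (\<forall>xs i. length xs = m \<longrightarrow> i < m \<longrightarrow> clinear (\<lambda>x. A (xs[i := x])))"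

definition symmetric_multilinear :: "nat \<Rightarrow> ('a::complex_banach list \<Rightarrow> 'b::complex_banach) \<Rightarrow> bool"
  where "symmetric_multilinear m A \<longleftrightarrow> multilinear m A \<and>
    (\<forall>xs ys. length xs = m \<longrightarrow> mset xs = mset ys \<longrightarrow> A xs = A ys)"

definition hom_polynomials :: "nat \<Rightarrow> ('a::complex_banach \<Rightarrow> 'b::complex_banach) set"
  where "hom_polynomials m = {P. continuous_on UNIV P \<and>
    (\<exists>A. multilinear m A \<and> (\<forall>x. P x = A (replicate m x)))}"

text \<open>The normalisation on lists of the wrong length is what makes the symmetric form of a
  polynomial unique as a function on lists.\<close>

definition polar_form :: "nat \<Rightarrow> ('a::complex_banach \<Rightarrow> 'b::complex_banach) \<Rightarrow> 'a list \<Rightarrow> 'b"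
  where "polar_form m P = (THE A. symmetric_multilinear m A \<and>
    (\<forall>xs. length xs \<noteq> m \<longrightarrow> A xs = 0) \<and> (\<forall>x. P x = A (replicate m x)))"


section \<open>The Aron--Berner extension\<close>

text \<open>Nets in a space are represented by the filters they generate on it: a bounded net
  weak-star convergent to \<open>z\<close> is a proper filter containing a bounded set and weak-star
  convergent to \<open>z\<close> along the canonical embedding.\<close>

definition bounded_weak_star_net :: "'a::complex_banach filter \<Rightarrow> 'a cdual cdual \<Rightarrow> bool"
  where "bounded_weak_star_net \<F> z \<longleftrightarrow> \<F> \<noteq> bot \<and> (\<exists>r. \<forall>\<^sub>F x in \<F>. norm x \<le> r) \<and>
    limitin weak_star_topology canonical_embedding z \<F>"

text \<open>\<open>iterated_limit [\<F>\<^sub>1, \<dots>, \<F>\<^sub>m] G w\<close> says that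
  \<open>w = lim\<^sub>\<F>\<^sub>1 \<dots> lim\<^sub>\<F>\<^sub>m G [x\<^sub>1, \<dots>, x\<^sub>m]\<close>, the innermost limit being the one in \<open>x\<^sub>m\<close>.
  The function \<open>g\<close> below is the inner iterated limit as a function of \<open>x\<^sub>1\<close>.\<close>

primrec iterated_limit ::
    "'a filter list \<Rightarrow> ('a list \<Rightarrow> 'b::complex_banach cdual) \<Rightarrow> 'b cdual \<Rightarrow> bool"
  where
    "iterated_limit [] G w \<longleftrightarrow> w = G []"
  | "iterated_limit (\<F> # \<F>s) G w \<longleftrightarrow>
      (\<exists>g. (\<forall>x. iterated_limit \<F>s (\<lambda>xs. G (x # xs)) (g x)) \<and>
           limitin weak_star_topology g w \<F>)"

text \<open>The iterated limit does not depend on the nets, and such nets exist by Goldstine's theorem.\<close>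

definition bidual_extension ::
    "('a::complex_banach list \<Rightarrow> 'b::complex_banach) \<Rightarrow> 'a cdual cdual list \<Rightarrow> 'b cdual cdual"
  where "bidual_extension A zs = (THE w. \<forall>\<F>s. list_all2 bounded_weak_star_net \<F>s zs \<longrightarrow>
    iterated_limit \<F>s (\<lambda>xs. canonical_embedding (A xs)) w)"

definition aron_berner ::
    "nat \<Rightarrow> ('a::complex_banach \<Rightarrow> 'b::complex_banach) \<Rightarrow> 'a cdual cdual \<Rightarrow> 'b cdual cdual"
  where "aron_berner m P z = bidual_extension (polar_form m P) (replicate m z)"


section \<open>$p$-compactness\<close>

definition ell :: "ennreal \<Rightarrow> (nat \<Rightarrow> 'a::complex_banach) set"
  where "ell p = {y. if p = top then bounded (range y)
    else summable (\<lambda>n. norm (y n) powr enn2real p)}"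

definition ell_norm :: "ennreal \<Rightarrow> (nat \<Rightarrow> 'a::complex_banach) \<Rightarrow> real"
  where "ell_norm p y = (if p = top then (SUP n. norm (y n))
    else (\<Sum>n. norm (y n) powr enn2real p) powr (1 / enn2real p))"

text \<open>In \<^typ>\<open>ennreal\<close> the equation \<open>1 / p + 1 / q = 1\<close> has, for given \<open>p \<ge> 1\<close>, exactly one
  solution \<open>q\<close>, which is \<open>top\<close> for \<open>p = 1\<close>.\<close>

definition p_co :: "real \<Rightarrow> (nat \<Rightarrow> 'a::complex_banach) \<Rightarrow> 'a set"
  where "p_co p y = {\<Sum>n. \<alpha> n *\<^sub>C y n | (\<alpha> :: nat \<Rightarrow> complex) q.
    1 / ennreal p + 1 / q = 1 \<and> \<alpha> \<in> ell q \<and> ell_norm q \<alpha> \<le> 1}"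

definition relatively_p_compact :: "real \<Rightarrow> 'a::complex_banach set \<Rightarrow> bool"
  where "relatively_p_compact p K \<longleftrightarrow> (\<exists>y \<in> ell (ennreal p). K \<subseteq> closure (p_co p y))"

text \<open>The infimum is \<open>top\<close> if there is no admissible sequence.\<close>

definition m_p :: "real \<Rightarrow> 'a::complex_banach set \<Rightarrow> ennreal"
  where "m_p p K = (INF y \<in> {y \<in> ell (ennreal p). K \<subseteq> p_co p y}. ennreal (ell_norm (ennreal p) y))"

definition p_compact :: "real \<Rightarrow> ('a::complex_banach \<Rightarrow> 'b::complex_banach) \<Rightarrow> bool"
  where "p_compact p P \<longleftrightarrow> relatively_p_compact p (P ` cball 0 1)"

definition kappa_p :: "real \<Rightarrow> ('a::complex_banach \<Rightarrow> 'b::complex_banach) \<Rightarrow> ennreal"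
  where "kappa_p p P = m_p p (P ` cball 0 1)"

end

theory Submission
  imports Defs "HOL-Library.Function_Algebras"
begin

text \<open>Write \<open>J\<close> for the canonical embeddings into the biduals. Since \<open>p_co p y\<close> is a continuous image
  of the coordinatewise compact unit ball of \<open>\<ell>\<^sub>q\<close>, it is norm compact, so its closure in the
  definition of \<open>p\<close>-compactness is immaterial and everything reduces to comparing \<open>m_p\<close> of the
  images of the unit balls.

  If \<open>P\<close> maps the unit ball into a compact set \<open>S\<close>, its extension maps the bidual ball into \<open>J S\<close>:
  averaging well-chosen points of the ball, as in the theorem of Davie and Gamelin, makes
  \<open>P x\<close> approximate any finite set of coordinates of the extension at \<open>z\<close>, and compactness of \<open>S\<close>
  turns approximation into membership.

  Conversely the extension restricts to \<open>J \<circ> P\<close>, so it remains to see that \<open>m_p K = m_p (J K)\<close>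
  for \<open>K \<subseteq> F\<close>. Suppose \<open>J K\<close> is a subset of \<open>p_co p z\<close> with \<open>z\<close> in the bidual. By Hahn--Banach, finitely
  many combinations of the \<open>z n\<close> that lie in \<open>F\<close> are approximated by the same combinations of vectors
  \<open>y n\<close> of \<open>F\<close> with \<open>norm (y n) \<le> norm (z n)\<close>. As the coefficients vary in a compact set, the
  error is a function on \<open>K\<close> that is again \<open>p\<close>-bounded in the bidual, with a small constant, and
  iterating gives a series in \<open>F\<close> of total norm as close to that of \<open>z\<close> as desired.\<close>

subsection \<open>Complex scalars and functionals\<close>

text \<open>Smallness of the error in norm would not be enough: a set of small norm need not be
  p-compact at all. Each correction must leave an error that is again \<open>p_bounded\<close>, with
  a constant as small as desired. The iteration concerns functions on K rather than sets, because
  the coefficients of a point in the bidual are reused for the approximating vectors and the error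
  is a pointwise difference. The constants of the summands add up: the first correction costs the
  given constant, the later ones a geometric series of total e / 2, and the other half of e is spent
  on keeping all weights positive. As \<open>m_p\<close> is an infimum, this loss disappears; in the
  opposite direction there is none.

  The averaging is forced by the iterated limits: points chosen one after the other control the
  multilinear form only on lists of distinct indices, and in a long average the lists with a
  repetition are rare.\<close>

lemma scaleC_right_zero [simp]: "c *\<^sub>C (0::'a::complex_banach) = 0"
  using norm_scaleC[of c "0::'a"] by simp

lemma scaleC_left_zero [simp]: "0 *\<^sub>C (x::'a::complex_banach) = 0"
  using norm_scaleC[of 0 x] by simp

lemma scaleC_one [simp]: "1 *\<^sub>C (x::'a::complex_banach) = x"
  using scaleC_of_real[of 1 x] by simp

lemma bounded_bilinear_scaleC:
  "bounded_bilinear (\<lambda>c (x::'a::complex_banach). c *\<^sub>C x)"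
proof
  fix r c and x :: 'a
  show "(r *\<^sub>R c) *\<^sub>C x = r *\<^sub>R c *\<^sub>C x"
    by (simp add: scaleR_conv_of_real scaleC_scaleC flip: scaleC_of_real)
  show "c *\<^sub>C r *\<^sub>R x = r *\<^sub>R c *\<^sub>C x"
    by (simp add: scaleC_scaleC mult.commute flip: scaleC_of_real)
  show "\<exists>K. \<forall>c (x::'a). norm (c *\<^sub>C x) \<le> norm c * norm x * K"
    by (rule exI[of _ 1]) (simp add: norm_scaleC)
qed (simp_all add: scaleC_add_right scaleC_add_left)

interpretation scaleC: bounded_bilinear "\<lambda>c (x::'a::complex_banach). c *\<^sub>C x"
  by (rule bounded_bilinear_scaleC)

lemma clinear_imp_linear: "clinear f \<Longrightarrow> linear f"
  by (rule linearI) (simp_all add: clinear_def flip: scaleC_of_real)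

lemma clinear_add: "clinear f \<Longrightarrow> f (x + y) = f x + f y"
  by (simp add: clinear_def)

lemma clinear_scaleC: "clinear f \<Longrightarrow> f (c *\<^sub>C x) = c *\<^sub>C f x"
  by (simp add: clinear_def)

lemma clinear_sum: "clinear f \<Longrightarrow> f (sum g A) = (\<Sum>a\<in>A. f (g a))"
  using linear_sum[OF clinear_imp_linear] by blast

lemma bounded_linear_cdual_apply: "bounded_linear (cdual_apply f)"
  by (simp add: cdual_apply_def blinfun.bounded_linear_right)

lemmas cdual_apply_simps =
  bounded_linear.linear[OF bounded_linear_cdual_apply, THEN linear_0]
  bounded_linear.linear[OF bounded_linear_cdual_apply, THEN linear_add]
  bounded_linear.linear[OF bounded_linear_cdual_apply, THEN linear_diff]
  bounded_linear.linear[OF bounded_linear_cdual_apply, THEN linear_neg]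
  bounded_linear.linear[OF bounded_linear_cdual_apply, THEN linear_cmul]
  bounded_linear.linear[OF bounded_linear_cdual_apply, THEN linear_sum]

lemma clinear_cdual_apply: "clinear (cdual_apply f)"
  using blinfun_of_cdual[of f] by (simp add: cdual_apply_def)

lemma cdual_apply_scaleC: "cdual_apply f (c *\<^sub>C x) = c * cdual_apply f x"
  using clinear_scaleC[OF clinear_cdual_apply] by (simp add: scaleC_complex_def)

lemma norm_cdual_apply: "cmod (cdual_apply f x) \<le> norm f * norm x"
  by (simp add: cdual_apply_def norm_cdual.rep_eq norm_blinfun)

lemma cdual_apply_left_linear:
  "cdual_apply (f + g) x = cdual_apply f x + cdual_apply g x"
  "cdual_apply (f - g) x = cdual_apply f x - cdual_apply g x"
  "cdual_apply (c *\<^sub>C f) x = c * cdual_apply f x"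
  "cdual_apply 0 x = 0"
  by (simp_all add: cdual_apply_def plus_cdual.rep_eq minus_cdual.rep_eq scaleC_cdual.rep_eq
      zero_cdual.rep_eq blinfun.add_left blinfun.diff_left)

lemma cdual_apply_sum_left:
  "cdual_apply (\<Sum>i\<in>A. f i) x = (\<Sum>i\<in>A. cdual_apply (f i) x)"
  by (induction A rule: infinite_finite_induct) (auto simp: cdual_apply_left_linear)

lemma cdual_eqI: "(\<And>x. cdual_apply f x = cdual_apply g x) \<Longrightarrow> f = g"
  unfolding cdual_apply_def by (metis blinfun_eqI blinfun_of_cdual_inject)

lemma norm_cdual_bound:
  assumes "0 \<le> C" "\<And>x. cmod (cdual_apply f x) \<le> C * norm x"
  shows "norm f \<le> C"
  using assms norm_blinfun_bound[of C "blinfun_of_cdual f"]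
  by (simp add: norm_cdual.rep_eq cdual_apply_def)

text \<open>On the zero space the bound may hold with a negative \<open>C\<close>, which is why the
  norm is compared with \<open>max C 0\<close>.\<close>

lemma cdual_of_clinear:
  assumes "clinear f" and bd: "\<And>x. cmod (f x) \<le> C * norm x"
  obtains g where "cdual_apply g = f" "norm g \<le> max C 0"
proof -
  interpret linear f by (rule clinear_imp_linear) fact
  have bl: "bounded_linear f"
    by (rule bounded_linear_intro[where K = C])
       (use bd in \<open>auto simp: add scaleR mult.commute\<close>)
  have eq: "cdual_apply (Abs_cdual (Blinfun f)) = f"
    using assms(1) bl by (simp add: cdual_apply_def Abs_cdual_inverse bounded_linear_Blinfun_apply)
  have "cmod (f x) \<le> max C 0 * norm x" for x
    by (rule order_trans[OF bd mult_right_mono]) auto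
  then have "norm (Abs_cdual (Blinfun f)) \<le> max C 0"
    by (intro norm_cdual_bound) (auto simp: eq)
  with eq show thesis by (rule that)
qed

text \<open>A vector nearly attaining the norm is normalised and multiplied by a unimodular phase,
  which makes the value a positive real. For negative \<open>r\<close> the vector 0 serves, which
  also covers the zero space.\<close>

lemma norm_cdual_approx:
  assumes "r < norm f"
  obtains x where "norm x \<le> 1" "r < Re (cdual_apply f x)" "Im (cdual_apply f x) = 0"
proof (cases "r < 0")
  case True
  show ?thesis by (rule that[of 0]) (use True in \<open>auto simp: cdual_apply_simps\<close>)
next
  case False
  with assms obtain x where x: "r * norm x < cmod (cdual_apply f x)"
    using norm_cdual_bound[of r f] by (meson not_le order.refl)
  let ?v = "cdual_apply f x"
  have "0 \<le> r * norm x" using False by simp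
  with x have "?v \<noteq> 0" "x \<noteq> 0" by (auto simp: cdual_apply_simps)
  define c where "c = cnj ?v / of_real (cmod ?v * norm x)"
  have "cdual_apply f (c *\<^sub>C x) = of_real (cmod ?v / norm x)"
    using \<open>?v \<noteq> 0\<close> \<open>x \<noteq> 0\<close> complex_norm_square[of ?v]
    by (simp add: c_def cdual_apply_scaleC field_simps power2_eq_square)
  moreover have "norm (c *\<^sub>C x) = 1"
    using \<open>?v \<noteq> 0\<close> \<open>x \<noteq> 0\<close> by (simp add: c_def norm_scaleC norm_divide norm_mult)
  ultimately show ?thesis
    using x \<open>x \<noteq> 0\<close>
    by (intro that[of "c *\<^sub>C x"]) (simp_all add: pos_less_divide_eq del: of_real_divide)
qed

lemma norm_cdual_approx':
  assumes "0 < e"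
  shows "\<exists>x. norm x \<le> 1 \<and> norm f - e \<le> Re (cdual_apply f x)"
proof -
  obtain x where "norm x \<le> 1" "norm f - e < Re (cdual_apply f x)"
    using norm_cdual_approx[of "norm f - e" f] assms by auto
  then show ?thesis by (intro exI[of _ x]) simp
qed

lemma clinear_canonical_embedding: "clinear canonical_embedding"
  unfolding clinear_def
  by (auto intro!: cdual_eqI simp: cdual_apply_left_linear cdual_apply_canonical_embedding
      cdual_apply_simps cdual_apply_scaleC)

lemma norm_canonical_embedding_le: "norm (canonical_embedding x) \<le> norm x"
  by (rule norm_cdual_bound)
     (auto simp: cdual_apply_canonical_embedding mult.commute[of "norm x"] norm_cdual_apply)

lemma bounded_linear_canonical_embedding: "bounded_linear canonical_embedding"
proof -
  interpret linear "canonical_embedding :: 'a \<Rightarrow> _"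
    by (rule clinear_imp_linear[OF clinear_canonical_embedding])
  show ?thesis
    by (rule bounded_linear_intro[where K = 1]) (auto simp: add scaleR norm_canonical_embedding_le)
qed


subsection \<open>The Hahn--Banach theorem\<close>

definition sublinear :: "('a::real_vector \<Rightarrow> real) \<Rightarrow> bool"
  where "sublinear q \<longleftrightarrow> (\<forall>x y. q (x + y) \<le> q x + q y) \<and> (\<forall>t\<ge>0. \<forall>x. q (t *\<^sub>R x) = t * q x)"

lemma sublinear_zero: "sublinear q \<Longrightarrow> q 0 = 0"
  unfolding sublinear_def by (metis mult_zero_left order.refl scaleR_zero_left)

lemma sublinear_minus: "sublinear q \<Longrightarrow> - q (- x) \<le> q x"
  using sublinear_zero[of q] unfolding sublinear_def by (smt (verit) add.right_inverse)

text \<open>\<open>r\<close> is the infimal convolution of \<open>q\<close> with the function that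
  is -t q(a) at -t a and infinite off this ray. It is used twice: for a minimal \<open>q\<close> it
  coincides with \<open>q\<close>, and the third claim becomes superadditivity; for the initial
  functional it forces every linear minorant to reach the value q(a) at \<open>a\<close>.\<close>

lemma sublinear_shift:
  fixes q :: "'a::real_vector \<Rightarrow> real" and a :: 'a
  assumes q: "sublinear q"
  defines "r \<equiv> \<lambda>x. INF t\<in>{0..}. q (x + t *\<^sub>R a) - t * q a"
  shows "sublinear r" and "r x \<le> q x" and "r x \<le> q (x + a) - q a"
proof -
  have qa: "q (x + y) \<le> q x + q y" and qs: "0 \<le> t \<Longrightarrow> q (t *\<^sub>R x) = t * q x" for x y t
    using q by (auto simp: sublinear_def)
  have lb: "- q (- x) \<le> q (x + t *\<^sub>R a) - t * q a" if "0 \<le> t" for x t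
    using qa[of "x + t *\<^sub>R a" "- x"] that by (simp add: qs)
  have bdd: "bdd_below ((\<lambda>t. q (x + t *\<^sub>R a) - t * q a) ` {0..})" for x
    using lb by (intro bdd_belowI[of _ "- q (- x)"]) auto
  have le: "r x \<le> q (x + t *\<^sub>R a) - t * q a" if "0 \<le> t" for x t
    unfolding r_def by (rule cINF_lower[OF bdd]) (use that in auto)
  have approx: "\<exists>t\<ge>0. q (x + t *\<^sub>R a) - t * q a < c" if "r x < c" for x c
    using that cINF_less_iff[OF _ bdd, of x c] unfolding r_def by force
  show "r x \<le> q x" using le[of 0 x] by simp
  show "r x \<le> q (x + a) - q a" using le[of 1 x] by simp
  show "sublinear r"
    unfolding sublinear_def
  proof safe
    fix x y :: 'a
    show "r (x + y) \<le> r x + r y"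
    proof (rule field_le_epsilon)
      fix e :: real assume "0 < e"
      then obtain s t where st: "0 \<le> s" "0 \<le> t" "q (x + s *\<^sub>R a) - s * q a < r x + e/2"
        "q (y + t *\<^sub>R a) - t * q a < r y + e/2"
        using approx[of x "r x + e/2"] approx[of y "r y + e/2"] by auto
      have "q ((x + y) + (s + t) *\<^sub>R a) \<le> q (x + s *\<^sub>R a) + q (y + t *\<^sub>R a)"
        using qa[of "x + s *\<^sub>R a" "y + t *\<^sub>R a"] by (simp add: algebra_simps)
      then show "r (x + y) \<le> r x + r y + e"
        using le[of "s + t" "x + y"] st by (simp add: algebra_simps)
    qed
  next
    fix t :: real and x :: 'a assume "0 \<le> t"
    \<comment> \<open>One inequality suffices for positive \<open>t\<close>: its instance at the
      inverse of \<open>t\<close> and the scaled vector is the reverse one.\<close>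
    have sc: "r (t *\<^sub>R x) \<le> t * r x" if "0 < t" for t x
    proof (rule field_le_epsilon)
      fix e :: real assume "0 < e"
      then obtain s where s: "0 \<le> s" "q (x + s *\<^sub>R a) - s * q a < r x + e/t"
        using approx[of x "r x + e/t"] \<open>0 < t\<close> by auto
      have "r (t *\<^sub>R x) \<le> q (t *\<^sub>R (x + s *\<^sub>R a)) - t * s * q a"
        using le[of "t * s" "t *\<^sub>R x"] s(1) that by (simp add: scaleR_add_right)
      also have "\<dots> = t * (q (x + s *\<^sub>R a) - s * q a)"
        using that qs[of t "x + s *\<^sub>R a"] by (simp add: right_diff_distrib)
      also have "\<dots> \<le> t * (r x + e/t)"
        using that s(2) by (intro mult_left_mono) auto
      finally show "r (t *\<^sub>R x) \<le> t * r x + e"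
        using that by (simp add: algebra_simps)
    qed
    show "r (t *\<^sub>R x) = t * r x"
    proof (cases "t = 0")
      case True
      have "r 0 = 0"
        using le[of 0 0] lb[of _ 0] sublinear_zero[OF q] unfolding r_def
        by (intro antisym cINF_greatest) auto
      with True show ?thesis by simp
    next
      case False
      with \<open>0 \<le> t\<close> have "0 < t" by simp
      then have "t * r x \<le> r (t *\<^sub>R x)"
        using sc[of "inverse t" "t *\<^sub>R x"] by (simp add: field_simps)
      with sc[OF \<open>0 < t\<close>, of x] show ?thesis by simp
    qed
  qed
qed

text \<open>The infimum is finite because q(x) is at least -q(-x), hence at least -p(-x), for every
  \<open>q\<close> in \<open>C\<close>. Subadditivity needs the chain condition: near-minimisers at
  \<open>x\<close> and at \<open>y\<close> can both be replaced by the smaller of the two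
  functionals.\<close>

lemma sublinear_chain_INF:
  fixes C :: "('a::real_vector \<Rightarrow> real) set"
  assumes C: "\<And>q. q \<in> C \<Longrightarrow> sublinear q" and "C \<noteq> {}" and lb: "\<And>q. q \<in> C \<Longrightarrow> q \<le> p" 
    and chain: "\<And>q r. q \<in> C \<Longrightarrow> r \<in> C \<Longrightarrow> q \<le> r \<or> r \<le> q"
  defines "u \<equiv> \<lambda>x. INF q\<in>C. q x"
  shows "sublinear u" and "q \<in> C \<Longrightarrow> u \<le> q"
proof -
  have bdd: "bdd_below ((\<lambda>q. q x) ` C)" for x
  proof (rule bdd_belowI2[of _ "- p (- x)"])
    fix q assume "q \<in> C"
    then have "- q (- x) \<le> q x" "q (- x) \<le> p (- x)"
      using sublinear_minus[OF C] lb by (auto simp: le_fun_def)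
    then show "- p (- x) \<le> q x" by simp
  qed
  have le: "u x \<le> q x" if "q \<in> C" for q x
    unfolding u_def by (rule cINF_lower[OF bdd that])
  then show "u \<le> q" if "q \<in> C" using that by (auto simp: le_fun_def)
  have approx: "\<exists>q\<in>C. q x < c" if "u x < c" for x c
    using that cINF_less_iff[OF \<open>C \<noteq> {}\<close> bdd, of x c] unfolding u_def by auto
  show "sublinear u"
    unfolding sublinear_def
  proof safe
    fix x y :: 'a
    show "u (x + y) \<le> u x + u y"
    proof (rule field_le_epsilon)
      fix e :: real assume "0 < e"
      then obtain q r where qr: "q \<in> C" "r \<in> C" "q x < u x + e/2" "r y < u y + e/2"
        using approx[of x "u x + e/2"] approx[of y "u y + e/2"] by auto
      obtain s where s: "s \<in> C" "s \<le> q" "s \<le> r"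
        using chain[OF qr(1,2)] qr(1,2) by blast
      have "u (x + y) \<le> s x + s y"
        using le[OF s(1), of "x + y"] C[OF s(1)] unfolding sublinear_def
        by (meson order_trans)
      also have "\<dots> \<le> q x + r y" using s by (intro add_mono) (auto simp: le_fun_def)
      finally show "u (x + y) \<le> u x + u y + e" using qr by simp
    qed
  next
    fix t :: real and x :: 'a assume "0 \<le> t"
    have "u (t *\<^sub>R x) = (INF q\<in>C. t * q x)"
      unfolding u_def using C \<open>0 \<le> t\<close> by (intro INF_cong) (auto simp: sublinear_def)
    also have "\<dots> = t * u x"
    proof (cases "t = 0")
      case True
      then show ?thesis using \<open>C \<noteq> {}\<close> by simp
    next
      case False
      with \<open>0 \<le> t\<close> have "0 < t" by simp
      have bdd': "bdd_below ((\<lambda>q. t * q x) ` C)"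
      proof -
        from bdd[of x] obtain M where "\<And>q. q \<in> C \<Longrightarrow> M \<le> q x"
          by (auto simp: bdd_below_def)
        then show ?thesis
          using \<open>0 < t\<close> by (intro bdd_belowI2[of _ "t * M"]) (auto intro!: mult_left_mono)
      qed
      show ?thesis
      proof (rule antisym)
        have "(INF q\<in>C. t * q x) / t \<le> u x"
          unfolding u_def using \<open>C \<noteq> {}\<close> \<open>0 < t\<close> cINF_lower[OF bdd']
          by (intro cINF_greatest) (auto simp: field_simps)
        then show "(INF q\<in>C. t * q x) \<le> t * u x" using \<open>0 < t\<close> by (simp add: field_simps)
        show "t * u x \<le> (INF q\<in>C. t * q x)"
          using \<open>C \<noteq> {}\<close> le \<open>0 < t\<close> by (intro cINF_greatest) auto
      qed
    qed
    finally show "u (t *\<^sub>R x) = t * u x" .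
  qed
qed

text \<open>A minimal sublinear functional is linear, since shifting it by any direction cannot
  decrease it any further.\<close>

theorem Hahn_Banach:
  fixes p :: "'a::real_vector \<Rightarrow> real"
  assumes p: "sublinear p"
  obtains f where "linear f" "\<And>x. f x \<le> p x" "f a = p a"
proof -
  \<comment> \<open>Minimising below \<open>p'\<close> instead of \<open>p\<close> secures the value
    at \<open>a\<close>: a minorant of \<open>p'\<close> is at most -p(a) at -a.\<close>
  define p' where "p' x = (INF t\<in>{0..}. p (x + t *\<^sub>R a) - t * p a)" for x
  note p' = sublinear_shift[OF p, where a = a, folded p'_def]
  define S where "S = {q. sublinear q \<and> q \<le> p'}"
  have "p' \<in> S" using p'(1) by (simp add: S_def)
  have "\<exists>f\<in>S. \<forall>q\<in>S. q \<le> f \<longrightarrow> q = f"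
  proof (rule predicate_Zorn[of S "\<lambda>x y. y \<le> x"])
    show "partial_order_on S (relation_of (\<lambda>x y. y \<le> x) S)"
      by (rule partial_order_on_relation_ofI) auto
    fix C assume "C \<in> Chains (relation_of (\<lambda>x y. y \<le> x) S)"
    then have C: "C \<subseteq> S" "\<And>q r. q \<in> C \<Longrightarrow> r \<in> C \<Longrightarrow> q \<le> r \<or> r \<le> q"
      by (auto simp: Chains_def relation_of_def)
    show "\<exists>u\<in>S. \<forall>q\<in>C. u \<le> q"
    proof (cases "C = {}")
      case True
      then show ?thesis using \<open>p' \<in> S\<close> by auto
    next
      case False
      define u where "u = (\<lambda>x. INF q\<in>C. q x)"
      have u: "sublinear u" "q \<in> C \<Longrightarrow> u \<le> q" for q
        unfolding u_def using sublinear_chain_INF[of C p'] C False by (auto simp: S_def)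
      with False C(1) have "u \<in> S" by (fastforce simp: S_def)
      with u show ?thesis by blast
    qed
  qed
  then obtain f where f: "sublinear f" "f \<le> p'" and
    min: "\<And>q. sublinear q \<Longrightarrow> q \<le> f \<Longrightarrow> q = f"
    unfolding S_def by (auto intro: order_trans)
  have add: "f (x + y) = f x + f y" for x y
  proof (rule antisym)
    show "f (x + y) \<le> f x + f y" using f(1) by (simp add: sublinear_def)
    let ?g = "\<lambda>x. INF t\<in>{0..}. f (x + t *\<^sub>R y) - t * f y"
    have "?g = f"
      by (rule min[OF sublinear_shift(1)[OF f(1)]]) (auto simp: le_fun_def sublinear_shift(2)[OF f(1)])
    then have "?g x = f x" by (rule fun_cong)
    then show "f x + f y \<le> f (x + y)"
      using sublinear_shift(3)[OF f(1), where x = x and a = y] by simp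
  qed
  have minus: "f (- x) = - f x" for x
    using add[of x "- x"] sublinear_zero[OF f(1)] by simp
  have "linear f"
  proof (rule linearI)
    fix t :: real and x
    show "f (t *\<^sub>R x) = t *\<^sub>R f x"
    proof (cases "0 \<le> t")
      case True
      then show ?thesis using f(1) by (simp add: sublinear_def)
    next
      case False
      moreover have "\<forall>t\<ge>0. \<forall>x. f (t *\<^sub>R x) = t * f x" using f(1) by (simp add: sublinear_def)
      ultimately have "f ((- t) *\<^sub>R x) = (- t) * f x" by (metis le_cases neg_0_le_iff_le)
      then show ?thesis using minus[of "t *\<^sub>R x"] by simp
    qed
  qed (rule add)
  moreover have "f x \<le> p x" for x
    using f(2) p'(2)[of x] by (auto simp: le_fun_def intro: order_trans)
  moreover have "f a = p a"
  proof (rule antisym)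
    have "f (- a) \<le> p' (- a)" using f(2) by (simp add: le_fun_def)
    also have "\<dots> \<le> p (- a + a) - p a" by (rule p'(3))
    also have "\<dots> = - p a" using sublinear_zero[OF p] by simp
    finally show "p a \<le> f a" by (simp add: minus)
  qed fact
  ultimately show thesis using that by blast
qed

text \<open>A real functional is the real part of the complex functional l(x) - i l(ix). Rotating
  the argument by a phase makes the complex value real and nonnegative, so the one-sided bound on
  \<open>l\<close> bounds the modulus with the same constant.\<close>

lemma cdual_of_linear:
  fixes l :: "'a::complex_banach \<Rightarrow> real"
  assumes "linear l" and l: "\<And>x. l x \<le> C * norm x" and "0 \<le> C"
  obtains g where "\<And>x. Re (cdual_apply g x) = l x" "norm g \<le> C"
proof -
  interpret linear l by fact
  have abs: "\<bar>l x\<bar> \<le> C * norm x" for x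
    using l[of x] l[of "- x"] by (simp add: neg)
  define f where "f x = Complex (l x) (- l (\<i> *\<^sub>C x))" for x
  have decomp: "c *\<^sub>C x = Re c *\<^sub>R x + Im c *\<^sub>R (\<i> *\<^sub>C x)" for c and x :: 'a
  proof -
    have "c *\<^sub>C x = (of_real (Re c) + of_real (Im c) * \<i>) *\<^sub>C x"
      by (rule arg_cong[of _ _ "\<lambda>c. c *\<^sub>C x"]) (simp add: complex_eq_iff)
    then show ?thesis
      by (simp only: scaleC_add_left scaleC_of_real flip: scaleC_scaleC)
  qed
  have lin: "l (c *\<^sub>C x) = Re c * l x + Im c * l (\<i> *\<^sub>C x)" for c x
    by (simp only: decomp[of c x] add scaleR real_scaleR_def)
  have "clinear f"
  proof -
    have "f (x + y) = f x + f y" for x y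
      by (simp add: f_def add scaleC_add_right complex_eq_iff)
    moreover have "f (c *\<^sub>C x) = c *\<^sub>C f x" for c x
      by (simp add: f_def lin[of c x] lin[of "\<i> * c" x] scaleC_scaleC scaleC_complex_def
          complex_eq_iff algebra_simps)
    ultimately show ?thesis by (simp add: clinear_def)
  qed
  moreover have bd: "cmod (f x) \<le> C * norm x" for x
  proof (cases "f x = 0")
    case False
    define c where "c = cnj (f x) / of_real (cmod (f x))"
    have "f (c *\<^sub>C x) = of_real (cmod (f x))"
      using False complex_norm_square[of "f x"] clinear_scaleC[OF \<open>clinear f\<close>]
      by (simp add: c_def scaleC_complex_def field_simps power2_eq_square)
    then have "cmod (f x) = l (c *\<^sub>C x)"
      by (simp add: f_def complex_eq_iff)
    also have "\<dots> \<le> C * norm (c *\<^sub>C x)" by (rule l)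
    also have "norm (c *\<^sub>C x) = norm x"
      using False by (simp add: c_def norm_scaleC norm_divide)
    finally show ?thesis .
  qed (use \<open>0 \<le> C\<close> in auto)
  ultimately obtain g where "cdual_apply g = f" "norm g \<le> max C 0"
    using cdual_of_clinear by blast
  with \<open>0 \<le> C\<close> show thesis by (intro that) (auto simp: f_def)
qed

text \<open>The nontrivial half needs a norming functional: Hahn--Banach for the norm itself, with
  equality at \<open>x\<close>.\<close>

lemma norm_canonical_embedding [simp]: "norm (canonical_embedding x) = norm x"
proof (rule antisym)
  have "sublinear (norm :: 'a \<Rightarrow> real)"
    by (auto simp: sublinear_def norm_triangle_ineq)
  then obtain l :: "'a \<Rightarrow> real" where l: "linear l" "\<And>y. l y \<le> norm y" "l x = norm x"
    using Hahn_Banach by blast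
  obtain g where g: "\<And>y. Re (cdual_apply g y) = l y" "norm g \<le> 1"
    using cdual_of_linear[of l 1] l(1,2) by auto
  have "norm x = Re (cdual_apply (canonical_embedding x) g)"
    by (simp add: cdual_apply_canonical_embedding g l)
  also have "\<dots> \<le> norm (canonical_embedding x) * norm g"
    using complex_Re_le_cmod norm_cdual_apply order_trans by blast
  also have "\<dots> \<le> norm (canonical_embedding x)"
    using g(2) by (simp add: mult_left_le)
  finally show "norm x \<le> norm (canonical_embedding x)" .
qed (rule norm_canonical_embedding_le)


subsection \<open>A weak form of local reflexivity\<close>

text \<open>The separation argument takes place in a finite power of a Banach space, represented by
  functions on the whole index type. Only the vector space structure is needed, since a gauge
  replaces the topology.\<close>

instantiation "fun" :: (type, real_vector) real_vector
begin

definition scaleR_fun :: "real \<Rightarrow> ('a \<Rightarrow> 'b) \<Rightarrow> 'a \<Rightarrow> 'b"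
  where "scaleR_fun r f = (\<lambda>x. r *\<^sub>R f x)"

instance
  by standard (auto simp: scaleR_fun_def fun_eq_iff algebra_simps)

end

text \<open>This is the Minkowski functional of a convex absorbing set, where \<open>G t u\<close>
  stands for membership of \<open>u\<close> in t times the set. A relation is used so that t = 0 is
  meaningful and can admit nonzero vectors.\<close>

lemma sublinear_gauge:
  fixes G :: "real \<Rightarrow> 'a::real_vector \<Rightarrow> bool"
  assumes ex: "\<And>u. \<exists>t\<ge>0. G t u"
    and add: "\<And>s t u v. 0 \<le> s \<Longrightarrow> 0 \<le> t \<Longrightarrow> G s u \<Longrightarrow> G t v \<Longrightarrow> G (s + t) (u + v)"
    and scale: "\<And>c t u. 0 \<le> c \<Longrightarrow> 0 \<le> t \<Longrightarrow> G t u \<Longrightarrow> G (c * t) (c *\<^sub>R u)"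
  defines "q \<equiv> \<lambda>u. Inf {t. 0 \<le> t \<and> G t u}"
  shows "sublinear q" and "0 \<le> t \<Longrightarrow> G t u \<Longrightarrow> q u \<le> t"
    and "q u < c \<Longrightarrow> \<exists>t\<ge>0. t < c \<and> G t u"
proof -
  have bdd: "bdd_below {t. 0 \<le> t \<and> G t u}" for u
    by (rule bdd_belowI[of _ 0]) auto
  have ne: "{t. 0 \<le> t \<and> G t u} \<noteq> {}" for u using ex by blast
  show le: "q u \<le> t" if "0 \<le> t" "G t u" for t u
    unfolding q_def using that bdd by (auto intro: cInf_lower)
  show approx: "\<exists>t\<ge>0. t < c \<and> G t u" if "q u < c" for c u
    using that cInf_less_iff[OF ne bdd] unfolding q_def by auto
  have ge0: "0 \<le> q u" for u
    unfolding q_def by (rule cInf_greatest[OF ne]) auto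
  have sc: "q (c *\<^sub>R u) \<le> c * q u" if "0 \<le> c" for c u
  proof (rule field_le_epsilon)
    fix e :: real assume "0 < e"
    have "0 < e / (c + 1)" using \<open>0 < e\<close> that by simp
    then obtain t where t: "0 \<le> t" "t < q u + e / (c + 1)" "G t u"
      using approx[of u "q u + e / (c + 1)"] by auto
    have "q (c *\<^sub>R u) \<le> c * t" using t that by (intro le scale) auto
    also have "\<dots> \<le> c * (q u + e / (c + 1))" using t that by (intro mult_left_mono) auto
    also have "\<dots> \<le> c * q u + e"
      using \<open>0 < e\<close> that by (simp add: field_simps)
    finally show "q (c *\<^sub>R u) \<le> c * q u + e" .
  qed
  show "sublinear q"
    unfolding sublinear_def
  proof safe
    fix u v :: 'a
    show "q (u + v) \<le> q u + q v"
    proof (rule field_le_epsilon)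
      fix e :: real assume "0 < e"
      then obtain s t where "0 \<le> s" "s < q u + e/2" "G s u" "0 \<le> t" "t < q v + e/2" "G t v"
        using approx[of u "q u + e/2"] approx[of v "q v + e/2"] by auto
      then show "q (u + v) \<le> q u + q v + e"
        using le[OF _ add[of s t u v]] by auto
    qed
  next
    fix c :: real and u :: 'a assume "0 \<le> c"
    show "q (c *\<^sub>R u) = c * q u"
    proof (cases "c = 0")
      case True
      then show ?thesis using sc[of 0 u] ge0[of 0] by simp
    next
      case False
      then show ?thesis
        using \<open>0 \<le> c\<close> sc[of "inverse c" "c *\<^sub>R u"] sc[of c u] by (simp add: field_simps)
    qed
  qed
qed

text \<open>The set of all \<open>u\<close> for which the conclusion holds is convex with nonempty interior in
  \<open>'g\<^sup>I\<close>. A functional separating \<open>v\<close> from it is a family \<open>g\<close> violating the hypothesis.\<close>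

lemma bidual_approximation:
  fixes T :: "'i \<Rightarrow> 'n \<Rightarrow> 'e::complex_banach \<Rightarrow> 'g::complex_banach"
  assumes fin: "finite I" "finite N"
    and cl: "\<And>i n. clinear (T i n)" and bl: "\<And>i n. bounded_linear (T i n)"
    and H: "\<And>g \<psi>. (\<And>n x. n \<in> N \<Longrightarrow> cdual_apply (\<psi> n) x = (\<Sum>i\<in>I. cdual_apply (g i) (T i n x))) \<Longrightarrow>
      Re (\<Sum>i\<in>I. cdual_apply (g i) (v i)) \<le>
      Re (\<Sum>n\<in>N. cdual_apply (z n) (\<psi> n)) + r * (\<Sum>i\<in>I. norm (g i))"
    and "0 \<le> r" "0 < d"
  obtains x where "\<And>n. n \<in> N \<Longrightarrow> norm (x n) \<le> norm (z n)"
    and "\<And>i. i \<in> I \<Longrightarrow> norm (v i - (\<Sum>n\<in>N. T i n (x n))) \<le> r + d"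
proof (rule ccontr)
  assume "\<not> thesis"
  \<comment> \<open>The slack \<open>d\<close> makes the convex set absorbing even for r = 0, and it
    is what survives in the final contradiction.\<close>
  define s where "s = r + d"
  have "0 < s" using \<open>0 \<le> r\<close> \<open>0 < d\<close> by (simp add: s_def)
  define G where "G t u \<longleftrightarrow> (\<exists>x. (\<forall>n\<in>N. norm (x n) \<le> t * norm (z n)) \<and>
    (\<forall>i\<in>I. norm (u i - (\<Sum>n\<in>N. T i n (x n))) \<le> t * s))" for t u
  have notG: "\<not> G 1 v" using \<open>\<not> thesis\<close> that by (auto simp: G_def s_def)
  have lin: "linear (T i n)" for i n using bl bounded_linear.linear by blast
  note T = linear_add[OF lin] linear_cmul[OF lin] linear_0[OF lin]
  define q where "q u = Inf {t. 0 \<le> t \<and> G t u}" for u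
  have ex: "\<exists>t\<ge>0. G t u" for u
  proof (intro exI conjI)
    show "0 \<le> (\<Sum>i\<in>I. norm (u i)) / s" using \<open>0 < s\<close> by (simp add: sum_nonneg)
    show "G ((\<Sum>i\<in>I. norm (u i)) / s) u"
      unfolding G_def using \<open>0 < s\<close> fin
      by (intro exI[of _ "\<lambda>_. 0"]) (auto simp: T sum_nonneg intro!: member_le_sum)
  qed
  have Gadd: "G (a + b) (u + w)" if "G a u" "G b w" for a b u w
  proof -
    from that obtain x y where
      "\<And>n. n \<in> N \<Longrightarrow> norm (x n) \<le> a * norm (z n)" "\<And>n. n \<in> N \<Longrightarrow> norm (y n) \<le> b * norm (z n)"
      and xy: "\<And>i. i \<in> I \<Longrightarrow> norm (u i - (\<Sum>n\<in>N. T i n (x n))) \<le> a * s"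
       "\<And>i. i \<in> I \<Longrightarrow> norm (w i - (\<Sum>n\<in>N. T i n (y n))) \<le> b * s"
      unfolding G_def by blast
    moreover have "norm ((u + w) i - (\<Sum>n\<in>N. T i n (x n + y n))) \<le> (a + b) * s" if "i \<in> I" for i
      using norm_triangle_le[OF add_mono[OF xy[OF that]]]
      by (simp add: T sum.distrib algebra_simps)
    ultimately show ?thesis
      unfolding G_def
      by (intro exI[of _ "\<lambda>n. x n + y n"]) (auto simp: ring_distribs intro: norm_triangle_le add_mono)
  qed
  have Gscale: "G (c * a) (c *\<^sub>R u)" if "0 \<le> c" "G a u" for c a u
  proof -
    from that obtain x where x: "\<And>n. n \<in> N \<Longrightarrow> norm (x n) \<le> a * norm (z n)"
      "\<And>i. i \<in> I \<Longrightarrow> norm (u i - (\<Sum>n\<in>N. T i n (x n))) \<le> a * s"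
      unfolding G_def by blast
    have "norm ((c *\<^sub>R u) i - (\<Sum>n\<in>N. T i n (c *\<^sub>R x n))) \<le> c * a * s" if "i \<in> I" for i
    proof -
      have "(c *\<^sub>R u) i - (\<Sum>n\<in>N. T i n (c *\<^sub>R x n)) = c *\<^sub>R (u i - (\<Sum>n\<in>N. T i n (x n)))"
        by (simp add: T scaleR_fun_def scaleR_diff_right scaleR_sum_right)
      then show ?thesis
        using mult_left_mono[OF x(2)[OF that] \<open>0 \<le> c\<close>] \<open>0 \<le> c\<close> by (simp add: mult.assoc)
    qed
    moreover have "norm (c *\<^sub>R x n) \<le> c * a * norm (z n)" if "n \<in> N" for n
      using mult_left_mono[OF x(1)[OF that] \<open>0 \<le> c\<close>] \<open>0 \<le> c\<close> by (simp add: mult.assoc)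
    ultimately show ?thesis
      unfolding G_def by (intro exI[of _ "\<lambda>n. c *\<^sub>R x n"]) auto
  qed
  have gauge: "sublinear q" "0 \<le> t \<Longrightarrow> G t u \<Longrightarrow> q u \<le> t" "q u < c \<Longrightarrow> \<exists>t\<ge>0. t < c \<and> G t u" for t u c
    by (rule sublinear_gauge[of G, folded q_def]; (assumption | blast intro: ex Gadd Gscale))+
  have "1 \<le> q v"
  proof (rule ccontr)
    assume "\<not> 1 \<le> q v"
    then obtain t where t: "0 \<le> t" "t < 1" "G t v" using gauge(3)[of v 1] by auto
    have "G (1 - t) 0"
      unfolding G_def using t(2) \<open>0 < s\<close> by (intro exI[of _ "\<lambda>_. 0"]) (auto simp: T)
    from Gadd[OF t(3) this] notG show False by simp
  qed
  obtain l where l: "linear l" "\<And>u. l u \<le> q u" "l v = q v"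
    using Hahn_Banach[OF gauge(1)] by blast
  have l_le: "l u \<le> t" if "0 \<le> t" "G t u" for t u
    using l(2)[of u] gauge(2)[OF that] by simp
  define e where "e i y = (\<lambda>j. if j = i then y else 0 :: 'g)" for i :: 'i and y
  have "\<exists>g. \<forall>y. Re (cdual_apply g y) = l (e i y)" for i
  proof -
    have lin_e: "linear (e i)"
      by (rule linearI) (auto simp: e_def scaleR_fun_def fun_eq_iff)
    have "l (e i y) \<le> 1 / s * norm y" for y
    proof (rule l_le)
      show "G (1 / s * norm y) (e i y)"
        unfolding G_def using \<open>0 < s\<close> by (intro exI[of _ "\<lambda>_. 0"]) (auto simp: e_def T)
    qed (use \<open>0 < s\<close> in auto)
    moreover have "linear (\<lambda>y. l (e i y))"
      using linear_compose[OF lin_e l(1)] by (simp add: o_def)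
    moreover have "0 \<le> 1 / s" using \<open>0 < s\<close> by simp
    ultimately obtain g where "\<And>y. Re (cdual_apply g y) = l (e i y)"
      using cdual_of_linear[of "\<lambda>y. l (e i y)" "1 / s"] by blast
    then show ?thesis by blast
  qed
  then obtain g where g: "\<And>i y. Re (cdual_apply (g i) y) = l (e i y)" by metis
  have l_eq: "l u = Re (\<Sum>i\<in>I. cdual_apply (g i) (u i))" for u
  proof -
    let ?w = "u - (\<Sum>i\<in>I. e i (u i))"
    have sum_apply: "(\<Sum>i\<in>J. e i (u i)) j = (if j \<in> J then u j else 0)" if "finite J" for J j
      using that by (induction J) (auto simp: e_def)
    \<comment> \<open>\<open>G\<close> does not see coordinates outside \<open>I\<close>, so the
      remainder and its negative both have gauge zero.\<close>
    have "G 0 ?w" "G 0 (- ?w)"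
      unfolding G_def using fin by (auto simp: sum_apply T intro!: exI[of _ "\<lambda>_. 0"])
    from l_le[OF _ this(1)] l_le[OF _ this(2)] have "l ?w = 0"
      unfolding linear_neg[OF l(1)] by linarith
    then show ?thesis
      by (simp add: linear_diff[OF l(1)] linear_sum[OF l(1)] g)
  qed
  have "\<exists>\<psi>. \<forall>x. cdual_apply \<psi> x = (\<Sum>i\<in>I. cdual_apply (g i) (T i n x))" for n
  proof -
    have "bounded_linear (\<lambda>x. \<Sum>i\<in>I. cdual_apply (g i) (T i n x))"
      by (intro bounded_linear_sum bounded_linear_compose[OF bounded_linear_cdual_apply] bl)
    from bounded_linear.bounded[OF this]
    obtain K where "\<And>x. cmod (\<Sum>i\<in>I. cdual_apply (g i) (T i n x)) \<le> K * norm x"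
      by (auto simp: mult.commute)
    moreover have "clinear (\<lambda>x. \<Sum>i\<in>I. cdual_apply (g i) (T i n x))"
      unfolding clinear_def
      by (auto simp: clinear_add[OF cl] clinear_scaleC[OF cl] cdual_apply_simps cdual_apply_scaleC
          sum.distrib scaleC_complex_def sum_distrib_left)
    ultimately obtain \<psi> where "cdual_apply \<psi> = (\<lambda>x. \<Sum>i\<in>I. cdual_apply (g i) (T i n x))"
      using cdual_of_clinear by blast
    then show ?thesis by (intro exI[of _ \<psi>]) simp
  qed
  then obtain \<psi> where \<psi>: "\<And>n x. cdual_apply (\<psi> n) x = (\<Sum>i\<in>I. cdual_apply (g i) (T i n x))"
    by metis
  \<comment> \<open>The functional \<open>l\<close> is at most 1 on the convex set. There the points
    of the balls around 0 can be varied independently, so all the functionals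
    \<open>\<psi> n\<close> and \<open>g i\<close> are nearly normed at once and their weighted
    norms add up.\<close>
  have key: "(\<Sum>n\<in>N. norm (z n) * norm (\<psi> n)) + s * (\<Sum>i\<in>I. norm (g i)) \<le> 1"
  proof (rule field_le_epsilon)
    fix e' :: real assume "0 < e'"
    define K where "K = (\<Sum>n\<in>N. norm (z n)) + s * card I"
    have "0 \<le> K" using \<open>0 < s\<close> by (simp add: K_def sum_nonneg)
    \<comment> \<open>The total loss is \<open>K\<close> times \<open>e''\<close>; the added 1
      guards against K = 0.\<close>
    define e'' where "e'' = e' / (K + 1)"
    have "0 < e''" using \<open>0 \<le> K\<close> \<open>0 < e'\<close> by (simp add: e''_def)
    have "e' * K \<le> e' * (K + 1)" using \<open>0 < e'\<close> by simp
    then have "e'' * K \<le> e'"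
      using \<open>0 \<le> K\<close> by (simp add: e''_def pos_divide_le_eq)
    have "\<forall>n. \<exists>x. norm x \<le> 1 \<and> norm (\<psi> n) - e'' \<le> Re (cdual_apply (\<psi> n) x)"
      by (intro allI norm_cdual_approx') fact
    from choice[OF this] obtain x where x: "\<And>n. norm (x n) \<le> 1"
      "\<And>n. norm (\<psi> n) - e'' \<le> Re (cdual_apply (\<psi> n) (x n))" by blast
    have "\<forall>i. \<exists>x. norm x \<le> 1 \<and> norm (g i) - e'' \<le> Re (cdual_apply (g i) x)"
      by (intro allI norm_cdual_approx') fact
    from choice[OF this] obtain y where y: "\<And>i. norm (y i) \<le> 1"
      "\<And>i. norm (g i) - e'' \<le> Re (cdual_apply (g i) (y i))" by blast
    define u where "u i = (\<Sum>n\<in>N. T i n (norm (z n) *\<^sub>R x n)) + s *\<^sub>R y i" for i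
    have "G 1 u"
      unfolding G_def using \<open>0 < s\<close> x(1) y(1)
      by (intro exI[of _ "\<lambda>n. norm (z n) *\<^sub>R x n"]) (auto simp: u_def mult_left_le)
    from l_le[OF _ this] have "l u \<le> 1" by simp
    moreover have "l u = (\<Sum>n\<in>N. norm (z n) * Re (cdual_apply (\<psi> n) (x n))) + s * (\<Sum>i\<in>I. Re (cdual_apply (g i) (y i)))"
    proof -
      have "cdual_apply (g i) (u i) =
          (\<Sum>n\<in>N. norm (z n) *\<^sub>R cdual_apply (g i) (T i n (x n))) + s *\<^sub>R cdual_apply (g i) (y i)" for i
        by (simp add: u_def cdual_apply_simps T)
      then have "(\<Sum>i\<in>I. cdual_apply (g i) (u i)) =
          (\<Sum>n\<in>N. norm (z n) *\<^sub>R cdual_apply (\<psi> n) (x n)) + s *\<^sub>R (\<Sum>i\<in>I. cdual_apply (g i) (y i))"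
        by (simp only: \<psi> sum.distrib scaleR_sum_right sum.swap[of _ N I])
      then show ?thesis by (simp add: l_eq)
    qed
    moreover have "(\<Sum>n\<in>N. norm (z n) * (norm (\<psi> n) - e'')) + s * (\<Sum>i\<in>I. norm (g i) - e'') \<le>
      (\<Sum>n\<in>N. norm (z n) * Re (cdual_apply (\<psi> n) (x n))) + s * (\<Sum>i\<in>I. Re (cdual_apply (g i) (y i)))"
      using \<open>0 < s\<close> x(2) y(2) by (intro add_mono sum_mono mult_left_mono) auto
    moreover have "(\<Sum>n\<in>N. norm (z n) * (norm (\<psi> n) - e'')) + s * (\<Sum>i\<in>I. norm (g i) - e'') =
       (\<Sum>n\<in>N. norm (z n) * norm (\<psi> n)) + s * (\<Sum>i\<in>I. norm (g i)) - e'' * K"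
      by (simp add: K_def right_diff_distrib sum_subtractf sum_distrib_left algebra_simps)
    ultimately show "(\<Sum>n\<in>N. norm (z n) * norm (\<psi> n)) + s * (\<Sum>i\<in>I. norm (g i)) \<le> 1 + e'"
      using \<open>e'' * K \<le> e'\<close> by linarith
  qed
  have "1 \<le> Re (\<Sum>i\<in>I. cdual_apply (g i) (v i))"
    using \<open>1 \<le> q v\<close> l(3) l_eq by simp
  also have "\<dots> \<le> Re (\<Sum>n\<in>N. cdual_apply (z n) (\<psi> n)) + r * (\<Sum>i\<in>I. norm (g i))"
    by (rule H) (simp add: \<psi>)
  also have "Re (\<Sum>n\<in>N. cdual_apply (z n) (\<psi> n)) \<le> (\<Sum>n\<in>N. norm (z n) * norm (\<psi> n))"
    unfolding Re_sum
    by (intro sum_mono order_trans[OF complex_Re_le_cmod norm_cdual_apply])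
  \<comment> \<open>The hypothesis bounds the value with \<open>r\<close> where \<open>key\<close>
    has \<open>s\<close>, and the difference is the slack \<open>d\<close>. Hence \<open>g\<close>
    vanishes on \<open>I\<close>, so that l v = 0, against q v >= 1.\<close>
  finally have "d * (\<Sum>i\<in>I. norm (g i)) \<le> 0"
    using key by (simp add: s_def algebra_simps)
  then have "(\<Sum>i\<in>I. norm (g i)) = 0"
    using \<open>0 < d\<close> by (metis antisym mult_le_0_iff norm_ge_zero not_le sum_nonneg)
  then have "\<forall>i\<in>I. g i = 0" using fin by (simp add: sum_nonneg_eq_0_iff)
  then have "l v = 0" by (simp add: l_eq cdual_apply_left_linear)
  with \<open>1 \<le> q v\<close> l(3) show False by simp
qed

text \<open>This is \<open>bidual_approximation\<close> for a single vector, the functionals in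
  \<open>\<Phi>\<close> being both the operators and their own indices, with r = 0. A functional on
  the scalars is multiplication by its value at 1, so \<open>\<psi>\<close> is a linear combination
  of \<open>\<Phi>\<close> and the hypothesis holds with equality.\<close>

theorem Goldstine:
  fixes z :: "'e::complex_banach cdual cdual"
  assumes "finite \<Phi>" "0 < d"
  obtains x where "norm x \<le> norm z"
    and "\<And>\<phi>. \<phi> \<in> \<Phi> \<Longrightarrow> cmod (cdual_apply z \<phi> - cdual_apply \<phi> x) \<le> d"
proof -
  obtain x where "\<And>n::unit. n \<in> {()} \<Longrightarrow> norm (x n) \<le> norm z"
    "\<And>\<phi>. \<phi> \<in> \<Phi> \<Longrightarrow> norm (cdual_apply z \<phi> - (\<Sum>n\<in>{()}. cdual_apply \<phi> (x n))) \<le> 0 + d"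
  proof (rule bidual_approximation[of \<Phi> "{()}" "\<lambda>\<phi> n. cdual_apply \<phi>" "\<lambda>\<phi>. cdual_apply z \<phi>" "\<lambda>_. z" 0 d])
    fix g :: "'e cdual \<Rightarrow> complex cdual" and \<psi> :: "unit \<Rightarrow> 'e cdual"
    assume \<psi>: "\<And>n x. n \<in> {()} \<Longrightarrow> cdual_apply (\<psi> n) x = (\<Sum>i\<in>\<Phi>. cdual_apply (g i) (cdual_apply i x))"
    have g: "cdual_apply (g i) c = cdual_apply (g i) 1 * c" for i c
      using cdual_apply_scaleC[of "g i" c 1] by (simp add: scaleC_complex_def mult.commute)
    have "\<psi> () = (\<Sum>i\<in>\<Phi>. cdual_apply (g i) 1 *\<^sub>C i)"
      by (rule cdual_eqI) (simp add: \<psi> cdual_apply_sum_left cdual_apply_left_linear flip: g)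
    then show "Re (\<Sum>i\<in>\<Phi>. cdual_apply (g i) (cdual_apply z i)) \<le>
       Re (\<Sum>n\<in>{()}. cdual_apply z (\<psi> n)) + 0 * (\<Sum>i\<in>\<Phi>. norm (g i))"
      by (simp add: cdual_apply_simps cdual_apply_scaleC flip: g)
  qed (use assms in \<open>auto simp: clinear_cdual_apply bounded_linear_cdual_apply\<close>)
  then show thesis using that[of "x ()"] by simp
qed

subsection \<open>The unit ball of $\ell_q$ by duality\<close>

text \<open>The unit ball of \<open>\<ell>\<^sub>q\<close> on an arbitrary index type, tested against the unit ball
  of \<open>\<ell>\<^sub>p\<close>, so that \<open>p = 1\<close> needs no separate treatment.\<close>

definition dual_ball :: "real \<Rightarrow> ('i \<Rightarrow> complex) \<Rightarrow> bool"
  where "dual_ball p \<alpha> \<longleftrightarrow> (\<forall>A b. finite A \<longrightarrow> (\<forall>i\<in>A. 0 \<le> b i) \<longrightarrow>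
    (\<Sum>i\<in>A. b i powr p) \<le> 1 \<longrightarrow> (\<Sum>i\<in>A. cmod (\<alpha> i) * b i) \<le> 1)"

text \<open>Finite partial sums express that the l_p norm is at most \<open>c\<close> over any index
  type, in particular over pairs.\<close>

definition lp_le :: "real \<Rightarrow> real \<Rightarrow> ('i \<Rightarrow> 'a::real_normed_vector) \<Rightarrow> bool"
  where "lp_le p c y \<longleftrightarrow> 0 \<le> c \<and> (\<forall>A. finite A \<longrightarrow> (\<Sum>i\<in>A. norm (y i) powr p) \<le> c powr p)"

lemma dual_ballD:
  "dual_ball p \<alpha> \<Longrightarrow> finite A \<Longrightarrow> (\<And>i. i \<in> A \<Longrightarrow> 0 \<le> b i) \<Longrightarrow> (\<Sum>i\<in>A. b i powr p) \<le> 1 \<Longrightarrow>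
    (\<Sum>i\<in>A. cmod (\<alpha> i) * b i) \<le> 1"
  by (simp add: dual_ball_def)

text \<open>Hoelder's inequality in homogeneous form; c = 0 is separate because the normalisation
  divides by \<open>c\<close>.\<close>

lemma dual_ball_scaled:
  assumes "dual_ball p \<alpha>" "1 \<le> p" "finite A" "\<And>i. i \<in> A \<Longrightarrow> 0 \<le> b i"
    "(\<Sum>i\<in>A. b i powr p) \<le> c powr p" "0 \<le> c"
  shows "(\<Sum>i\<in>A. cmod (\<alpha> i) * b i) \<le> c"
proof (cases "c = 0")
  case True
  with assms have "(\<Sum>i\<in>A. b i powr p) = 0"
    by (intro antisym sum_nonneg) auto
  with assms have "\<forall>i\<in>A. b i = 0" by (subst (asm) sum_nonneg_eq_0_iff) auto
  with True show ?thesis by simp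
next
  case False
  with assms have "0 < c" by simp
  have "(\<Sum>i\<in>A. cmod (\<alpha> i) * (b i / c)) \<le> 1"
  proof (rule dual_ballD[OF assms(1,3)])
    have "(\<Sum>i\<in>A. (b i / c) powr p) = (\<Sum>i\<in>A. b i powr p) / c powr p"
      using assms(4) \<open>0 < c\<close> by (simp add: powr_divide sum_divide_distrib)
    also have "\<dots> \<le> 1" using assms(5) \<open>0 < c\<close> by (simp add: divide_le_eq)
    finally show "(\<Sum>i\<in>A. (b i / c) powr p) \<le> 1" .
  qed (use assms(4) \<open>0 < c\<close> in auto)
  then show ?thesis
    using \<open>0 < c\<close> by (simp flip: sum_divide_distrib)
qed

text \<open>Absolute convexity of the ball. The halving keeps a difference of two coefficient
  families inside; the factor 2 is later moved onto the vectors.\<close>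

lemma dual_ball_half_diff:
  fixes \<alpha> \<beta> :: "'i \<Rightarrow> complex"
  assumes "dual_ball p \<alpha>" "dual_ball p \<beta>"
  shows "dual_ball p (\<lambda>i. (\<alpha> i - \<beta> i) / 2)"
  unfolding dual_ball_def
proof (intro allI impI)
  fix A :: "'i set" and b :: "'i \<Rightarrow> real"
  assume *: "finite A" "\<forall>i\<in>A. 0 \<le> b i" "(\<Sum>i\<in>A. b i powr p) \<le> 1"
  have "(\<Sum>i\<in>A. cmod ((\<alpha> i - \<beta> i) / 2) * b i) \<le> (\<Sum>i\<in>A. (cmod (\<alpha> i) * b i + cmod (\<beta> i) * b i) / 2)"
  proof (rule sum_mono)
    fix i assume "i \<in> A"
    then show "cmod ((\<alpha> i - \<beta> i) / 2) * b i \<le> (cmod (\<alpha> i) * b i + cmod (\<beta> i) * b i) / 2"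
      using mult_right_mono[OF norm_triangle_ineq4[of "\<alpha> i" "\<beta> i"], of "b i"] *(2)
      by (simp add: norm_divide field_simps)
  qed
  also have "\<dots> = ((\<Sum>i\<in>A. cmod (\<alpha> i) * b i) + (\<Sum>i\<in>A. cmod (\<beta> i) * b i)) / 2"
    by (simp add: sum.distrib flip: sum_divide_distrib)
  also have "\<dots> \<le> 1"
    using dual_ballD[OF assms(1) *(1) _ *(3)] dual_ballD[OF assms(2) *(1) _ *(3)] *(2) by simp
  finally show "(\<Sum>i\<in>A. cmod ((\<alpha> i - \<beta> i) / 2) * b i) \<le> 1" .
qed

lemma powr_le_one_imp_le_one:
  fixes b p :: real
  assumes "0 \<le> b" "b powr p \<le> 1" "1 \<le> p"
  shows "b \<le> 1"
proof (rule ccontr)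
  assume "\<not> b \<le> 1"
  then have "1 powr p < b powr p" using assms by (intro powr_less_mono2) auto
  with assms show False by simp
qed

lemma dual_ball_le_one:
  assumes "dual_ball p \<alpha>"
  shows "cmod (\<alpha> i) \<le> 1"
  using dual_ballD[OF assms, of "{i}" "\<lambda>_. 1"] by simp

lemma dual_ball_single:
  fixes k :: 'i
  assumes "cmod c \<le> 1" "1 \<le> p"
  shows "dual_ball p (\<lambda>i. if i = k then c else 0)"
  unfolding dual_ball_def
proof (intro allI impI)
  fix A :: "'i set" and b :: "'i \<Rightarrow> real"
  assume *: "finite A" "\<forall>i\<in>A. 0 \<le> b i" "(\<Sum>i\<in>A. b i powr p) \<le> 1"
  show "(\<Sum>i\<in>A. cmod (if i = k then c else 0) * b i) \<le> 1"
  proof (cases "k \<in> A")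
    case True
    then have "b k powr p \<le> 1"
      using member_le_sum[of k A "\<lambda>i. b i powr p"] * by simp
    then have "b k \<le> 1"
      by (rule powr_le_one_imp_le_one[rotated]) (use * True assms in auto)
    moreover have "(\<Sum>i\<in>A. cmod (if i = k then c else 0) * b i) = cmod c * b k"
      using True * by (simp add: if_distrib if_distribR cong: if_cong)
    ultimately show ?thesis using assms mult_le_one[of "cmod c" "b k"] * True by simp
  next
    case False
    then show ?thesis by (auto intro!: order_trans[OF eq_refl[OF sum.neutral]])
  qed
qed

section \<open>Agreement with the ball given by the conjugate exponent\<close>

lemma ennreal_conjugate_exponent:
  assumes "1 < p"
  shows "1 / ennreal p + 1 / q = 1 \<longleftrightarrow> q = ennreal (p / (p - 1))"
proof (cases q)
  case (real r)
  show ?thesis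
  proof (cases "r = 0")
    case True
    \<comment> \<open>The reciprocal of 0 is \<open>top\<close> here, so q = 0 is not conjugate to
      any \<open>p\<close>.\<close>
    then show ?thesis using real assms by (simp add: divide_ennreal_def)
  next
    case False
    then have "1 / ennreal p + 1 / q = ennreal (1 / p + 1 / r)"
      using real assms divide_ennreal[of 1 p] divide_ennreal[of 1 r] by (simp flip: ennreal_1)
    also have "\<dots> = 1 \<longleftrightarrow> 1 / p + 1 / r = 1"
      using real assms False unfolding ennreal_1[symmetric] by (subst ennreal_inj) auto
    also have "\<dots> \<longleftrightarrow> r = p / (p - 1)"
      using assms False by (auto simp: field_simps)
    also have "\<dots> \<longleftrightarrow> q = ennreal (p / (p - 1))"
      using assms real by simp
    finally show ?thesis .
  qed
next
  case top
  have "1 / ennreal p = ennreal (1 / p)" using assms divide_ennreal[of 1 p] by simp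
  then show ?thesis using assms top by (auto simp: ennreal_eq_1)
qed

lemma ennreal_conjugate_exponent_one: "1 / ennreal 1 + 1 / q = 1 \<longleftrightarrow> q = top"
proof -
  have "1 + 1 / q = 1 \<longleftrightarrow> 1 / q = 0"
    using ennreal_add_left_cancel[of 1 "1 / q" 0] by simp
  then show ?thesis by (simp add: divide_ennreal_def)
qed

text \<open>Testing \<open>\<alpha>\<close> against its modulus to the power q - 1 yields S <=
  S^(1/p) for every partial sum S of the q-th powers, which forces S <= 1. The converse is Young's
  inequality summed over the finite set.\<close>

lemma dual_ball_iff_powr:
  fixes \<alpha> :: "nat \<Rightarrow> complex"
  assumes "1 < p" and q: "1 / p + 1 / q = 1" and "1 < q"
  shows "dual_ball p \<alpha> \<longleftrightarrow>
    summable (\<lambda>n. cmod (\<alpha> n) powr q) \<and> (\<Sum>n. cmod (\<alpha> n) powr q) \<le> 1"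
proof (intro iffI conjI)
  assume *: "dual_ball p \<alpha>"
  have qp: "(q - 1) * p = q" "q - 1 + 1 = q" using q assms by (auto simp: field_simps)
  have le: "(\<Sum>n<N. cmod (\<alpha> n) powr q) \<le> 1" for N
  proof -
    define S where "S = (\<Sum>n<N. cmod (\<alpha> n) powr q)"
    have "S \<le> S powr (1 / p)"
      
    proof -
      have "(\<Sum>n<N. cmod (\<alpha> n) * cmod (\<alpha> n) powr (q - 1)) \<le> S powr (1 / p)"
      proof (rule dual_ball_scaled[OF *])
        have "(S powr (1 / p)) powr p = S"
          using assms by (simp add: powr_powr S_def sum_nonneg)
        then show "(\<Sum>n<N. (cmod (\<alpha> n) powr (q - 1)) powr p) \<le> (S powr (1 / p)) powr p"
          by (simp add: powr_powr qp S_def)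
      qed (use assms in auto)
      moreover have "cmod (\<alpha> n) * cmod (\<alpha> n) powr (q - 1) = cmod (\<alpha> n) powr q" for n
        using powr_mult_base[of "cmod (\<alpha> n)" "q - 1"] by simp
      ultimately show ?thesis by (simp add: S_def)
    qed
    show ?thesis
    proof (rule ccontr)
      assume "\<not> ?thesis"
      then have "1 < S" by (simp add: S_def)
      then have "S powr (1 / p) < S powr 1" using assms by (intro powr_less_mono) auto
      with \<open>S \<le> S powr (1 / p)\<close> \<open>1 < S\<close> show False by simp
    qed
  qed
  show "summable (\<lambda>n. cmod (\<alpha> n) powr q)"
    using le by (intro summableI_nonneg_bounded[of _ 1]) auto
  then show "(\<Sum>n. cmod (\<alpha> n) powr q) \<le> 1" by (rule suminf_le_const) (use le in auto)
next
  assume *: "summable (\<lambda>n. cmod (\<alpha> n) powr q) \<and> (\<Sum>n. cmod (\<alpha> n) powr q) \<le> 1"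
  show "dual_ball p \<alpha>"
    unfolding dual_ball_def
  proof (intro allI impI)
    fix A :: "nat set" and b :: "nat \<Rightarrow> real"
    assume b: "finite A" "\<forall>i\<in>A. 0 \<le> b i" "(\<Sum>i\<in>A. b i powr p) \<le> 1"
    have "(\<Sum>i\<in>A. cmod (\<alpha> i) * b i) \<le> (\<Sum>i\<in>A. cmod (\<alpha> i) powr q / q + b i powr p / p)"
      using b assms by (intro sum_mono Youngs_inequality) (auto simp: add.commute)
    also have "\<dots> = (\<Sum>i\<in>A. cmod (\<alpha> i) powr q) / q + (\<Sum>i\<in>A. b i powr p) / p"
      by (simp add: sum.distrib sum_divide_distrib)
    also have "\<dots> \<le> 1 / q + 1 / p"
      using b assms * order_trans[OF sum_le_suminf[of "\<lambda>n. cmod (\<alpha> n) powr q" A]]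
      by (intro add_mono divide_right_mono) auto
    finally show "(\<Sum>i\<in>A. cmod (\<alpha> i) * b i) \<le> 1" using q by simp
  qed
qed

lemma dual_ball_iff:
  fixes \<alpha> :: "nat \<Rightarrow> complex"
  assumes "1 \<le> p"
  shows "dual_ball p \<alpha> \<longleftrightarrow> (\<exists>q. 1 / ennreal p + 1 / q = 1 \<and> \<alpha> \<in> ell q \<and> ell_norm q \<alpha> \<le> 1)"
proof (cases "p = 1")
  case True
  have "dual_ball 1 \<alpha> \<longleftrightarrow> (\<forall>n. cmod (\<alpha> n) \<le> 1)"
  proof (intro iffI allI)
    assume *: "\<forall>n. cmod (\<alpha> n) \<le> 1"
    show "dual_ball 1 \<alpha>"
      unfolding dual_ball_def
    proof (intro allI impI)
      fix A :: "nat set" and b :: "nat \<Rightarrow> real"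
      assume b: "finite A" "\<forall>i\<in>A. 0 \<le> b i" "(\<Sum>i\<in>A. b i powr 1) \<le> 1"
      have "(\<Sum>i\<in>A. cmod (\<alpha> i) * b i) \<le> (\<Sum>i\<in>A. b i powr 1)"
        using * b by (intro sum_mono) (auto intro: mult_left_le_one_le)
      with b show "(\<Sum>i\<in>A. cmod (\<alpha> i) * b i) \<le> 1" by simp
    qed
  qed (rule dual_ball_le_one)
  also have "\<dots> \<longleftrightarrow> \<alpha> \<in> ell top \<and> ell_norm top \<alpha> \<le> 1"
  proof
    assume "\<forall>n. cmod (\<alpha> n) \<le> 1"
    then show "\<alpha> \<in> ell top \<and> ell_norm top \<alpha> \<le> 1"
      by (auto simp: ell_def ell_norm_def bounded_iff intro!: cSUP_least)
  next
    assume *: "\<alpha> \<in> ell top \<and> ell_norm top \<alpha> \<le> 1"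
    then obtain B where "\<And>n. cmod (\<alpha> n) \<le> B" by (auto simp: ell_def bounded_iff)
    then have "bdd_above (range (\<lambda>n. cmod (\<alpha> n)))" by (auto simp: bdd_above_def)
    then have "cmod (\<alpha> n) \<le> (SUP n. cmod (\<alpha> n))" for n by (rule cSUP_upper2) auto
    with * show "\<forall>n. cmod (\<alpha> n) \<le> 1" by (auto simp: ell_norm_def intro: order_trans)
  qed
  finally show ?thesis
    using True ennreal_conjugate_exponent_one by auto
next
  case False
  with assms have "1 < p" by simp
  define q where "q = p / (p - 1)"
  have q: "1 / p + 1 / q = 1" "1 < q" using \<open>1 < p\<close> by (auto simp: q_def field_simps)
  have "\<alpha> \<in> ell (ennreal q) \<and> ell_norm (ennreal q) \<alpha> \<le> 1 \<longleftrightarrow>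
    summable (\<lambda>n. cmod (\<alpha> n) powr q) \<and> (\<Sum>n. cmod (\<alpha> n) powr q) \<le> 1"
  proof -
    have "s powr (1 / q) \<le> 1 \<longleftrightarrow> s \<le> 1" if "0 \<le> s" for s
    proof
      assume "s \<le> 1"
      then show "s powr (1 / q) \<le> 1" using that q by (intro powr_le1) auto
    next
      assume "s powr (1 / q) \<le> 1"
      then have "(s powr (1 / q)) powr q \<le> 1" using that q by (intro powr_le1) auto
      then show "s \<le> 1" using that q by (simp add: powr_powr)
    qed
    moreover have "summable (\<lambda>n. cmod (\<alpha> n) powr q) \<Longrightarrow> 0 \<le> (\<Sum>n. cmod (\<alpha> n) powr q)"
      by (rule suminf_nonneg) auto
    ultimately show ?thesis
      using q by (auto simp: ell_def ell_norm_def)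
  qed
  then show ?thesis
    using dual_ball_iff_powr[OF \<open>1 < p\<close> q] ennreal_conjugate_exponent[OF \<open>1 < p\<close>]
    by (auto simp: q_def)
qed

section \<open>Coordinatewise compactness of the ball\<close>

lemma closed_dual_ball: "closed {\<alpha> :: nat \<Rightarrow> complex. dual_ball p \<alpha>}"
  unfolding dual_ball_def
  by (intro closed_Collect_all closed_Collect_imp open_Collect_const closed_Collect_le
      continuous_intros continuous_on_product_coordinates)

text \<open>The function type carries the product topology, so the ball is a closed subset of a
  Tychonoff product of discs. This replaces weak-star compactness of the unit ball of the dual of
  l_p.\<close>

lemma compact_dual_ball: "compact {\<alpha> :: nat \<Rightarrow> complex. dual_ball p \<alpha>}"
proof -
  have "compact (UNIV \<rightarrow>\<^sub>E cball 0 1 :: (nat \<Rightarrow> complex) set)"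
    unfolding compactin_euclidean_iff[symmetric] euclidean_product_topology[symmetric] compactin_PiE
    by auto
  moreover have "{\<alpha>. dual_ball p \<alpha>} \<subseteq> (UNIV \<rightarrow>\<^sub>E cball 0 1)"
    by (auto simp: dual_ball_le_one)
  ultimately show ?thesis
    using closed_dual_ball closed_Int_compact by (metis inf.absorb1)
qed


subsection \<open>Sets inside a $p$-convex hull\<close>

lemma lp_leD: "lp_le p c y \<Longrightarrow> finite A \<Longrightarrow> (\<Sum>i\<in>A. norm (y i) powr p) \<le> c powr p"
  by (simp add: lp_le_def)

lemma lp_le_nonneg: "lp_le p c y \<Longrightarrow> 0 \<le> c"
  by (simp add: lp_le_def)

lemma lp_le_mono:
  fixes y :: "'i \<Rightarrow> 'a::real_normed_vector"
  assumes "lp_le p c y" "1 \<le> p" "c \<le> d" "\<And>i. norm (x i) \<le> norm (y i)"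
  shows "lp_le p d x"
  unfolding lp_le_def
proof (intro conjI allI impI)
  fix A :: "'i set" assume "finite A"
  have "(\<Sum>i\<in>A. norm (x i) powr p) \<le> (\<Sum>i\<in>A. norm (y i) powr p)"
    using assms by (intro sum_mono powr_mono2) auto
  also have "\<dots> \<le> c powr p" by (rule lp_leD) fact+
  also have "\<dots> \<le> d powr p" using assms lp_le_nonneg by (intro powr_mono2) auto
  finally show "(\<Sum>i\<in>A. norm (x i) powr p) \<le> d powr p" .
qed (use assms in \<open>auto dest: lp_le_nonneg\<close>)

lemma lp_le_scale:
  fixes y :: "'i \<Rightarrow> 'a::real_normed_vector"
  assumes "lp_le p c y" "0 \<le> r"
  shows "lp_le p (r * c) (\<lambda>i. r *\<^sub>R y i)"
  unfolding lp_le_def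
proof (intro conjI allI impI)
  fix A :: "'i set" assume "finite A"
  have "(\<Sum>i\<in>A. norm (r *\<^sub>R y i) powr p) = r powr p * (\<Sum>i\<in>A. norm (y i) powr p)"
    using assms by (simp add: powr_mult sum_distrib_left)
  also have "\<dots> \<le> r powr p * c powr p" by (intro mult_left_mono lp_leD assms) (use \<open>finite A\<close> in auto)
  also have "\<dots> = (r * c) powr p" using assms by (simp add: powr_mult lp_le_nonneg)
  finally show "(\<Sum>i\<in>A. norm (r *\<^sub>R y i) powr p) \<le> (r * c) powr p" .
qed (use assms in \<open>auto dest: lp_le_nonneg\<close>)

lemma lp_le_iff_ell:
  assumes "1 \<le> p"
  shows "lp_le p c y \<longleftrightarrow> y \<in> ell (ennreal p) \<and> ell_norm (ennreal p) y \<le> c"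
proof -
  have sum_le: "(\<forall>A. finite A \<longrightarrow> (\<Sum>i\<in>A. norm (y i) powr p) \<le> c powr p) \<longleftrightarrow>
      summable (\<lambda>n. norm (y n) powr p) \<and> (\<Sum>n. norm (y n) powr p) \<le> c powr p"
  proof (intro iffI conjI)
    assume *: "\<forall>A. finite A \<longrightarrow> (\<Sum>i\<in>A. norm (y i) powr p) \<le> c powr p"
    then show "summable (\<lambda>n. norm (y n) powr p)"
      by (intro summableI_nonneg_bounded[of _ "c powr p"]) auto
    then show "(\<Sum>n. norm (y n) powr p) \<le> c powr p"
      by (rule suminf_le_const) (use * in auto)
  qed (auto intro: order_trans[OF sum_le_suminf])
  have "s \<le> c powr p \<longleftrightarrow> s powr (1 / p) \<le> c" if "0 \<le> s" "0 \<le> c" for s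
  proof
    assume "s \<le> c powr p"
    then have "s powr (1 / p) \<le> (c powr p) powr (1 / p)" using that assms by (intro powr_mono2) auto
    then show "s powr (1 / p) \<le> c" using that assms by (simp add: powr_powr)
  next
    assume "s powr (1 / p) \<le> c"
    then have "(s powr (1 / p)) powr p \<le> c powr p" using that assms by (intro powr_mono2) auto
    then show "s \<le> c powr p" using that assms by (simp add: powr_powr)
  qed
  moreover have "summable (\<lambda>n. norm (y n) powr p) \<Longrightarrow> 0 \<le> (\<Sum>n. norm (y n) powr p)"
    by (rule suminf_nonneg) auto
  moreover have "(\<Sum>n. norm (y n) powr p) powr (1 / p) \<le> c \<Longrightarrow> 0 \<le> c"
    by (rule order_trans[rotated]) auto
  ultimately show ?thesis
    using assms unfolding lp_le_def sum_le by (auto simp: ell_def ell_norm_def)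
qed

text \<open>Finiteness of \<open>p\<close> enters here: small tails reduce both the compactness of
  hulls and the approximation in the bidual to finitely many coordinates.\<close>

lemma lp_le_tail:
  fixes y :: "nat \<Rightarrow> 'a::real_normed_vector"
  assumes "lp_le p c y" "1 \<le> p" "0 < e"
  obtains N where "lp_le p e (\<lambda>n. if n < N then 0 else y n)"
proof -
  have "summable (\<lambda>n. norm (y n) powr p)"
    using lp_leD[OF assms(1)] by (intro summableI_nonneg_bounded[of _ "c powr p"]) auto
  moreover have "0 < e powr p" using \<open>0 < e\<close> by simp
  ultimately obtain N where N: "\<And>m n. N \<le> m \<Longrightarrow> norm (\<Sum>i=m..<n. norm (y i) powr p) < e powr p"
    using summable_Cauchy by meson
  have "lp_le p e (\<lambda>n. if n < N then 0 else y n)"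
    unfolding lp_le_def
  proof (intro conjI allI impI)
    fix A :: "nat set" assume "finite A"
    then obtain M where "A \<subseteq> {..<M}" using finite_nat_iff_bounded by blast
    have "(\<Sum>i\<in>A. norm (if i < N then 0 else y i) powr p) = (\<Sum>i\<in>A \<inter> {N..}. norm (y i) powr p)"
      using \<open>finite A\<close> by (intro sum.mono_neutral_cong_right) auto
    also have "\<dots> \<le> (\<Sum>i=N..<M. norm (y i) powr p)"
      using \<open>A \<subseteq> {..<M}\<close> by (intro sum_mono2) auto
    also have "\<dots> \<le> e powr p" using N[of N M] by simp
    finally show "(\<Sum>i\<in>A. norm (if i < N then 0 else y i) powr p) \<le> e powr p" .
  qed (use \<open>0 < e\<close> in simp)
  then show thesis by (rule that)
qed

lemma lp_dual_sum_le:
  assumes "lp_le p c y" "dual_ball p \<alpha>" "1 \<le> p" "finite A"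
  shows "(\<Sum>i\<in>A. norm (\<alpha> i *\<^sub>C y i)) \<le> c"
  unfolding norm_scaleC using assms
  by (intro dual_ball_scaled) (auto simp: lp_leD lp_le_nonneg)

lemma lp_dual_abs_summable:
  assumes "lp_le p c y" "dual_ball p \<alpha>" "1 \<le> p"
  shows "(\<lambda>i. norm (\<alpha> i *\<^sub>C y i)) summable_on UNIV"
  unfolding abs_summable_iff_bdd_above
  using lp_dual_sum_le[OF assms] by (auto intro!: bdd_aboveI2)

lemma lp_dual_has_sum:
  assumes "lp_le p c y" "dual_ball p \<alpha>" "1 \<le> p"
  shows "((\<lambda>i. \<alpha> i *\<^sub>C y i) has_sum (\<Sum>\<^sub>\<infinity>i. \<alpha> i *\<^sub>C y i)) UNIV"
  by (rule has_sum_infsum[OF abs_summable_summable[OF lp_dual_abs_summable[OF assms]]])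

lemma has_sum_diff:
  fixes f g :: "'i \<Rightarrow> 'a::real_normed_vector"
  assumes "(f has_sum s) A" "(g has_sum t) A"
  shows "((\<lambda>i. f i - g i) has_sum (s - t)) A"
  using has_sum_add[OF assms(1), of "\<lambda>i. - g i" "- t"] assms(2) by (simp add: has_sum_uminus)

lemma lp_dual_norm_le:
  assumes "lp_le p c y" "dual_ball p \<alpha>" "1 \<le> p" and sum: "((\<lambda>i. \<alpha> i *\<^sub>C y i) has_sum s) UNIV"
  shows "norm s \<le> c"
proof (rule tendsto_upperbound)
  show "((\<lambda>A. norm (\<Sum>i\<in>A. \<alpha> i *\<^sub>C y i)) \<longlongrightarrow> norm s) (finite_subsets_at_top UNIV)"
    using sum unfolding has_sum_def by (rule tendsto_norm)
  show "\<forall>\<^sub>F A in finite_subsets_at_top UNIV. norm (\<Sum>i\<in>A. \<alpha> i *\<^sub>C y i) \<le> c"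
    using order_trans[OF norm_sum lp_dual_sum_le[OF assms(1-3)]]
    by (intro eventually_finite_subsets_at_top_weakI)
qed simp

text \<open>Unordered sums allow index types other than \<open>nat\<close> and make reindexing
  harmless; by absolute convergence they give the same set as \<open>p_co\<close> for sequences in
  l_p.\<close>

definition p_hull :: "real \<Rightarrow> ('i \<Rightarrow> 'a::complex_banach) \<Rightarrow> 'a set"
  where "p_hull p y = {s. \<exists>\<alpha>. dual_ball p \<alpha> \<and> ((\<lambda>i. \<alpha> i *\<^sub>C y i) has_sum s) UNIV}"

lemma p_co_eq_p_hull:
  assumes "1 \<le> p" "lp_le p c y"
  shows "p_co p y = p_hull p y"
proof -
  have "((\<lambda>n. \<alpha> n *\<^sub>C y n) has_sum s) UNIV \<longleftrightarrow> s = (\<Sum>n. \<alpha> n *\<^sub>C y n)" if "dual_ball p \<alpha>" for \<alpha> s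
    using lp_dual_has_sum[OF assms(2) that assms(1)]
    by (metis has_sum_imp_sums has_sum_unique sums_unique)
  then show ?thesis
    unfolding p_co_def p_hull_def by (auto simp flip: dual_ball_iff[OF assms(1)]) 
qed

text \<open>The summation map is continuous on the compact ball: a partial sum depends on finitely
  many coordinates, and the remainder is bounded by the l_p norm of the tail of \<open>y\<close>,
  uniformly in \<open>\<alpha>\<close>.\<close>

lemma compact_p_hull:
  fixes y :: "nat \<Rightarrow> 'a::complex_banach"
  assumes "1 \<le> p" "lp_le p c y"
  shows "compact (p_hull p y)"
proof -
  let ?B = "{\<alpha> :: nat \<Rightarrow> complex. dual_ball p \<alpha>}"
  let ?\<Phi> = "\<lambda>\<alpha>. \<Sum>\<^sub>\<infinity>n. \<alpha> n *\<^sub>C y n"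
  have "uniform_limit ?B (\<lambda>N \<alpha>. \<Sum>n<N. \<alpha> n *\<^sub>C y n) ?\<Phi> sequentially"
    unfolding uniform_limit_sequentially_iff
  proof (intro allI impI)
    fix e :: real assume "0 < e"
    then obtain M where M: "lp_le p (e/2) (\<lambda>n. if n < M then 0 else y n)"
      using lp_le_tail[OF assms(2,1), of "e/2"] by auto
    have "dist (\<Sum>n<N. \<alpha> n *\<^sub>C y n) (?\<Phi> \<alpha>) < e" if "M \<le> N" "dual_ball p \<alpha>" for N \<alpha>
    proof -
      have N: "lp_le p (e/2) (\<lambda>n. if n < N then 0 else y n)"
        by (rule lp_le_mono[OF M]) (use assms that in auto)
      have "((\<lambda>n. \<alpha> n *\<^sub>C y n) has_sum (\<Sum>n<N. \<alpha> n *\<^sub>C y n)) {..<N}"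
        by (simp add: has_sum_finite)
      then have "((\<lambda>n. if n < N then \<alpha> n *\<^sub>C y n else 0) has_sum (\<Sum>n<N. \<alpha> n *\<^sub>C y n)) UNIV"
        by (rule has_sum_cong_neutral[THEN iffD1, rotated -1]) auto
      from has_sum_diff[OF lp_dual_has_sum[OF assms(2) that(2) assms(1)] this]
      have "((\<lambda>n. \<alpha> n *\<^sub>C (if n < N then 0 else y n)) has_sum (?\<Phi> \<alpha> - (\<Sum>n<N. \<alpha> n *\<^sub>C y n))) UNIV"
        by (rule has_sum_cong[THEN iffD1, rotated]) auto
      from lp_dual_norm_le[OF N that(2) assms(1) this] show ?thesis
        using \<open>0 < e\<close> by (simp add: dist_norm norm_minus_commute)
    qed
    then show "\<exists>M. \<forall>N\<ge>M. \<forall>\<alpha>\<in>?B. dist (\<Sum>n<N. \<alpha> n *\<^sub>C y n) (?\<Phi> \<alpha>) < e" by blast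
  qed
  moreover have "continuous_on ?B (\<lambda>\<alpha>. \<Sum>n<N. \<alpha> n *\<^sub>C y n)" for N
    by (intro continuous_on_sum scaleC.continuous_on continuous_on_const
        continuous_on_subset[OF continuous_on_product_coordinates]) auto
  ultimately have "continuous_on ?B ?\<Phi>"
    by (intro uniform_limit_theorem[of _ "\<lambda>N \<alpha>. \<Sum>n<N. \<alpha> n *\<^sub>C y n" sequentially]) auto
  then have "compact (?\<Phi> ` ?B)"
    using compact_dual_ball compact_continuous_image by blast
  also have "?\<Phi> ` ?B = p_hull p y"
    unfolding p_hull_def using lp_dual_has_sum[OF assms(2) _ assms(1)] infsumI by fastforce
  finally show ?thesis .
qed

lemma p_hullI: "dual_ball p \<alpha> \<Longrightarrow> ((\<lambda>i. \<alpha> i *\<^sub>C y i) has_sum s) UNIV \<Longrightarrow> s \<in> p_hull p y"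
  by (auto simp: p_hull_def)

lemma p_hullE:
  assumes "s \<in> p_hull p y"
  obtains \<alpha> where "dual_ball p \<alpha>" "((\<lambda>i. \<alpha> i *\<^sub>C y i) has_sum s) UNIV"
  using assms by (auto simp: p_hull_def)

section \<open>Reindexing, and addition of the constants of p-bounded families\<close>

lemma lp_le_reindex:
  fixes h :: "'i \<Rightarrow> 'j"
  assumes "lp_le p c y" "inj h"
  shows "lp_le p c (y \<circ> h)"
  unfolding lp_le_def
proof (intro conjI allI impI)
  fix A :: "'i set" assume "finite A"
  have "(\<Sum>i\<in>A. norm ((y \<circ> h) i) powr p) = (\<Sum>j\<in>h ` A. norm (y j) powr p)"
    using inj_on_subset[OF assms(2)] by (subst sum.reindex) auto
  also have "\<dots> \<le> c powr p" using assms \<open>finite A\<close> by (intro lp_leD) auto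
  finally show "(\<Sum>i\<in>A. norm ((y \<circ> h) i) powr p) \<le> c powr p" .
qed (use assms lp_le_nonneg in blast)

lemma dual_ball_reindex:
  fixes h :: "'i \<Rightarrow> 'j"
  assumes "dual_ball p \<alpha>" "inj h"
  shows "dual_ball p (\<alpha> \<circ> h)"
  unfolding dual_ball_def
proof (intro allI impI)
  fix A :: "'i set" and b :: "'i \<Rightarrow> real"
  assume A: "finite A" "\<forall>i\<in>A. 0 \<le> b i" "(\<Sum>i\<in>A. b i powr p) \<le> 1"
  have inj: "inj_on h A" using inj_on_subset[OF assms(2)] by auto
  have "(\<Sum>j\<in>h ` A. cmod (\<alpha> j) * b (inv h j)) \<le> 1"
    using A assms by (intro dual_ballD[OF assms(1)]) (auto simp: sum.reindex[OF inj])
  then show "(\<Sum>i\<in>A. cmod ((\<alpha> \<circ> h) i) * b i) \<le> 1"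
    using assms by (simp add: sum.reindex[OF inj])
qed

lemma p_hull_reindex:
  assumes "bij h"
  shows "p_hull p y \<subseteq> p_hull p (y \<circ> h)"
proof
  fix s assume "s \<in> p_hull p y"
  then obtain \<alpha> where \<alpha>: "dual_ball p \<alpha>" "((\<lambda>i. \<alpha> i *\<^sub>C y i) has_sum s) UNIV" by (rule p_hullE)
  show "s \<in> p_hull p (y \<circ> h)"
  proof (rule p_hullI)
    show "dual_ball p (\<alpha> \<circ> h)" by (rule dual_ball_reindex[OF \<alpha>(1) bij_is_inj[OF assms]])
    show "((\<lambda>i. (\<alpha> \<circ> h) i *\<^sub>C (y \<circ> h) i) has_sum s) UNIV"
      using has_sum_reindex_bij_betw[OF assms, of "\<lambda>i. \<alpha> i *\<^sub>C y i" s] \<alpha>(2) by simp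
  qed
qed

text \<open>The constant is realised by a witness sequence, whereas \<open>m_p\<close> is an
  infimum; this is why a strict inequality or an added \<open>e\<close> appears in later
  statements.\<close>

definition p_bounded :: "real \<Rightarrow> real \<Rightarrow> 'a::complex_banach set \<Rightarrow> bool"
  where "p_bounded p c S \<longleftrightarrow> (\<exists>y :: nat \<Rightarrow> 'a. lp_le p c y \<and> S \<subseteq> p_hull p y)"

lemma p_bounded_norm_le:
  assumes "p_bounded p c S" "1 \<le> p" "s \<in> S"
  shows "norm s \<le> c"
  using assms lp_dual_norm_le unfolding p_bounded_def p_hull_def by blast

lemma p_bounded_mono: "p_bounded p c S \<Longrightarrow> 1 \<le> p \<Longrightarrow> c \<le> d \<Longrightarrow> T \<subseteq> S \<Longrightarrow> p_bounded p d T"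
  unfolding p_bounded_def using lp_le_mono by blast

lemma p_bounded_line:
  assumes "1 \<le> p"
  shows "p_bounded p (norm v) {c *\<^sub>C v |c. cmod c \<le> 1}"
  unfolding p_bounded_def
proof (intro exI conjI subsetI)
  let ?y = "\<lambda>n::nat. if n = 0 then v else 0"
  show "lp_le p (norm v) ?y"
    unfolding lp_le_def
  proof (intro conjI allI impI)
    fix A :: "nat set" assume "finite A"
    have "norm (?y n) powr p = (if n = 0 then norm v powr p else 0)" for n by simp
    with \<open>finite A\<close> show "(\<Sum>n\<in>A. norm (?y n) powr p) \<le> norm v powr p" by simp
  qed simp
  fix x assume "x \<in> {c *\<^sub>C v |c. cmod c \<le> 1}"
  then obtain c where c: "x = c *\<^sub>C v" "cmod c \<le> 1" by blast
  show "x \<in> p_hull p ?y"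
  proof (rule p_hullI)
    show "dual_ball p (\<lambda>n::nat. if n = 0 then c else 0)"
      using c assms by (intro dual_ball_single)
    show "((\<lambda>n. (if n = 0 then c else 0) *\<^sub>C ?y n) has_sum x) UNIV"
      by (rule has_sum_finite_neutralI[of "{0}"]) (auto simp: c)
  qed
qed

text \<open>The weights \<open>(c k / C) powr (1 / p - 1)\<close> balance the \<open>\<ell>\<^sub>p\<close> norm of the combined sequence
  against the \<open>\<ell>\<^sub>q\<close> norm of the combined coefficients.\<close>

lemma dual_ball_weighted:
  fixes \<alpha> :: "'k \<Rightarrow> 'i \<Rightarrow> complex"
  assumes "1 \<le> p" and \<alpha>: "\<And>k. dual_ball p (\<alpha> k)"
    and l: "\<And>k. 0 < l k" "\<And>M. finite M \<Longrightarrow> (\<Sum>k\<in>M. l k) \<le> 1"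
  shows "dual_ball p (\<lambda>(k, i). of_real (l k powr (1 - 1 / p)) * \<alpha> k i)"
  unfolding dual_ball_def
proof (intro allI impI)
  fix A :: "('k \<times> 'i) set" and b
  assume A: "finite A" "\<forall>i\<in>A. 0 \<le> b i" "(\<Sum>i\<in>A. b i powr p) \<le> 1"
  define M where "M = fst ` A"
  define S where "S k = {i. (k, i) \<in> A}" for k
  have A_eq: "A = Sigma M S" by (force simp: M_def S_def)
  have fin: "finite M" using A(1) by (simp add: M_def)
  have finS: "finite (S k)" for k
    using A(1) finite_subset[of "S k" "snd ` A"] by (force simp: S_def)
  have split: "sum h A = (\<Sum>k\<in>M. \<Sum>i\<in>S k. h (k, i))" for h :: "_ \<Rightarrow> real"
    unfolding A_eq using fin finS by (subst sum.Sigma) auto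
  define B where "B k = (\<Sum>i\<in>S k. b (k, i) powr p)" for k
  have B0: "0 \<le> B k" for k by (simp add: B_def sum_nonneg)
  have "(\<Sum>i\<in>S k. l k powr (1 - 1 / p) * cmod (\<alpha> k i) * b (k, i)) \<le> (1 - 1 / p) * l k + 1 / p * B k"
    if "k \<in> M" for k
  proof -
    have "(\<Sum>i\<in>S k. cmod (\<alpha> k i) * b (k, i)) \<le> B k powr (1 / p)"
    proof (rule dual_ball_scaled[OF \<alpha>])
      show "(\<Sum>i\<in>S k. b (k, i) powr p) \<le> (B k powr (1 / p)) powr p"
        using B0[of k] \<open>1 \<le> p\<close> by (simp add: powr_powr B_def)
    qed (use A(2) finS \<open>1 \<le> p\<close> in \<open>auto simp: S_def\<close>)
    then have "l k powr (1 - 1 / p) * (\<Sum>i\<in>S k. cmod (\<alpha> k i) * b (k, i)) \<le>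
        l k powr (1 - 1 / p) * B k powr (1 / p)"
      by (intro mult_left_mono) auto
    \<comment> \<open>The weighted arithmetic-geometric mean inequality separates the weights from
      the test sequence; each of the two then sums to at most 1 over \<open>k\<close>.\<close>
    also have "\<dots> \<le> (1 - 1 / p) * l k + 1 / p * B k"
    proof (cases "B k = 0")
      case True
      then show ?thesis using \<open>1 \<le> p\<close> less_imp_le[OF l(1)] by simp
    next
      case False
      then show ?thesis
        using \<open>1 \<le> p\<close> l(1) B0[of k] by (intro Youngs_inequality_0) auto
    qed
    finally show ?thesis by (simp add: sum_distrib_left mult.assoc)
  qed
  then have "(\<Sum>(k, i)\<in>A. l k powr (1 - 1 / p) * cmod (\<alpha> k i) * b (k, i)) \<le>
      (\<Sum>k\<in>M. (1 - 1 / p) * l k + 1 / p * B k)"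
    unfolding split by (auto intro: sum_mono)
  also have "\<dots> = (1 - 1 / p) * (\<Sum>k\<in>M. l k) + 1 / p * (\<Sum>i\<in>A. b i powr p)"
    unfolding split by (simp add: B_def sum.distrib sum_distrib_left)
  also have "\<dots> \<le> (1 - 1 / p) * 1 + 1 / p * 1"
    using A(3) l(2)[OF fin] \<open>1 \<le> p\<close> by (intro add_mono mult_left_mono) auto
  finally have "(\<Sum>(k, i)\<in>A. l k powr (1 - 1 / p) * cmod (\<alpha> k i) * b (k, i)) \<le> 1"
    by simp
  then show "(\<Sum>i\<in>A. cmod (case i of (k, i) \<Rightarrow> of_real (l k powr (1 - 1 / p)) * \<alpha> k i) * b i) \<le> 1"
    by (simp add: case_prod_unfold norm_mult)
qed

text \<open>Block \<open>k\<close> contributes at most l_k^(1-p) (C l_k)^p = C^p l_k to the sum of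
  p-th powers, and the \<open>l k\<close> sum to at most 1.\<close>

lemma lp_le_weighted:
  fixes y :: "'k \<Rightarrow> 'i \<Rightarrow> 'a::real_normed_vector"
  assumes "1 \<le> p" and y: "\<And>k. lp_le p (C * l k) (y k)" and "0 < C"
    and l: "\<And>k. 0 < l k" "\<And>M. finite M \<Longrightarrow> (\<Sum>k\<in>M. l k) \<le> 1"
  shows "lp_le p C (\<lambda>(k, i). (l k powr (1 / p - 1)) *\<^sub>R y k i)"
  unfolding lp_le_def
proof (intro conjI allI impI)
  fix A :: "('k \<times> 'i) set" assume A: "finite A"
  define M where "M = fst ` A"
  define S where "S k = {i. (k, i) \<in> A}" for k
  have A_eq: "A = Sigma M S" by (force simp: M_def S_def)
  have fin: "finite M" using A(1) by (simp add: M_def)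
  have finS: "finite (S k)" for k
    using A(1) finite_subset[of "S k" "snd ` A"] by (force simp: S_def)
  have "(\<Sum>i\<in>S k. norm ((l k powr (1 / p - 1)) *\<^sub>R y k i) powr p) \<le> C powr p * l k" for k
  proof -
    have exponent: "(1 / p - 1) * p = 1 - p" using \<open>1 \<le> p\<close> by (simp add: field_simps)
    have "(\<Sum>i\<in>S k. norm ((l k powr (1 / p - 1)) *\<^sub>R y k i) powr p) =
        l k powr (1 - p) * (\<Sum>i\<in>S k. norm (y k i) powr p)"
      by (simp add: powr_mult powr_powr exponent sum_distrib_left)
    also have "\<dots> \<le> l k powr (1 - p) * (C * l k) powr p"
      by (intro mult_left_mono lp_leD y finS) auto
    also have "\<dots> = C powr p * (l k powr (1 - p) * l k powr p)"
      using l(1)[of k] \<open>0 < C\<close> by (simp add: powr_mult)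
    also have "l k powr (1 - p) * l k powr p = l k"
      using l(1)[of k] by (simp flip: powr_add)
    finally show ?thesis .
  qed
  then have "(\<Sum>(k, i)\<in>A. norm ((l k powr (1 / p - 1)) *\<^sub>R y k i) powr p) \<le> (\<Sum>k\<in>M. C powr p * l k)"
    unfolding A_eq using fin finS by (subst sum.Sigma[symmetric]) (auto intro: sum_mono)
  also have "\<dots> \<le> C powr p"
    using l(2)[OF fin] mult_left_mono[of _ 1 "C powr p"] by (simp flip: sum_distrib_left)
  finally show "(\<Sum>j\<in>A. norm (case j of (k, i) \<Rightarrow> (l k powr (1 / p - 1)) *\<^sub>R y k i) powr p) \<le> C powr p"
    by (simp add: case_prod_unfold)
qed (use \<open>0 < C\<close> in simp)

text \<open>The witness sequences are placed side by side over pairs (k, i), with reciprocal weights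
  on vectors and coefficients, so that no term of any series changes. Positivity of
  \<open>c k\<close> makes the weights invertible. The double series converges unconditionally and
  can be summed block by block, which gives \<open>g x\<close>.\<close>

lemma p_bounded_sums:
  fixes f :: "nat \<Rightarrow> 'x \<Rightarrow> 'a::complex_banach"
  assumes "1 \<le> p" and c: "\<And>k. 0 < c k" "c sums C"
    and f: "\<And>k. p_bounded p (c k) (f k ` K)" and g: "\<And>x. x \<in> K \<Longrightarrow> (\<lambda>k. f k x) sums g x"
  shows "p_bounded p C (g ` K)"
proof -
  have "0 < C" using c suminf_pos[of c] by (simp add: sums_iff)
  define l where "l k = c k / C" for k
  have l: "0 < l k" "C * l k = c k" for k using c \<open>0 < C\<close> by (auto simp: l_def)
  have l_sum: "(\<Sum>k\<in>M. l k) \<le> 1" if "finite M" for M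
  proof -
    have "(\<Sum>k\<in>M. c k) \<le> C"
      using c that sum_le_suminf[of c M] by (auto simp: sums_iff less_imp_le)
    then show ?thesis using \<open>0 < C\<close> by (simp add: l_def flip: sum_divide_distrib)
  qed
  have "\<forall>k. \<exists>y :: nat \<Rightarrow> 'a. lp_le p (c k) y \<and> f k ` K \<subseteq> p_hull p y"
    using f by (auto simp: p_bounded_def)
  from choice[OF this] obtain y :: "nat \<Rightarrow> nat \<Rightarrow> 'a"
    where y: "\<And>k. lp_le p (c k) (y k)" "\<And>k. f k ` K \<subseteq> p_hull p (y k)" by blast
  define Y where "Y = (\<lambda>(k, i). (l k powr (1 / p - 1)) *\<^sub>R y k i)"
  have Y: "lp_le p C Y"
    unfolding Y_def using assms(1) y(1) \<open>0 < C\<close> l l_sum by (intro lp_le_weighted) simp_all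
  have "g x \<in> p_hull p Y" if "x \<in> K" for x
  proof -
    have "\<forall>k. \<exists>\<alpha>. dual_ball p \<alpha> \<and> ((\<lambda>i. \<alpha> i *\<^sub>C y k i) has_sum f k x) UNIV"
      using y(2) that by (fastforce simp: p_hull_def)
    from choice[OF this] obtain \<alpha>
      where \<alpha>: "\<And>k. dual_ball p (\<alpha> k)" "\<And>k. ((\<lambda>i. \<alpha> k i *\<^sub>C y k i) has_sum f k x) UNIV" by blast
    define \<Gamma> where "\<Gamma> = (\<lambda>(k, i). of_real (l k powr (1 - 1 / p)) * \<alpha> k i)"
    have \<Gamma>: "dual_ball p \<Gamma>"
      unfolding \<Gamma>_def using assms(1) \<alpha>(1) l l_sum by (intro dual_ball_weighted)
    have prod: "\<Gamma> (k, i) *\<^sub>C Y (k, i) = \<alpha> k i *\<^sub>C y k i" for k i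
    proof -
      have "l k powr (1 - 1 / p) * l k powr (1 / p - 1) = 1"
        using l(1)[of k] by (simp flip: powr_add)
      then have "of_real (l k powr (1 - 1 / p)) * of_real (l k powr (1 / p - 1)) = (1 :: complex)"
        by (simp flip: of_real_mult)
      then show ?thesis
        by (simp add: \<Gamma>_def Y_def scaleC_scaleC mult.commute mult.left_commute flip: scaleC_of_real)
    qed
    have "(\<lambda>j. \<Gamma> j *\<^sub>C Y j) summable_on Sigma UNIV (\<lambda>_. UNIV)"
      using lp_dual_has_sum[OF Y \<Gamma> assms(1)] by (auto simp: summable_on_def)
    moreover have "((\<lambda>k. f k x) has_sum g x) UNIV"
    proof (rule norm_summable_imp_has_sum)
      have "norm (f k x) \<le> c k" for k
        using p_bounded_norm_le[OF f assms(1)] that by blast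
      then show "summable (\<lambda>k. norm (f k x))"
        by (intro summable_comparison_test'[OF sums_summable[OF c(2)], of 0]) simp
    qed (rule g[OF that])
    ultimately have "((\<lambda>j. \<Gamma> j *\<^sub>C Y j) has_sum g x) (Sigma UNIV (\<lambda>_. UNIV))"
      using \<alpha>(2) by (intro has_sum_SigmaI[where g = "\<lambda>k. f k x"]) (auto simp: prod)
    then show ?thesis using \<Gamma> by (intro p_hullI) auto
  qed
  \<comment> \<open>The pairs are coded by natural numbers, since a witness of
    \<open>p_bounded\<close> is a sequence.\<close>
  then have "g ` K \<subseteq> p_hull p (Y \<circ> prod_decode)"
    using p_hull_reindex[OF bij_prod_decode, of p Y] by blast
  moreover have "lp_le p C (Y \<circ> prod_decode)"
    by (rule lp_le_reindex[OF Y]) (rule inj_prod_decode)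
  ultimately show ?thesis unfolding p_bounded_def by blast
qed

lemma p_bounded_zero: "0 \<le> c \<Longrightarrow> 1 \<le> p \<Longrightarrow> S \<subseteq> {0} \<Longrightarrow> p_bounded p c S"
  by (rule p_bounded_mono[OF p_bounded_line[of p 0]]) (auto intro!: exI[of _ "0 :: complex"])

text \<open>The gap D - C, spread geometrically over the summands, makes every constant positive;
  the new constants add up to exactly \<open>D\<close>. Thus vanishing \<open>c k\<close> are
  allowed.\<close>

lemma p_bounded_sums_less:
  fixes f :: "nat \<Rightarrow> 'x \<Rightarrow> 'a::complex_banach"
  assumes "1 \<le> p" and c: "\<And>k. 0 \<le> c k" "c sums C" "C < D"
    and f: "\<And>k. p_bounded p (c k) (f k ` K)" and g: "\<And>x. x \<in> K \<Longrightarrow> (\<lambda>k. f k x) sums g x"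
  shows "p_bounded p D (g ` K)"
proof (rule p_bounded_sums[OF assms(1)])
  let ?d = "\<lambda>k. c k + (D - C) / 2 * (1 / 2) ^ k"
  show "0 < ?d k" for k using c by (intro add_nonneg_pos) auto
  have "(\<lambda>k. (D - C) / 2 * (1 / 2) ^ k) sums ((D - C) / 2 * (1 / (1 - 1 / 2)))"
    by (intro sums_mult geometric_sums) auto
  from sums_add[OF c(2) this] show "?d sums D" by (simp add: field_simps)
  show "p_bounded p (?d k) (f k ` K)" for k
    using c by (intro p_bounded_mono[OF f assms(1)]) auto
qed (rule g)

lemma p_bounded_sum:
  fixes f :: "'i \<Rightarrow> 'x \<Rightarrow> 'a::complex_banach"
  assumes "1 \<le> p" "finite I" and c: "\<And>i. i \<in> I \<Longrightarrow> 0 \<le> c i" "(\<Sum>i\<in>I. c i) < D"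
    and f: "\<And>i. i \<in> I \<Longrightarrow> p_bounded p (c i) (f i ` K)"
  shows "p_bounded p D ((\<lambda>x. \<Sum>i\<in>I. f i x) ` K)"
proof -
  obtain h where h: "bij_betw h {..<card I} I"
    using ex_bij_betw_nat_finite[OF \<open>finite I\<close>] by (auto simp: atLeast0LessThan)
  then have hI: "h k \<in> I" if "k < card I" for k using that by (auto simp: bij_betw_def)
  let ?c = "\<lambda>k. if k \<in> {..<card I} then c (h k) else 0"
  let ?f = "\<lambda>k x. if k \<in> {..<card I} then f (h k) x else 0"
  show ?thesis
  proof (rule p_bounded_sums_less[OF assms(1)])
    show "0 \<le> ?c k" for k using c hI by auto
    show "?c sums (\<Sum>i\<in>I. c i)"
      using sums_If_finite_set[of "{..<card I}" "\<lambda>k. c (h k)"] sum.reindex_bij_betw[OF h, of c] by simp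
    show "p_bounded p (?c k) (?f k ` K)" for k
      using f hI by (cases "k < card I") (auto intro!: p_bounded_zero assms(1))
    show "(\<lambda>k. ?f k x) sums (\<Sum>i\<in>I. f i x)" for x
      using sums_If_finite_set[of "{..<card I}" "\<lambda>k. f (h k) x"]
        sum.reindex_bij_betw[OF h, of "\<lambda>i. f i x"] by simp
  qed fact
qed

lemma p_bounded_add:
  assumes "1 \<le> p" "p_bounded p a (f ` K)" "p_bounded p b (g ` K)" "a + b < D"
  shows "p_bounded p D ((\<lambda>x. f x + g x) ` K)"
proof -
  have "0 \<le> a" "0 \<le> b" using assms(2,3) lp_le_nonneg by (auto simp: p_bounded_def)
  then have "p_bounded p D ((\<lambda>x. \<Sum>i\<in>UNIV. (if i then f else g) x) ` K)"
    using assms by (intro p_bounded_sum[where c = "\<lambda>i. if i then a else b"]) (auto simp: UNIV_bool)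
  then show ?thesis by (simp add: UNIV_bool add.commute)
qed

subsection \<open>$p$-compactness in the bidual\<close>

text \<open>Centres of a finite subcover of the compact ball need not be of the form
  \<open>\<alpha> x\<close>, so each one that is used is replaced by a point of \<open>K\<close> in
  the same neighbourhood; the radius \<open>\<eta> / 2\<close> pays for the exchange.\<close>

lemma finite_partition_dual_ball:
  fixes \<alpha> :: "'x \<Rightarrow> nat \<Rightarrow> complex"
  assumes "\<And>x. x \<in> K \<Longrightarrow> dual_ball p (\<alpha> x)" "0 < \<eta>"
  obtains I r where "finite I" "I \<subseteq> K"
    and "\<And>x. x \<in> K \<Longrightarrow> r x \<in> I"
    and "\<And>x n. x \<in> K \<Longrightarrow> n < N \<Longrightarrow> cmod (\<alpha> x n - \<alpha> (r x) n) < \<eta>"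
proof -
  define U where "U \<beta> = {\<gamma> :: nat \<Rightarrow> complex. \<forall>n<N. dist (\<gamma> n) (\<beta> n) < \<eta> / 2}" for \<beta> :: "nat \<Rightarrow> complex"
  have "open (U \<beta>)" for \<beta>
  proof -
    have "U \<beta> = (\<Inter>n\<in>{..<N}. {\<gamma>. dist (\<gamma> n) (\<beta> n) < \<eta> / 2})" by (auto simp: U_def)
    moreover have "open {\<gamma> :: nat \<Rightarrow> complex. dist (\<gamma> n) (\<beta> n) < \<eta> / 2}" for n
      by (intro open_Collect_less continuous_intros continuous_on_product_coordinates)
    ultimately show ?thesis by (simp add: open_INT)
  qed
  moreover have "\<beta> \<in> U \<beta>" for \<beta> using \<open>0 < \<eta>\<close> by (simp add: U_def)
  then have "{\<alpha>. dual_ball p \<alpha>} \<subseteq> (\<Union>\<beta>\<in>UNIV. U \<beta>)" by auto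
  ultimately obtain D where D: "finite D" "{\<alpha>. dual_ball p \<alpha>} \<subseteq> (\<Union>\<beta>\<in>D. U \<beta>)"
    by (rule compactE_image[OF compact_dual_ball[of p]])
  define e where "e \<beta> = (SOME x. x \<in> K \<and> \<alpha> x \<in> U \<beta>)" for \<beta>
  define d where "d x = (SOME \<beta>. \<beta> \<in> D \<and> \<alpha> x \<in> U \<beta>)" for x
  have d: "d x \<in> D" "\<alpha> x \<in> U (d x)" if "x \<in> K" for x
  proof -
    have "\<exists>\<beta>. \<beta> \<in> D \<and> \<alpha> x \<in> U \<beta>" using assms(1)[OF that] D(2) by blast
    then show "d x \<in> D" "\<alpha> x \<in> U (d x)" unfolding d_def by (metis (mono_tags, lifting) someI_ex)+
  qed
  have e: "e (d x) \<in> K" "\<alpha> (e (d x)) \<in> U (d x)" if "x \<in> K" for x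
  proof -
    have "\<exists>y. y \<in> K \<and> \<alpha> y \<in> U (d x)" using d(2)[OF that] that by blast
    then show "e (d x) \<in> K" "\<alpha> (e (d x)) \<in> U (d x)"
      unfolding e_def by (metis (mono_tags, lifting) someI_ex)+
  qed
  show thesis
  proof (rule that[of "(\<lambda>x. e (d x)) ` K" "\<lambda>x. e (d x)"])
    show "finite ((\<lambda>x. e (d x)) ` K)"
      by (rule finite_subset[of _ "e ` D"]) (use d D in auto)
    fix x n assume "x \<in> K" "n < N"
    then have "dist (\<alpha> x n) (d x n) < \<eta> / 2" "dist (\<alpha> (e (d x)) n) (d x n) < \<eta> / 2"
      using d(2) e(2) by (auto simp: U_def)
    then show "cmod (\<alpha> x n - \<alpha> (e (d x)) n) < \<eta>"
      using dist_triangle_half_r[of "d x n" "\<alpha> x n" \<eta> "\<alpha> (e (d x)) n"]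
      by (simp add: dist_norm norm_minus_commute)
  qed (use e in auto)
qed

text \<open>For the scalar operators x -> a_in x the functional \<open>\<psi> n\<close> is the
  combination of the \<open>g i\<close> with coefficients \<open>a i n\<close>. The two sides of the
  hypothesis of \<open>bidual_approximation\<close> then differ only by the remainders tested
  against the \<open>g i\<close>, and \<open>r\<close> bounds these.\<close>

lemma combination_approximation:
  fixes z :: "nat \<Rightarrow> 'a::complex_banach cdual cdual"
  assumes "finite I" "0 < d"
    and close: "\<And>i. i \<in> I \<Longrightarrow> norm (canonical_embedding (v i) - (\<Sum>n<N. a i n *\<^sub>C z n)) \<le> r"
    and "0 \<le> r"
  obtains y where "\<And>n. norm (y n) \<le> norm (z n)" "\<And>n. N \<le> n \<Longrightarrow> y n = 0"
    and "\<And>i. i \<in> I \<Longrightarrow> norm (v i - (\<Sum>n<N. a i n *\<^sub>C y n)) \<le> r + d"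
proof -
  obtain x where x: "\<And>n. n \<in> {..<N} \<Longrightarrow> norm (x n) \<le> norm (z n)"
    "\<And>i. i \<in> I \<Longrightarrow> norm (v i - (\<Sum>n<N. a i n *\<^sub>C x n)) \<le> r + d"
  proof (rule bidual_approximation[of I "{..<N}" "\<lambda>i n x. a i n *\<^sub>C x" v z r d])
    show "clinear (\<lambda>x :: 'a. a i n *\<^sub>C x)" for i n
      by (auto simp: clinear_def scaleC_add_right scaleC_scaleC mult.commute)
    show "bounded_linear (\<lambda>x :: 'a. a i n *\<^sub>C x)" for i n
      by (rule scaleC.bounded_linear_right)
    fix g :: "_ \<Rightarrow> 'a cdual" and \<psi> :: "nat \<Rightarrow> 'a cdual"
    assume \<psi>: "\<And>n x. n \<in> {..<N} \<Longrightarrow> cdual_apply (\<psi> n) x = (\<Sum>i\<in>I. cdual_apply (g i) (a i n *\<^sub>C x))"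
    have \<psi>_eq: "\<psi> n = (\<Sum>i\<in>I. a i n *\<^sub>C g i)" if "n < N" for n
      using that by (intro cdual_eqI)
        (simp add: \<psi> cdual_apply_sum_left cdual_apply_left_linear cdual_apply_scaleC)
    let ?rem = "\<lambda>i. canonical_embedding (v i) - (\<Sum>n<N. a i n *\<^sub>C z n)"
    have "cdual_apply (g i) (v i) = (\<Sum>n<N. a i n * cdual_apply (z n) (g i)) + cdual_apply (?rem i) (g i)" for i
      by (simp add: cdual_apply_left_linear cdual_apply_sum_left cdual_apply_canonical_embedding)
    then have "(\<Sum>i\<in>I. cdual_apply (g i) (v i)) =
        (\<Sum>i\<in>I. \<Sum>n<N. a i n * cdual_apply (z n) (g i)) + (\<Sum>i\<in>I. cdual_apply (?rem i) (g i))"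
      by (simp add: sum.distrib)
    also have "(\<Sum>i\<in>I. \<Sum>n<N. a i n * cdual_apply (z n) (g i)) = (\<Sum>n<N. cdual_apply (z n) (\<psi> n))"
      by (subst sum.swap) (simp add: \<psi>_eq cdual_apply_simps cdual_apply_scaleC)
    finally have "Re (\<Sum>i\<in>I. cdual_apply (g i) (v i)) =
        Re (\<Sum>n<N. cdual_apply (z n) (\<psi> n)) + (\<Sum>i\<in>I. Re (cdual_apply (?rem i) (g i)))"
      by simp
    also have "(\<Sum>i\<in>I. Re (cdual_apply (?rem i) (g i))) \<le> (\<Sum>i\<in>I. r * norm (g i))"
    proof (rule sum_mono)
      fix i assume "i \<in> I"
      have "Re (cdual_apply (?rem i) (g i)) \<le> norm (?rem i) * norm (g i)"
        by (rule order_trans[OF complex_Re_le_cmod norm_cdual_apply])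
      also have "\<dots> \<le> r * norm (g i)" using close[OF \<open>i \<in> I\<close>] by (intro mult_right_mono) auto
      finally show "Re (cdual_apply (?rem i) (g i)) \<le> r * norm (g i)" .
    qed
    finally show "Re (\<Sum>i\<in>I. cdual_apply (g i) (v i)) \<le>
        Re (\<Sum>n<N. cdual_apply (z n) (\<psi> n)) + r * (\<Sum>i\<in>I. norm (g i))"
      by (simp add: sum_distrib_left)
  qed (use assms in auto)
  show thesis
    by (rule that[of "\<lambda>n. if n < N then x n else 0"]) (use x in auto)
qed

text \<open>The error \<open>h\<close> at \<open>x\<close> equals the error at the representative
  \<open>r x\<close> plus a head over n < N, where the coefficients differ by less than
  \<open>\<eta>\<close>, plus a tail, where \<open>z\<close> is small. The first part takes finitely
  many values, small by the choice of \<open>y\<close>. The first two parts are finite sums of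
  rank-one families and the third lies in the hull of a small sequence, so all are
  \<open>p_bounded\<close>, not merely small.\<close>

lemma p_bounded_step:
  fixes f :: "'x \<Rightarrow> 'a::complex_banach"
  assumes "1 \<le> p" "0 < e" and bd: "p_bounded p c ((\<lambda>x. canonical_embedding (f x)) ` K)"
  obtains g where "p_bounded p c (g ` K)"
    and "p_bounded p e ((\<lambda>x. canonical_embedding (f x - g x)) ` K)"
proof -
  let ?J = "canonical_embedding :: 'a \<Rightarrow> _"
  obtain z :: "nat \<Rightarrow> 'a cdual cdual" where z: "lp_le p c z" "(\<lambda>x. ?J (f x)) ` K \<subseteq> p_hull p z"
    using bd by (auto simp: p_bounded_def)
  have "\<forall>x. \<exists>\<alpha>. x \<in> K \<longrightarrow> dual_ball p \<alpha> \<and> ((\<lambda>n. \<alpha> n *\<^sub>C z n) has_sum ?J (f x)) UNIV"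
    using z(2) by (fastforce simp: p_hull_def)
  from choice[OF this] obtain \<alpha> where \<alpha>: "\<And>x. x \<in> K \<Longrightarrow> dual_ball p (\<alpha> x)"
    "\<And>x. x \<in> K \<Longrightarrow> ((\<lambda>n. \<alpha> x n *\<^sub>C z n) has_sum ?J (f x)) UNIV" by blast
  \<comment> \<open>The divisor 16 allows for two factors 2, one from the bound of \<open>w\<close>
    by twice \<open>z\<close> and one from halving the coefficient differences, and leaves e /
    4.\<close>
  obtain N where N: "lp_le p (e / 16) (\<lambda>n. if n < N then 0 else z n)"
    using lp_le_tail[OF z(1) assms(1), of "e / 16"] \<open>0 < e\<close> by auto
  define Z where "Z = (\<Sum>n<N. norm (z n))"
  have "0 \<le> Z" by (simp add: Z_def sum_nonneg)
  \<comment> \<open>Chosen so that the head costs at most 2 \<eta> Z < e / 8; the added 1 guards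
    against Z = 0.\<close>
  define \<eta> where "\<eta> = e / (16 * (Z + 1))"
  have "0 < \<eta>" using \<open>0 < e\<close> \<open>0 \<le> Z\<close> by (simp add: \<eta>_def)
  obtain I r where I: "finite I" "I \<subseteq> K" "\<And>x. x \<in> K \<Longrightarrow> r x \<in> I"
    "\<And>x n. x \<in> K \<Longrightarrow> n < N \<Longrightarrow> cmod (\<alpha> x n - \<alpha> (r x) n) < \<eta>"
    using finite_partition_dual_ball[of K p \<alpha> \<eta> N] \<alpha>(1) \<open>0 < \<eta>\<close> by auto
  \<comment> \<open>Each of the \<open>card I\<close> representatives will have error at most 2
    \<rho>, so together they stay below e / 8.\<close>
  define \<rho> where "\<rho> = e / (16 * (card I + 1))"
  have "0 < \<rho>" using \<open>0 < e\<close> by (simp add: \<rho>_def)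
  have "\<forall>\<^sub>F M in sequentially. norm (?J (f i) - (\<Sum>n<M. \<alpha> i n *\<^sub>C z n)) < \<rho>" if "i \<in> I" for i
  proof -
    have "(\<lambda>M. \<Sum>n<M. \<alpha> i n *\<^sub>C z n) \<longlonglongrightarrow> ?J (f i)"
      using has_sum_imp_sums[OF \<alpha>(2)] that I(2) by (auto simp: sums_def)
    from tendstoD[OF this \<open>0 < \<rho>\<close>] show ?thesis
      by (simp add: dist_norm norm_minus_commute)
  qed
  then have "\<forall>\<^sub>F M in sequentially. \<forall>i\<in>I. norm (?J (f i) - (\<Sum>n<M. \<alpha> i n *\<^sub>C z n)) < \<rho>"
    by (intro eventually_ball_finite[OF I(1)] ballI)
  then obtain M where M: "\<And>i. i \<in> I \<Longrightarrow> norm (?J (f i) - (\<Sum>n<M. \<alpha> i n *\<^sub>C z n)) < \<rho>"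
    unfolding eventually_sequentially by blast
  obtain y where y: "\<And>n. norm (y n) \<le> norm (z n)" "\<And>n. M \<le> n \<Longrightarrow> y n = 0"
    "\<And>i. i \<in> I \<Longrightarrow> norm (f i - (\<Sum>n<M. \<alpha> i n *\<^sub>C y n)) \<le> \<rho> + \<rho>"
    by (rule combination_approximation[where I = I and d = \<rho> and v = f and N = M and a = \<alpha> and z = z
          and r = \<rho>])
      (use I(1) \<open>0 < \<rho>\<close> M in \<open>auto intro: less_imp_le\<close>)
  define g where "g x = (\<Sum>n<M. \<alpha> x n *\<^sub>C y n)" for x
  have g_sum: "((\<lambda>n. \<alpha> x n *\<^sub>C y n) has_sum g x) UNIV" for x
    unfolding g_def by (rule has_sum_finite_neutralI[of "{..<M}"]) (use y(2) in auto)
  have "lp_le p c y" by (rule lp_le_mono[OF z(1) assms(1)]) (use y in auto)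
  then have g: "p_bounded p c (g ` K)"
    using \<alpha>(1) g_sum unfolding p_bounded_def by (blast intro: p_hullI)
  define h where "h x = f x - g x" for x
  define w where "w n = z n - ?J (y n)" for n
  have w: "norm (w n) \<le> 2 * norm (z n)" for n
    using norm_triangle_ineq4[of "z n" "?J (y n)"] y(1)[of n] by (simp add: w_def)
  have lin: "linear ?J" by (rule clinear_imp_linear[OF clinear_canonical_embedding])
  have h_sum: "((\<lambda>n. \<alpha> x n *\<^sub>C w n) has_sum ?J (h x)) UNIV" if "x \<in> K" for x
  proof -
    have "((\<lambda>n. \<alpha> x n *\<^sub>C ?J (y n)) has_sum ?J (g x)) UNIV"
      using has_sum_bounded_linear[OF bounded_linear_canonical_embedding g_sum]
      by (simp add: clinear_scaleC[OF clinear_canonical_embedding])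
    from has_sum_diff[OF \<alpha>(2)[OF that] this] show ?thesis
      by (simp add: h_def w_def linear_diff[OF lin] scaleC.diff_right)
  qed
  \<comment> \<open>This is the contribution of the indices n >= N to the difference of the errors
    at \<open>x\<close> and at \<open>r x\<close>.\<close>
  define T where "T x = ?J (h x) - ?J (h (r x)) - (\<Sum>n<N. (\<alpha> x n - \<alpha> (r x) n) *\<^sub>C w n)" for x
  have T: "p_bounded p (e / 4) (T ` K)"
    unfolding p_bounded_def
  proof (intro exI conjI image_subsetI)
    let ?t = "\<lambda>n. 4 *\<^sub>R (if n < N then 0 else z n)"
    let ?v = "\<lambda>n. 2 *\<^sub>R (if n < N then 0 else w n)"
    show "lp_le p (e / 4) ?v"
    proof (rule lp_le_mono)
      show "lp_le p (4 * (e / 16)) ?t" by (rule lp_le_scale[OF N]) simp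
      show "norm (?v n) \<le> norm (?t n)" for n using w[of n] by simp
    qed (use assms in auto)
    fix x assume "x \<in> K"
    then have "r x \<in> K" using I by blast
    show "T x \<in> p_hull p ?v"
    proof (rule p_hullI)
      show "dual_ball p (\<lambda>n. (\<alpha> x n - \<alpha> (r x) n) / 2)"
        using \<open>x \<in> K\<close> \<open>r x \<in> K\<close> \<alpha>(1) by (intro dual_ball_half_diff) auto
      have "((\<lambda>n. if n < N then (\<alpha> x n - \<alpha> (r x) n) *\<^sub>C w n else 0) has_sum
          (\<Sum>n<N. (\<alpha> x n - \<alpha> (r x) n) *\<^sub>C w n)) UNIV"
        by (rule has_sum_finite_neutralI[of "{..<N}"]) auto
      from has_sum_diff[OF has_sum_diff[OF h_sum[OF \<open>x \<in> K\<close>] h_sum[OF \<open>r x \<in> K\<close>]] this]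
      show "((\<lambda>n. ((\<alpha> x n - \<alpha> (r x) n) / 2) *\<^sub>C ?v n) has_sum T x) UNIV"
        unfolding T_def
      proof (rule has_sum_cong[THEN iffD1, rotated])
        fix n
        show "\<alpha> x n *\<^sub>C w n - \<alpha> (r x) n *\<^sub>C w n - (if n < N then (\<alpha> x n - \<alpha> (r x) n) *\<^sub>C w n else 0) =
            ((\<alpha> x n - \<alpha> (r x) n) / 2) *\<^sub>C ?v n"
        proof -
          have "(a / 2) *\<^sub>C 2 *\<^sub>R w n = a *\<^sub>C w n" for a
            by (simp add: scaleC_scaleC flip: scaleC_of_real)
          then show ?thesis by (simp add: scaleC.diff_left)
        qed
      qed
    qed
  qed
  have head: "p_bounded p (e / 4) ((\<lambda>x. \<Sum>n<N. (\<alpha> x n - \<alpha> (r x) n) *\<^sub>C w n) ` K)"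
  proof (rule p_bounded_sum[OF assms(1), where c = "\<lambda>n. norm (\<eta> *\<^sub>R w n)"])
    have "(\<Sum>n<N. norm (\<eta> *\<^sub>R w n)) \<le> (\<Sum>n<N. \<eta> * (2 * norm (z n)))"
      using w \<open>0 < \<eta>\<close> by (intro sum_mono) simp
    also have "\<dots> = 2 * \<eta> * Z" by (simp add: Z_def sum_distrib_left mult_ac)
    also have "\<dots> < 2 * \<eta> * (Z + 1)" using \<open>0 < \<eta>\<close> by simp
    also have "\<dots> = e / 8" using \<open>0 \<le> Z\<close> by (auto simp: \<eta>_def divide_simps)
    finally show "(\<Sum>n<N. norm (\<eta> *\<^sub>R w n)) < e / 4" using \<open>0 < e\<close> by simp
    fix n assume n: "n \<in> {..<N}"
    show "p_bounded p (norm (\<eta> *\<^sub>R w n)) ((\<lambda>x. (\<alpha> x n - \<alpha> (r x) n) *\<^sub>C w n) ` K)"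
    proof (rule p_bounded_mono[OF p_bounded_line])
      show "(\<lambda>x. (\<alpha> x n - \<alpha> (r x) n) *\<^sub>C w n) ` K \<subseteq> {c *\<^sub>C \<eta> *\<^sub>R w n |c. cmod c \<le> 1}"
      proof safe
        fix x assume "x \<in> K"
        show "\<exists>c. (\<alpha> x n - \<alpha> (r x) n) *\<^sub>C w n = c *\<^sub>C \<eta> *\<^sub>R w n \<and> cmod c \<le> 1"
          using I(4)[OF \<open>x \<in> K\<close>, of n] n \<open>0 < \<eta>\<close>
          by (intro exI[of _ "(\<alpha> x n - \<alpha> (r x) n) / of_real \<eta>"])
             (simp add: norm_divide scaleC_scaleC flip: scaleC_of_real)
      qed
    qed (use assms in auto)
  qed auto
  \<comment> \<open>Indicator coefficients write the step function given by the error at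
    \<open>r x\<close> as a finite sum of rank-one families.\<close>
  have base: "p_bounded p (e / 4) ((\<lambda>x. \<Sum>i\<in>I. (if r x = i then 1 else 0) *\<^sub>C ?J (h i)) ` K)"
  proof (rule p_bounded_sum[OF assms(1) I(1), where c = "\<lambda>i. norm (?J (h i))"])
    have "(\<Sum>i\<in>I. norm (?J (h i))) \<le> (\<Sum>i\<in>I. 2 * \<rho>)"
      using y(3) by (intro sum_mono) (simp add: h_def g_def)
    also have "\<dots> = card I * (2 * \<rho>)" by simp
    also have "\<dots> < (card I + 1) * (2 * \<rho>)" using \<open>0 < \<rho>\<close> by simp
    also have "\<dots> = e / 8"
      using of_nat_0_le_iff[of "card I", where 'a = real] by (auto simp: \<rho>_def divide_simps)
    finally show "(\<Sum>i\<in>I. norm (?J (h i))) < e / 4" using \<open>0 < e\<close> by simp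
    show "p_bounded p (norm (?J (h i))) ((\<lambda>x. (if r x = i then 1 else 0) *\<^sub>C ?J (h i)) ` K)" for i
    proof (rule p_bounded_mono[OF p_bounded_line[OF assms(1)]])
      show "(\<lambda>x. (if r x = i then 1 else 0) *\<^sub>C ?J (h i)) ` K \<subseteq> {c *\<^sub>C ?J (h i) |c. cmod c \<le> 1}"
        by (auto intro: exI[of _ "1 :: complex"] exI[of _ "0 :: complex"])
    qed (use assms in auto)
  qed auto
  \<comment> \<open>Addition needs strict room at each stage: 1/4 + 1/4 < 5/8 and 1/4 + 5/8 <
    1.\<close>
  have "p_bounded p e ((\<lambda>x. (\<Sum>i\<in>I. (if r x = i then 1 else 0) *\<^sub>C ?J (h i)) +
      ((\<Sum>n<N. (\<alpha> x n - \<alpha> (r x) n) *\<^sub>C w n) + T x)) ` K)"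
    by (rule p_bounded_add[OF assms(1) base p_bounded_add[OF assms(1) head T, of "e * 5 / 8"]])
       (use \<open>0 < e\<close> in auto)
  also have "(\<lambda>x. (\<Sum>i\<in>I. (if r x = i then 1 else 0) *\<^sub>C ?J (h i)) +
      ((\<Sum>n<N. (\<alpha> x n - \<alpha> (r x) n) *\<^sub>C w n) + T x)) ` K = (\<lambda>x. ?J (f x - g x)) ` K"
  proof (rule image_cong[OF refl])
    fix x assume "x \<in> K"
    have "(\<Sum>i\<in>I. (if r x = i then 1 else 0) *\<^sub>C ?J (h i)) = (\<Sum>i\<in>I. if i = r x then ?J (h i) else 0)"
      by (rule sum.cong) auto
    then have "(\<Sum>i\<in>I. (if r x = i then 1 else 0) *\<^sub>C ?J (h i)) = ?J (h (r x))"
      using I(1,3) \<open>x \<in> K\<close> by simp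
    then show "(\<Sum>i\<in>I. (if r x = i then 1 else 0) *\<^sub>C ?J (h i)) +
      ((\<Sum>n<N. (\<alpha> x n - \<alpha> (r x) n) *\<^sub>C w n) + T x) = ?J (f x - g x)"
      by (simp add: T_def h_def)
  qed
  finally show thesis using g that by blast
qed

text \<open>Peeling off the approximations of \<open>p_bounded_step\<close> one after the other writes every
  element of \<open>K\<close> as a series with terms in sets that are \<open>p\<close>-bounded in \<open>F\<close>.\<close>

theorem p_bounded_bidual:
  fixes K :: "'a::complex_banach set"
  assumes "1 \<le> p" "0 < e" and bd: "p_bounded p c (canonical_embedding ` K)"
  shows "p_bounded p (c + e) K"
proof -
  let ?J = "canonical_embedding :: 'a \<Rightarrow> _"
  have "0 \<le> c" using bd lp_le_nonneg by (auto simp: p_bounded_def)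
  \<comment> \<open>The first correction inherits the constant \<open>c\<close>; those with k > 0
    add up to e / 2.\<close>
  define d where "d k = (if k = 0 then c else e / 2 * (1 / 2) ^ k)" for k :: nat
  have d0: "0 \<le> d k" "0 < d (Suc k)" for k using \<open>0 \<le> c\<close> \<open>0 < e\<close> by (auto simp: d_def)
  \<comment> \<open>\<open>F k\<close> is the error left after \<open>k\<close> corrections,
    starting from the identity on \<open>K\<close>; the difference of consecutive errors is the
    correction itself.\<close>
  have "\<exists>F. \<forall>k. p_bounded p (d k) ((\<lambda>x. ?J (F k x)) ` K) \<and>
      p_bounded p (d k) ((\<lambda>x. F k x - F (Suc k) x) ` K) \<and> (k = 0 \<longrightarrow> F k = id)"
  proof -
    let ?P = "\<lambda>k f. p_bounded p (d k) ((\<lambda>x. ?J (f x)) ` K) \<and> (k = 0 \<longrightarrow> f = id)"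
    let ?Q = "\<lambda>k f f'. p_bounded p (d k) ((\<lambda>x. f x - f' x) ` K)"
    have "\<exists>f. \<forall>n. ?P n (f n) \<and> ?Q n (f n) (f (Suc n))"
    proof (rule dependent_nat_choice)
      show "\<exists>f. ?P 0 f" using bd by (intro exI[of _ id]) (simp add: d_def)
      fix f k assume f: "?P k f"
      then obtain g where g: "p_bounded p (d k) (g ` K)"
        "p_bounded p (d (Suc k)) ((\<lambda>x. ?J (f x - g x)) ` K)"
        using p_bounded_step[OF assms(1) d0(2)] by blast
      then show "\<exists>f'. ?P (Suc k) f' \<and> ?Q k f f'"
        by (intro exI[of _ "\<lambda>x. f x - g x"]) simp
    qed
    then show ?thesis by blast
  qed
  then obtain F where F: "\<And>k. p_bounded p (d k) ((\<lambda>x. ?J (F k x)) ` K)"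
    "\<And>k. p_bounded p (d k) ((\<lambda>x. F k x - F (Suc k) x) ` K)" "F 0 = id" by blast
  have d_sums: "d sums (c + e / 2)"
  proof -
    have d_eq: "d = (\<lambda>k. e / 2 * (1 / 2) ^ k + (if k \<in> {0} then c - e / 2 else 0))"
      by (auto simp: d_def fun_eq_iff)
    have "(\<lambda>k. e / 2 * (1 / 2) ^ k) sums (e / 2 * (1 / (1 - 1 / 2)))"
      by (intro sums_mult geometric_sums) auto
    from sums_add[OF this sums_If_finite_set[of "{0}" "\<lambda>_. c - e / 2"]] show ?thesis
      by (simp add: d_eq add.commute[of c])
  qed
  have "p_bounded p (c + e) (id ` K)"
  proof (rule p_bounded_sums_less[OF assms(1) d0(1) d_sums _ F(2)])
    fix x assume "x \<in> K"
    \<comment> \<open>The errors are controlled only in the bidual, but the embedding is isometric,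
      so they tend to 0 in the space itself and the corrections telescope to
      \<open>x\<close>.\<close>
    have "(\<lambda>k. F k x) \<longlonglongrightarrow> 0"
    proof (rule Lim_null_comparison)
      show "\<forall>\<^sub>F k in sequentially. norm (F k x) \<le> d k"
      proof (rule always_eventually, rule allI)
        fix k
        have "norm (?J (F k x)) \<le> d k"
          using p_bounded_norm_le[OF F(1) assms(1)] \<open>x \<in> K\<close> by blast
        then show "norm (F k x) \<le> d k" by simp
      qed
      show "d \<longlonglongrightarrow> 0" using sums_summable[OF d_sums] by (rule summable_LIMSEQ_zero)
    qed
    from telescope_sums'[OF this] show "(\<lambda>k. F k x - F (Suc k) x) sums id x" by (simp add: F(3))
  qed (use \<open>0 < e\<close> in auto)
  then show ?thesis by simp
qed

section \<open>Return to relative p-compactness and \<open>m_p\<close>\<close>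

lemma p_bounded_iff_p_co:
  assumes "1 \<le> p"
  shows "p_bounded p c S \<longleftrightarrow> (\<exists>y\<in>ell (ennreal p). ell_norm (ennreal p) y \<le> c \<and> S \<subseteq> p_co p y)"
  unfolding p_bounded_def using lp_le_iff_ell[OF assms] p_co_eq_p_hull[OF assms] by blast

lemma relatively_p_compact_iff:
  assumes "1 \<le> p"
  shows "relatively_p_compact p S \<longleftrightarrow> (\<exists>c. p_bounded p c S)"
proof -
  have "closure (p_co p y) = p_co p y" if "y \<in> ell (ennreal p)" for y :: "nat \<Rightarrow> 'a"
  proof -
    have y: "lp_le p (ell_norm (ennreal p) y) y" using that lp_le_iff_ell[OF assms] by blast
    show ?thesis
      using compact_imp_closed[OF compact_p_hull[OF assms y]] p_co_eq_p_hull[OF assms y] by simp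
  qed
  then show ?thesis
    unfolding relatively_p_compact_def p_bounded_iff_p_co[OF assms] by fastforce
qed

text \<open>Transferring witnesses with an arbitrarily small loss is enough, as the infimum absorbs
  it. If \<open>T\<close> has no witness, the right-hand side is \<open>top\<close>.\<close>

lemma m_p_le:
  assumes "1 \<le> p" and le: "\<And>c e. 0 < e \<Longrightarrow> p_bounded p c T \<Longrightarrow> p_bounded p (c + e) S"
  shows "m_p p S \<le> m_p p T"
  unfolding m_p_def[of p T]
proof (rule INF_greatest)
  fix y assume y: "y \<in> {y \<in> ell (ennreal p). T \<subseteq> p_co p y}"
  let ?c = "ell_norm (ennreal p) y"
  have "0 \<le> ?c" using y lp_le_iff_ell[OF assms(1)] lp_le_nonneg by blast
  show "m_p p S \<le> ennreal ?c"
  proof (rule ennreal_le_epsilon)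
    fix e :: real assume "0 < e"
    have "p_bounded p ?c T" using y p_bounded_iff_p_co[OF assms(1)] by blast
    from le[OF \<open>0 < e\<close> this] obtain x where x: "x \<in> ell (ennreal p)"
      "ell_norm (ennreal p) x \<le> ?c + e" "S \<subseteq> p_co p x"
      using p_bounded_iff_p_co[OF assms(1)] by blast
    have "m_p p S \<le> ennreal (ell_norm (ennreal p) x)"
      unfolding m_p_def using x by (intro INF_lower) auto
    also have "\<dots> \<le> ennreal (?c + e)" using x(2) by (rule ennreal_leI)
    finally show "m_p p S \<le> ennreal ?c + ennreal e" using \<open>0 \<le> ?c\<close> \<open>0 < e\<close> by simp
  qed
qed

subsection \<open>Symmetric multilinear forms and polarization\<close>

lemma multilinearD: "multilinear m A \<Longrightarrow> length xs = m \<Longrightarrow> i < m \<Longrightarrow> clinear (\<lambda>x. A (xs[i := x]))"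
  by (simp add: multilinear_def)

lemma symmetric_multilinear_imp_multilinear: "symmetric_multilinear m A \<Longrightarrow> multilinear m A"
  by (simp only: symmetric_multilinear_def)

lemma symmetric_multilinear_mset_cong:
  "symmetric_multilinear m A \<Longrightarrow> length xs = m \<Longrightarrow> mset xs = mset ys \<Longrightarrow> A xs = A ys"
  unfolding symmetric_multilinear_def by blast

lemma multilinear_Cons:
  assumes "multilinear (Suc m) A"
  shows "multilinear m (\<lambda>xs. A (x # xs))"
  unfolding multilinear_def
proof (intro allI impI)
  fix xs :: "'a list" and i assume "length xs = m" "i < m"
  then show "clinear (\<lambda>y. A (x # xs[i := y]))"
    using multilinearD[OF assms, of "x # xs" "Suc i"] by simp
qed

lemma multilinear_clinear_hd: "multilinear (Suc m) A \<Longrightarrow> length xs = m \<Longrightarrow> clinear (\<lambda>x. A (x # xs))"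
  using multilinearD[of "Suc m" A "0 # xs" 0] by simp

lemma multilinear_expand:
  assumes "multilinear m A" "finite I"
  shows "A (replicate m (\<Sum>i\<in>I. x i)) = (\<Sum>is | set is \<subseteq> I \<and> length is = m. A (map x is))"
  using assms(1)
proof (induction m arbitrary: A)
  case 0
  have "{is. set is \<subseteq> I \<and> length is = 0} = {[]}" by auto
  then show ?case by simp
next
  case (Suc m)
  let ?L = "{is. set is \<subseteq> I \<and> length is = m}"
  have "A (replicate (Suc m) (\<Sum>i\<in>I. x i)) = (\<Sum>i\<in>I. A (x i # replicate m (\<Sum>i\<in>I. x i)))"
    using clinear_sum[OF multilinear_clinear_hd[OF Suc.prems, of "replicate m (\<Sum>i\<in>I. x i)"]] by simp
  also have "\<dots> = (\<Sum>i\<in>I. \<Sum>is\<in>?L. A (map x (i # is)))"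
    using Suc.IH[OF multilinear_Cons[OF Suc.prems]] by simp
  also have "\<dots> = (\<Sum>(is, i)\<in>?L \<times> I. A (map x (i # is)))"
    by (subst sum.swap) (simp add: sum.cartesian_product)
  also have "\<dots> = (\<Sum>is\<in>(\<lambda>(is, i). i # is) ` (?L \<times> I). A (map x is))"
    by (subst sum.reindex) (auto simp: inj_on_def case_prod_unfold)
  finally show ?case by (simp only: lists_length_Suc_eq)
qed

lemma multilinear_scaleC:
  assumes "multilinear m A" "length xs = m"
  shows "A (map ((*\<^sub>C) c) xs) = c ^ m *\<^sub>C A xs"
  using assms
proof (induction m arbitrary: A xs)
  case (Suc m)
  then obtain x ys where xs: "xs = x # ys" "length ys = m" by (auto simp: length_Suc_conv)
  have "A (map ((*\<^sub>C) c) xs) = c *\<^sub>C A (x # map ((*\<^sub>C) c) ys)"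
    using clinear_scaleC[OF multilinear_clinear_hd[OF Suc.prems(1), of "map ((*\<^sub>C) c) ys"]] xs by simp
  also have "\<dots> = c ^ Suc m *\<^sub>C A xs"
    using Suc.IH[OF multilinear_Cons[OF Suc.prems(1)] xs(2)] xs by (simp add: scaleC_scaleC)
  finally show ?case .
qed simp

lemma multilinear_bound:
  assumes "multilinear m A" "\<And>us. length us = m \<Longrightarrow> \<forall>u\<in>set us. norm u \<le> 1 \<Longrightarrow> norm (A us) \<le> C"
    and "length xs = m"
  shows "norm (A xs) \<le> C * prod_list (map norm xs)"
  using assms
proof (induction m arbitrary: A xs)
  case (Suc m)
  then obtain x ys where xs: "xs = x # ys" "length ys = m" by (auto simp: length_Suc_conv)
  define u where "u = sgn x"
  have u: "norm u \<le> 1" "x = complex_of_real (norm x) *\<^sub>C u"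
    by (cases "x = 0"; simp add: u_def norm_sgn scaleC_of_real sgn_div_norm)+
  have "norm (A (u # ys)) \<le> C * prod_list (map norm ys)"
    by (rule Suc.IH[OF multilinear_Cons[OF Suc.prems(1)] _ xs(2)]) (use Suc.prems(2) u in auto)
  moreover have "A xs = complex_of_real (norm x) *\<^sub>C A (u # ys)"
    using clinear_scaleC[OF multilinear_clinear_hd[OF Suc.prems(1) xs(2)], of "norm x" u] u(2) xs(1)
    by simp
  ultimately show ?case
    using mult_left_mono[of "norm (A (u # ys))" "C * prod_list (map norm ys)" "norm x"]
    by (simp add: norm_scaleC xs mult_ac)
qed simp

text \<open>An element of \<open>U\<close> outside \<open>T\<close> pairs each \<open>S\<close>
  avoiding it with the set obtained by inserting it, of opposite sign. In the polarization formula
  this cancels all index lists that miss an index.\<close>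

lemma alternating_sum_supersets:
  assumes "finite U" "T \<subseteq> U"
  shows "(\<Sum>S | T \<subseteq> S \<and> S \<subseteq> U. (-1) ^ (card U - card S)) = (if T = U then 1 else 0 :: real)"
proof (cases "T = U")
  case True
  then have "{S. T \<subseteq> S \<and> S \<subseteq> U} = {U}" by auto
  with True show ?thesis by simp
next
  case False
  then obtain a where a: "a \<in> U" "a \<notin> T" using assms by blast
  let ?X = "{S. T \<subseteq> S \<and> S \<subseteq> U - {a}}"
  have fin: "finite ?X" using assms(1) by auto
  have "{S. T \<subseteq> S \<and> S \<subseteq> U} = ?X \<union> insert a ` ?X"
  proof (intro equalityI subsetI)
    fix S assume S: "S \<in> {S. T \<subseteq> S \<and> S \<subseteq> U}"
    show "S \<in> ?X \<union> insert a ` ?X"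
    proof (cases "a \<in> S")
      case True
      then have "S = insert a (S - {a})" by auto
      moreover have "S - {a} \<in> ?X" using S a by auto
      ultimately show ?thesis by blast
    qed (use S in auto)
  qed (use a in auto)
  moreover have "?X \<inter> insert a ` ?X = {}" by auto
  moreover have "inj_on (insert a) ?X" by (rule inj_onI) blast
  ultimately have "(\<Sum>S | T \<subseteq> S \<and> S \<subseteq> U. (-1) ^ (card U - card S)) =
      (\<Sum>S\<in>?X. (-1) ^ (card U - card S) + (-1) ^ (card U - card (insert a S)) :: real)"
    using fin by (simp add: sum.union_disjoint sum.reindex sum.distrib)
  also have "\<dots> = (\<Sum>S\<in>?X. 0)"
  proof (rule sum.cong)
    fix S assume S: "S \<in> ?X"
    then have "finite S" "a \<notin> S" using assms(1) finite_subset[of S U] by auto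
    moreover have "card (insert a S) \<le> card U" using S a assms(1) by (intro card_mono) auto
    ultimately obtain k where "card U - card S = Suc k" "card U - card (insert a S) = k"
      by (auto simp: card_insert_if le_iff_add)
    then show "(-1) ^ (card U - card S) + (-1) ^ (card U - card (insert a S)) = (0 :: real)" by simp
  qed simp
  finally show ?thesis using False by simp
qed

text \<open>The classical polarization formula over subset sums. It refers to \<open>P\<close>
  alone, which gives the uniqueness of the symmetric form.\<close>

definition polarization :: "nat \<Rightarrow> ('a::complex_banach \<Rightarrow> 'b::complex_banach) \<Rightarrow> 'a list \<Rightarrow> 'b"
  where "polarization m P xs =
    (\<Sum>S\<in>Pow {..<m}. (-1) ^ (m - card S) *\<^sub>R P (\<Sum>i\<in>S. xs ! i)) /\<^sub>R fact m"

text \<open>Permutations written as lists, to match the index lists of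
  \<open>multilinear_expand\<close>.\<close>

definition index_lists :: "nat \<Rightarrow> nat list set"
  where "index_lists m = {is. length is = m \<and> distinct is \<and> set is \<subseteq> {..<m}}"

lemma card_index_lists: "card (index_lists m) = fact m"
  using card_lists_distinct_length_eq[of "{..<m}" m] by (simp add: index_lists_def fact_prod)

lemma index_lists_iff: "is \<in> index_lists m \<longleftrightarrow> length is = m \<and> set is = {..<m}"
proof
  assume "is \<in> index_lists m"
  then have *: "length is = m" "distinct is" "set is \<subseteq> {..<m}" by (auto simp: index_lists_def)
  then have "card (set is) = m" by (simp add: distinct_card)
  with * show "length is = m \<and> set is = {..<m}" using card_subset_eq[of "{..<m}" "set is"] by auto
next
  assume "length is = m \<and> set is = {..<m}"
  then show "is \<in> index_lists m" by (auto simp: index_lists_def card_distinct)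
qed

text \<open>After expanding every \<open>P\<close> and exchanging the sums, an index list carries
  the alternating sum over the supersets of its range. Only lists hitting all \<open>m\<close>
  indices survive, so the formula symmetrises \<open>A\<close>.\<close>

lemma polarization_eq:
  assumes A: "multilinear m A" and P: "\<And>x. P x = A (replicate m x)"
  shows "polarization m P xs = (\<Sum>is\<in>index_lists m. A (map ((!) xs) is)) /\<^sub>R fact m"
proof -
  let ?U = "{..<m}"
  let ?L = "{is. set is \<subseteq> ?U \<and> length is = m}"
  have finL: "finite ?L" by (rule finite_lists_length_eq) simp
  have "(\<Sum>S\<in>Pow ?U. (-1) ^ (m - card S) *\<^sub>R P (\<Sum>i\<in>S. xs ! i)) =
      (\<Sum>S\<in>Pow ?U. \<Sum>is\<in>?L. (if set is \<subseteq> S then (-1) ^ (m - card S) else 0) *\<^sub>R A (map ((!) xs) is))"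
  proof (rule sum.cong[OF refl])
    fix S assume "S \<in> Pow ?U"
    then have "finite S" "S \<subseteq> ?U" using finite_subset by auto
    have "P (\<Sum>i\<in>S. xs ! i) = (\<Sum>is | set is \<subseteq> S \<and> length is = m. A (map ((!) xs) is))"
      unfolding P by (rule multilinear_expand[OF A \<open>finite S\<close>])
    also have "\<dots> = (\<Sum>is\<in>?L. if set is \<subseteq> S then A (map ((!) xs) is) else 0)"
      using finL \<open>S \<subseteq> ?U\<close> by (intro sum.mono_neutral_cong_left) auto
    finally show "(-1) ^ (m - card S) *\<^sub>R P (\<Sum>i\<in>S. xs ! i) =
        (\<Sum>is\<in>?L. (if set is \<subseteq> S then (-1) ^ (m - card S) else 0) *\<^sub>R A (map ((!) xs) is))"
      by (auto simp: scaleR_sum_right intro!: sum.cong)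
  qed
  also have "\<dots> = (\<Sum>is\<in>?L. (\<Sum>S\<in>Pow ?U. if set is \<subseteq> S then (-1) ^ (m - card S) else 0) *\<^sub>R A (map ((!) xs) is))"
    by (subst sum.swap) (simp add: scaleR_sum_left)
  also have "\<dots> = (\<Sum>is\<in>?L. (if set is = ?U then 1 else 0) *\<^sub>R A (map ((!) xs) is))"
  proof (intro sum.cong refl arg_cong2[where f = scaleR])
    fix "is" assume "is \<in> ?L"
    have "(\<Sum>S\<in>Pow ?U. if set is \<subseteq> S then (-1) ^ (m - card S) else 0 :: real) =
        (\<Sum>S | set is \<subseteq> S \<and> S \<subseteq> ?U. (-1) ^ (card ?U - card S))"
      by (rule sum.mono_neutral_cong_right) auto
    then show "(\<Sum>S\<in>Pow ?U. if set is \<subseteq> S then (-1) ^ (m - card S) else 0 :: real) =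
        (if set is = ?U then 1 else 0)"
      using alternating_sum_supersets[of ?U "set is"] \<open>is \<in> ?L\<close> by simp
  qed
  also have "\<dots> = (\<Sum>is\<in>index_lists m. A (map ((!) xs) is))"
    using finL by (intro sum.mono_neutral_cong_right) (auto simp: index_lists_iff)
  finally show ?thesis by (simp add: polarization_def)
qed

lemma polarization_symmetric_multilinear:
  assumes "symmetric_multilinear m A" "\<And>x. P x = A (replicate m x)" "length xs = m"
  shows "polarization m P xs = A xs"
proof -
  note A = symmetric_multilinear_imp_multilinear[OF assms(1)]
    symmetric_multilinear_mset_cong[OF assms(1)]
  have "A (map ((!) xs) is) = A xs" if "is \<in> index_lists m" for "is"
  proof (rule A(2))
    have "distinct is" "set is = {..<m}" "length is = m"
      using that index_lists_iff[of "is" m] by (auto simp: index_lists_def)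
    then have "mset is = mset [0..<m]"
      using set_eq_iff_mset_eq_distinct[of "is" "[0..<m]"] by (simp add: atLeast0LessThan)
    then have "mset (map ((!) xs) is) = mset (map ((!) xs) [0..<m])" by (simp only: mset_map)
    also have "map ((!) xs) [0..<m] = xs" using assms(3) map_nth by blast
    finally show "mset (map ((!) xs) is) = mset xs" .
    show "length (map ((!) xs) is) = m" using \<open>length is = m\<close> by simp
  qed
  then show ?thesis
    by (simp add: polarization_eq[OF A(1) assms(2)] card_index_lists scaleR_conv_of_real
        sum_constant_scaleR)
qed

text \<open>Linearity is read off the average over permutations, in each of which the changed index
  occupies exactly one position. Symmetry is read off the subset formula, where permuting the
  arguments only relabels the subsets.\<close>

lemma symmetric_multilinear_polarization:
  assumes A: "multilinear m A" and P: "\<And>x. P x = A (replicate m x)"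
  shows "symmetric_multilinear m (polarization m P)"
  unfolding symmetric_multilinear_def
proof (intro conjI allI impI)
  show "multilinear m (polarization m P)"
    unfolding multilinear_def
  proof (intro allI impI)
    fix xs :: "'a list" and i assume i: "length xs = m" "i < m"
    have cl: "clinear (\<lambda>x. A (map ((!) (xs[i := x])) is))" if "is \<in> index_lists m" for "is"
    proof -
      have "distinct is" "set is = {..<m}" "length is = m"
        using that index_lists_iff[of "is" m] by (auto simp: index_lists_def)
      then have "i \<in> set is" using i(2) by simp
      then obtain j where j: "j < m" "is ! j = i" using \<open>length is = m\<close> by (auto simp: in_set_conv_nth)
      have "map ((!) (xs[i := x])) is = (map ((!) xs) is)[j := x]" for x
      proof (rule nth_equalityI)
        fix k assume "k < length (map ((!) (xs[i := x])) is)"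
        then have k: "k < m" using \<open>length is = m\<close> by simp
        then have "is ! k < m" using \<open>set is = {..<m}\<close> \<open>length is = m\<close> nth_mem by blast
        moreover have "is ! k = i \<longleftrightarrow> k = j"
          using \<open>distinct is\<close> \<open>length is = m\<close> j k nth_eq_iff_index_eq by blast
        ultimately show "map ((!) (xs[i := x])) is ! k = (map ((!) xs) is)[j := x] ! k"
          using k j i \<open>length is = m\<close> by (auto simp: nth_list_update)
      qed simp
      then show ?thesis
        using multilinearD[OF A, of "map ((!) xs) is" j] j(1) \<open>length is = m\<close> by simp
    qed
    show "clinear (\<lambda>x. polarization m P (xs[i := x]))"
      unfolding clinear_def polarization_eq[OF A P]
      by (auto simp: clinear_add[OF cl] clinear_scaleC[OF cl] sum.distrib scaleR_add_right
          scaleC.sum_right scaleC.scaleR_right)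
  qed
  fix xs ys :: "'a list" assume "length xs = m" "mset xs = mset ys"
  then obtain f where f: "f permutes {..<m}" "permute_list f ys = xs"
    using mset_eq_permutation[of xs ys] by (metis size_mset)
  have m: "length ys = m" using \<open>length xs = m\<close> \<open>mset xs = mset ys\<close> by (metis size_mset)
  have bij: "bij_betw f {..<m} {..<m}" using f(1) by (rule permutes_imp_bij)
  have "(\<Sum>S\<in>Pow {..<m}. (-1) ^ (m - card S) *\<^sub>R P (\<Sum>i\<in>S. xs ! i)) =
      (\<Sum>S\<in>Pow {..<m}. (-1) ^ (m - card (f ` S)) *\<^sub>R P (\<Sum>i\<in>f ` S. ys ! i))"
  proof (rule sum.cong[OF refl])
    fix S assume S: "S \<in> Pow {..<m}"
    have inj: "inj_on f S" using permutes_inj[OF f(1)] by (rule inj_on_subset) simp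
    have "xs ! i = ys ! f i" if "i \<in> S" for i
      using S that f m permute_list_nth[of f ys i] by auto
    then have "(\<Sum>i\<in>S. xs ! i) = (\<Sum>i\<in>f ` S. ys ! i)"
      by (simp add: sum.reindex[OF inj])
    then show "(-1) ^ (m - card S) *\<^sub>R P (\<Sum>i\<in>S. xs ! i) =
        (-1) ^ (m - card (f ` S)) *\<^sub>R P (\<Sum>i\<in>f ` S. ys ! i)"
      by (simp add: card_image[OF inj])
  qed
  also have "\<dots> = (\<Sum>S\<in>Pow {..<m}. (-1) ^ (m - card S) *\<^sub>R P (\<Sum>i\<in>S. ys ! i))"
    by (rule sum.reindex_bij_betw[OF bij_betw_Pow[OF bij]])
  finally show "polarization m P xs = polarization m P ys" by (simp add: polarization_def)
qed

lemma polarization_diagonal: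
  assumes A: "multilinear m A" and P: "\<And>x. P x = A (replicate m x)"
  shows "polarization m P (replicate m x) = P x"
proof -
  have "map ((!) (replicate m x)) is = replicate m x" if "is \<in> index_lists m" for "is"
    using that by (intro replicate_eqI) (auto simp: index_lists_iff)
  then show ?thesis
    by (simp add: polarization_eq[OF A P] P card_index_lists sum_constant_scaleR)
qed

lemma symmetric_multilinear_cong:
  assumes A: "symmetric_multilinear m A" and eq: "\<And>xs. length xs = m \<Longrightarrow> B xs = A xs"
  shows "symmetric_multilinear m B"
  unfolding symmetric_multilinear_def multilinear_def
proof (intro conjI allI impI)
  fix xs :: "'a list" and i assume "length xs = m" "i < m"
  then show "clinear (\<lambda>x. B (xs[i := x]))"
    using multilinearD[OF symmetric_multilinear_imp_multilinear[OF A]] by (simp add: eq)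
next
  fix xs ys :: "'a list" assume *: "length xs = m" "mset xs = mset ys"
  then have "length ys = m" using mset_eq_length by fastforce
  with * show "B xs = B ys" using symmetric_multilinear_mset_cong[OF A] eq by metis
qed

text \<open>The definite description is unique because any symmetric form of \<open>P\<close> is
  recovered by \<open>polarization\<close> on lists of length \<open>m\<close> and is fixed
  elsewhere by the normalisation.\<close>

lemma polar_form_eq:
  assumes "P \<in> hom_polynomials m"
  shows "polar_form m P = (\<lambda>xs. if length xs = m then polarization m P xs else 0)"
proof -
  obtain A where A: "multilinear m A" "\<And>x. P x = A (replicate m x)"
    using assms by (auto simp: hom_polynomials_def)
  let ?B = "\<lambda>xs. if length xs = m then polarization m P xs else 0"
  note sym = symmetric_multilinear_polarization[OF A]
  have "symmetric_multilinear m ?B"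
    by (rule symmetric_multilinear_cong[OF sym]) simp
  then have B: "symmetric_multilinear m ?B \<and> (\<forall>xs. length xs \<noteq> m \<longrightarrow> ?B xs = 0) \<and>
      (\<forall>x. P x = ?B (replicate m x))"
    by (simp add: polarization_diagonal[OF A])
  have uniq: "B = ?B"
    if B: "symmetric_multilinear m B" "\<And>xs. length xs \<noteq> m \<Longrightarrow> B xs = 0" "\<And>x. P x = B (replicate m x)" for B
  proof
    fix xs
    show "B xs = ?B xs"
      using polarization_symmetric_multilinear[OF B(1,3), of xs] B(2)[of xs] by (cases "length xs = m") simp_all
  qed
  show ?thesis
    unfolding polar_form_def
  proof (rule the_equality, fact B)
    fix B' assume "symmetric_multilinear m B' \<and> (\<forall>xs. length xs \<noteq> m \<longrightarrow> B' xs = 0) \<and>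
      (\<forall>x. P x = B' (replicate m x))"
    then show "B' = ?B" by (intro uniq) blast+
  qed
qed

lemma polar_form:
  assumes "P \<in> hom_polynomials m"
  shows "symmetric_multilinear m (polar_form m P)" and "polar_form m P (replicate m x) = P x"
proof -
  obtain A where A: "multilinear m A" "\<And>x. P x = A (replicate m x)"
    using assms by (auto simp: hom_polynomials_def)
  show "symmetric_multilinear m (polar_form m P)"
    by (rule symmetric_multilinear_cong[OF symmetric_multilinear_polarization[OF A]])
       (simp add: polar_form_eq[OF assms])
  show "polar_form m P (replicate m x) = P x"
    by (simp add: polar_form_eq[OF assms] polarization_diagonal[OF A])
qed

lemma hom_polynomial_bounded:
  assumes "P \<in> hom_polynomials m"
  obtains C where "\<And>x. norm x \<le> 1 \<Longrightarrow> norm (P x) \<le> C"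
proof -
  obtain A where A: "multilinear m A" "\<And>x. P x = A (replicate m x)"
    using assms by (auto simp: hom_polynomials_def)
  have "continuous (at 0) P"
    using assms by (simp add: hom_polynomials_def continuous_on_eq_continuous_at)
  then obtain d where d: "0 < d" "\<And>x. norm x < d \<Longrightarrow> norm (P x - P 0) < 1"
    unfolding continuous_at_eps_delta by (metis dist_norm diff_zero zero_less_one)
  define c where "c = complex_of_real (d / 2)"
  have "norm (P x) \<le> (1 + norm (P 0)) / cmod (c ^ m)" if "norm x \<le> 1" for x
  proof -
    have "P (c *\<^sub>C x) = c ^ m *\<^sub>C P x"
      using multilinear_scaleC[OF A(1), of "replicate m x" c] by (simp add: A(2))
    moreover have "norm (c *\<^sub>C x) < d"
      using that d(1) mult_left_mono[of "norm x" 1 "d / 2"] by (simp add: norm_scaleC c_def)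
    ultimately have "cmod (c ^ m) * norm (P x) \<le> 1 + norm (P 0)"
      using d(2)[of "c *\<^sub>C x"] norm_triangle_sub[of "P (c *\<^sub>C x)" "P 0"] by (simp add: norm_scaleC)
    moreover have "0 < cmod (c ^ m)" using d(1) by (simp add: c_def)
    ultimately show ?thesis by (simp add: pos_le_divide_eq mult.commute)
  qed
  then show thesis by (rule that)
qed

text \<open>A subset sum of \<open>m\<close> vectors of the unit ball has norm at most
  \<open>m\<close>, where homogeneity bounds \<open>P\<close> by m^m B. Summing over the 2^m subsets
  gives a crude but sufficient constant.\<close>

lemma polar_form_bounded:
  assumes "P \<in> hom_polynomials m"
  obtains C where "0 \<le> C"
    and "\<And>xs. length xs = m \<Longrightarrow> norm (polar_form m P xs) \<le> C * prod_list (map norm xs)"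
proof -
  obtain A where A: "multilinear m A" "\<And>x. P x = A (replicate m x)"
    using assms by (auto simp: hom_polynomials_def)
  obtain B where B: "\<And>x. norm x \<le> 1 \<Longrightarrow> norm (P x) \<le> B"
    using hom_polynomial_bounded[OF assms] by blast
  have "0 \<le> B" using order_trans[OF norm_ge_zero B[of 0]] by simp
  have scaled: "norm (P x) \<le> real m ^ m * B" if "norm x \<le> m" for x
  proof (cases "m = 0")
    case True
    with that show ?thesis using B[of x] by simp
  next
    case False
    let ?u = "x /\<^sub>R m"
    have "complex_of_real m *\<^sub>C ?u = x" using False unfolding scaleC_of_real by simp
    then have "P x = complex_of_real m ^ m *\<^sub>C P ?u"
      using multilinear_scaleC[OF A(1), of "replicate m ?u" "complex_of_real m"]
      by (simp only: A(2) map_replicate length_replicate simp_thms)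
    then have "norm (P x) = real m ^ m * norm (P ?u)" by (simp add: norm_scaleC norm_power)
    also have "\<dots> \<le> real m ^ m * B"
      using that False by (intro mult_left_mono B) (auto simp: field_simps)
    finally show ?thesis .
  qed
  define C where "C = (\<Sum>S\<in>Pow {..<m}. real m ^ m * B)"
  have "0 \<le> C" using \<open>0 \<le> B\<close> by (simp add: C_def)
  have "norm (polar_form m P us) \<le> C" if us: "length us = m" "\<forall>u\<in>set us. norm u \<le> 1" for us
  proof -
    have bound: "norm (\<Sum>S\<in>Pow {..<m}. (-1) ^ (m - card S) *\<^sub>R P (\<Sum>i\<in>S. us ! i)) \<le> C"
      unfolding C_def
    proof (rule sum_norm_le)
      fix S assume "S \<in> Pow {..<m}"
      then have S: "S \<subseteq> {..<m}" by simp
      have "norm (\<Sum>i\<in>S. us ! i) \<le> (\<Sum>i\<in>S. 1)"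
        using S us by (intro sum_norm_le) (auto simp: subset_iff)
      also have "\<dots> \<le> real m" using card_mono[OF _ S] by simp
      finally show "norm ((-1) ^ (m - card S) *\<^sub>R P (\<Sum>i\<in>S. us ! i)) \<le> real m ^ m * B"
        using scaled by simp
    qed
    have eq: "polar_form m P us = (\<Sum>S\<in>Pow {..<m}. (-1) ^ (m - card S) *\<^sub>R P (\<Sum>i\<in>S. us ! i)) /\<^sub>R fact m"
      using us by (simp add: polar_form_eq[OF assms] polarization_def)
    have "norm (v /\<^sub>R fact m) \<le> norm v" for v :: 'b
      using mult_right_mono[of "inverse (fact m)" 1 "norm v"] by (simp add: inverse_le_1_iff fact_ge_1)
    then show ?thesis unfolding eq using bound by (rule order_trans)
  qed
  note bound = this
  show thesis
  proof (rule that[OF \<open>0 \<le> C\<close>])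
    fix xs :: "'a list" assume "length xs = m"
    show "norm (polar_form m P xs) \<le> C * prod_list (map norm xs)"
      by (rule multilinear_bound[OF symmetric_multilinear_imp_multilinear[OF polar_form(1)[OF assms]]])
         (fact bound, fact)
  qed
qed

subsection \<open>Existence and uniqueness of the Aron--Berner extension\<close>

text \<open>The filter is generated by subbasic weak-star neighbourhoods of \<open>z\<close>, pulled
  back to the space and cut down to the ball of radius \<open>norm z\<close>. Goldstine's theorem is
  exactly their finite intersection property.\<close>

lemma bounded_weak_star_net_exists:
  fixes z :: "'a::complex_banach cdual cdual"
  obtains \<F> where "bounded_weak_star_net \<F> z"
proof -
  define S where "S = (\<lambda>(\<phi>, d). {x. norm x \<le> norm z \<and> cmod (cdual_apply \<phi> x - cdual_apply z \<phi>) \<le> d})"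
  define \<F> where "\<F> = (INF i\<in>UNIV \<times> {0<..}. principal (S i))"
  have ev: "\<forall>\<^sub>F x in \<F>. x \<in> S (\<phi>, d)" if "0 < d" for \<phi> d
    unfolding \<F>_def by (rule eventually_INF1[of "(\<phi>, d)"]) (use that in \<open>auto simp: eventually_principal\<close>)
  have "\<F> \<noteq> bot"
    unfolding \<F>_def
  proof (rule INF_filter_not_bot)
    fix X :: "('a cdual \<times> real) set" assume X: "X \<subseteq> UNIV \<times> {0<..}" "finite X"
    show "(INF i\<in>X. principal (S i)) \<noteq> bot"
    proof (cases "X = {}")
      case False
      define d where "d = Min (snd ` X)"
      have "d \<in> snd ` X" unfolding d_def using False X(2) by (intro Min_in) auto
      with X have "0 < d" by auto
      obtain x where x: "norm x \<le> norm z"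
        "\<And>\<phi>. \<phi> \<in> fst ` X \<Longrightarrow> cmod (cdual_apply z \<phi> - cdual_apply \<phi> x) \<le> d"
        using Goldstine[of "fst ` X" d z] X(2) \<open>0 < d\<close> by auto
      have "x \<in> S i" if "i \<in> X" for i
      proof -
        have "d \<le> snd i" unfolding d_def using X(2) that by (intro Min_le) auto
        then show ?thesis
          using x(1) x(2)[of "fst i"] that by (simp add: S_def case_prod_unfold norm_minus_commute)
      qed
      then have "x \<in> \<Inter> (S ` X)" by blast
      then show ?thesis
        unfolding INF_principal_finite[OF X(2)] principal_eq_bot_iff by blast
    next
      case True
      then show ?thesis by (auto simp: filter_eq_iff intro: exI[of _ "\<lambda>_. False"])
    qed
  qed
  moreover have "\<forall>\<^sub>F x in \<F>. norm x \<le> norm z"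
    using ev[of 1 0] by (rule eventually_mono) (auto simp: S_def)
  moreover have "((\<lambda>x. cdual_apply (canonical_embedding x) \<phi>) \<longlongrightarrow> cdual_apply z \<phi>) \<F>" for \<phi>
    unfolding tendsto_iff
  proof (intro allI impI)
    fix e :: real assume "0 < e"
    then have "\<forall>\<^sub>F x in \<F>. x \<in> S (\<phi>, e/2)" by (intro ev) simp
    then show "\<forall>\<^sub>F x in \<F>. dist (cdual_apply (canonical_embedding x) \<phi>) (cdual_apply z \<phi>) < e"
      by (rule eventually_mono)
         (use \<open>0 < e\<close> in \<open>auto simp: S_def dist_norm cdual_apply_canonical_embedding\<close>)
  qed
  ultimately show thesis
    using that unfolding bounded_weak_star_net_def limitin_weak_star_iff by blast
qed

section \<open>The iterated limit as a recursively defined scalar form\<close>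

definition bounded_multilinear ::
    "nat \<Rightarrow> real \<Rightarrow> ('a::complex_banach list \<Rightarrow> 'b::complex_banach) \<Rightarrow> bool"
  where "bounded_multilinear m C B \<longleftrightarrow> 0 \<le> C \<and> multilinear m B \<and>
    (\<forall>xs. length xs = m \<longrightarrow> norm (B xs) \<le> C * prod_list (map norm xs))"

lemma bounded_multilinear_Cons:
  assumes "bounded_multilinear (Suc m) C B"
  shows "bounded_multilinear m (C * norm x) (\<lambda>xs. B (x # xs))"
  unfolding bounded_multilinear_def
proof (intro conjI allI impI)
  fix xs :: "'a list" assume "length xs = m"
  then have "norm (B (x # xs)) \<le> C * prod_list (map norm (x # xs))"
    using assms unfolding bounded_multilinear_def by (metis length_Cons)
  then show "norm (B (x # xs)) \<le> C * norm x * prod_list (map norm xs)" by (simp add: mult.assoc)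
qed (use assms in \<open>auto simp: bounded_multilinear_def multilinear_Cons\<close>)

lemma bounded_multilinear_functional:
  assumes "bounded_multilinear m C A"
  shows "bounded_multilinear m (norm \<phi> * C) (\<lambda>xs. cdual_apply \<phi> (A xs))"
  unfolding bounded_multilinear_def
proof (intro conjI allI impI)
  fix xs :: "'a list" assume xs: "length xs = m"
  have "cmod (cdual_apply \<phi> (A xs)) \<le> norm \<phi> * norm (A xs)" by (rule norm_cdual_apply)
  also have "\<dots> \<le> norm \<phi> * (C * prod_list (map norm xs))"
    using assms xs by (intro mult_left_mono) (auto simp: bounded_multilinear_def)
  finally show "cmod (cdual_apply \<phi> (A xs)) \<le> norm \<phi> * C * prod_list (map norm xs)"
    by (simp add: mult.assoc)
next
  have "clinear (\<lambda>x. cdual_apply \<phi> (A (xs[i := x])))" if "length xs = m" "i < m" for xs i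
  proof -
    have "clinear (\<lambda>x. A (xs[i := x]))"
      using assms that by (simp add: bounded_multilinear_def multilinear_def)
    then show ?thesis
      by (simp add: clinear_def cdual_apply_simps cdual_apply_scaleC scaleC_complex_def)
  qed
  then show "multilinear m (\<lambda>xs. cdual_apply \<phi> (A xs))" by (simp add: multilinear_def)
qed (use assms in \<open>auto simp: bounded_multilinear_def\<close>)

text \<open>The functional chosen by \<open>SOME\<close> exists only for bounded multilinear \<open>B\<close>.\<close>

primrec ab_form :: "'a::complex_banach cdual cdual list \<Rightarrow> ('a list \<Rightarrow> complex) \<Rightarrow> complex"
  where
    "ab_form [] B = B []"
  | "ab_form (z # zs) B =
      cdual_apply z (SOME f. \<forall>x. cdual_apply f x = ab_form zs (\<lambda>xs. B (x # xs)))"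

lemma ab_form_cong:
  "(\<And>xs. length xs = length zs \<Longrightarrow> B xs = B' xs) \<Longrightarrow> ab_form zs B = ab_form zs B'"
proof (induction zs arbitrary: B B')
  case (Cons z zs)
  have "ab_form zs (\<lambda>xs. B (x # xs)) = ab_form zs (\<lambda>xs. B' (x # xs))" for x
    by (rule Cons.IH) (simp add: Cons.prems)
  then show ?case by simp
qed simp

text \<open>The claims must be proved together: the inner form is a bounded linear functional of the
  first argument, so that the choice in \<open>ab_form\<close> is meaningful, only by linearity and
  the bound for the shorter list.\<close>

lemma ab_form_linear:
  assumes "bounded_multilinear (length zs) C B" 
  shows "cmod (ab_form zs B) \<le> C * prod_list (map norm zs)"
    and "bounded_multilinear (length zs) C' B' \<Longrightarrow>
      ab_form zs (\<lambda>xs. B xs + B' xs) = ab_form zs B + ab_form zs B'"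
    and "ab_form zs (\<lambda>xs. c * B xs) = c * ab_form zs B"
    and "zs = z # zs' \<Longrightarrow> \<exists>f. (\<forall>x. cdual_apply f x = ab_form zs' (\<lambda>xs. B (x # xs))) \<and>
      ab_form zs B = cdual_apply z f \<and> norm f \<le> C * prod_list (map norm zs')"
  using assms
proof (induction zs arbitrary: B B' C C' c z zs')
  case Nil
  {
    case 1
    then show ?case by (auto simp: bounded_multilinear_def)
  next
    case 2
    show ?case by simp
  next
    case 3
    show ?case by simp
  next
    case 4
    then show ?case by simp
  }
next
  case (Cons w ws)
  have fun_ex: "\<exists>f. (\<forall>x. cdual_apply f x = ab_form ws (\<lambda>xs. B (x # xs))) \<and>
      ab_form (w # ws) B = cdual_apply w f \<and> norm f \<le> C * prod_list (map norm ws)"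
    if B: "bounded_multilinear (length (w # ws)) C B" for C B
  proof -
    let ?h = "\<lambda>x. ab_form ws (\<lambda>xs. B (x # xs))"
    have Bx: "bounded_multilinear (length ws) (C * norm x) (\<lambda>xs. B (x # xs))" for x
      using B by (intro bounded_multilinear_Cons) simp
    have mult: "multilinear (Suc (length ws)) B" using B by (simp add: bounded_multilinear_def)
    have "clinear ?h"
      unfolding clinear_def
    proof (intro conjI allI)
      fix x y
      have "?h (x + y) = ab_form ws (\<lambda>xs. B (x # xs) + B (y # xs))"
        by (rule ab_form_cong) (rule clinear_add[OF multilinear_clinear_hd[OF mult]])
      also have "\<dots> = ?h x + ?h y" by (rule Cons.IH(2)[OF Bx Bx])
      finally show "?h (x + y) = ?h x + ?h y" .
    next
      fix c x
      have "?h (c *\<^sub>C x) = ab_form ws (\<lambda>xs. c * B (x # xs))"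
      proof (rule ab_form_cong)
        fix xs :: "'a list" assume "length xs = length ws"
        then show "B (c *\<^sub>C x # xs) = c * B (x # xs)"
          using clinear_scaleC[OF multilinear_clinear_hd[OF mult]] by (simp add: scaleC_complex_def)
      qed
      also have "\<dots> = c * ?h x" by (rule Cons.IH(3)[OF Bx])
      finally show "?h (c *\<^sub>C x) = c *\<^sub>C ?h x" by (simp add: scaleC_complex_def)
    qed
    moreover have "cmod (?h x) \<le> C * prod_list (map norm ws) * norm x" for x
      using Cons.IH(1)[OF Bx] by (simp add: mult_ac)
    ultimately obtain f where f: "cdual_apply f = ?h" "norm f \<le> max (C * prod_list (map norm ws)) 0"
      by (rule cdual_of_clinear)
    have "0 \<le> C * prod_list (map norm ws)"
      using B by (auto simp: bounded_multilinear_def intro!: mult_nonneg_nonneg prod_list_nonneg)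
    \<comment> \<open>Functionals are determined by their values, so the choice has only one
      candidate.\<close>
    moreover have "(SOME f. \<forall>x. cdual_apply f x = ?h x) = f"
      using f(1) by (intro some_equality) (auto intro: cdual_eqI)
    ultimately show ?thesis using f by (intro exI[of _ f]) auto
  qed
  {
    case 1
    from fun_ex[OF this] obtain f where f: "ab_form (w # ws) B = cdual_apply w f"
      "norm f \<le> C * prod_list (map norm ws)" by blast
    have "cmod (cdual_apply w f) \<le> norm w * norm f" by (rule norm_cdual_apply)
    also have "\<dots> \<le> norm w * (C * prod_list (map norm ws))" using f(2) by (intro mult_left_mono) auto
    finally show ?case using f(1) by (simp add: mult_ac)
  next
    case 2
    from fun_ex[OF this(2)] obtain f where f: "\<And>x. cdual_apply f x = ab_form ws (\<lambda>xs. B (x # xs))"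
      "ab_form (w # ws) B = cdual_apply w f" by blast
    from fun_ex[OF 2(1)] obtain f' where f': "\<And>x. cdual_apply f' x = ab_form ws (\<lambda>xs. B' (x # xs))"
      "ab_form (w # ws) B' = cdual_apply w f'" by blast
    have "ab_form ws (\<lambda>xs. B (x # xs) + B' (x # xs)) = cdual_apply (f + f') x" for x
    proof -
      have "bounded_multilinear (length ws) (C * norm x) (\<lambda>xs. B (x # xs))"
        "bounded_multilinear (length ws) (C' * norm x) (\<lambda>xs. B' (x # xs))"
        using 2 by (auto intro!: bounded_multilinear_Cons)
      from Cons.IH(2)[OF this(2,1)] show ?thesis by (simp add: f f' cdual_apply_left_linear)
    qed
    then have "(SOME g. \<forall>x. cdual_apply g x = ab_form ws (\<lambda>xs. B (x # xs) + B' (x # xs))) = f + f'"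
      by (intro some_equality) (auto intro: cdual_eqI)
    then show ?case using f(2) f'(2) by (simp add: cdual_apply_simps)
  next
    case 3
    from fun_ex[OF this] obtain f where f: "\<And>x. cdual_apply f x = ab_form ws (\<lambda>xs. B (x # xs))"
      "ab_form (w # ws) B = cdual_apply w f" by blast
    have "ab_form ws (\<lambda>xs. c * B (x # xs)) = cdual_apply (c *\<^sub>C f) x" for x
    proof -
      have "bounded_multilinear (length ws) (C * norm x) (\<lambda>xs. B (x # xs))"
        using 3 by (auto intro!: bounded_multilinear_Cons)
      from Cons.IH(3)[OF this] show ?thesis by (simp add: f cdual_apply_left_linear)
    qed
    then have "(SOME g. \<forall>x. cdual_apply g x = ab_form ws (\<lambda>xs. c * B (x # xs))) = c *\<^sub>C f"
      by (intro some_equality) (auto intro: cdual_eqI)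
    then show ?case using f(2) by (simp add: cdual_apply_scaleC)
  next
    case 4
    then show ?case using fun_ex by simp
  }
qed

text \<open>A single functional serves every \<open>z\<close>; this makes it possible to compare
  \<open>z\<close> with embedded points in the first slot.\<close>

lemma ab_form_Cons:
  assumes "bounded_multilinear (Suc (length zs)) C B"
  obtains f where "\<And>x. cdual_apply f x = ab_form zs (\<lambda>xs. B (x # xs))"
    and "\<And>z. ab_form (z # zs) B = cdual_apply z f"
proof -
  have "\<exists>f. (\<forall>x. cdual_apply f x = ab_form zs (\<lambda>xs. B (x # xs))) \<and> ab_form (z # zs) B = cdual_apply z f"
    for z
    using ab_form_linear(4)[of "z # zs" C B z zs] assms by auto
  then show thesis using that cdual_eqI by metis
qed

lemma ab_form_canonical_embedding:
  "bounded_multilinear (length xs) C B \<Longrightarrow> ab_form (map canonical_embedding xs) B = B xs"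
proof (induction xs arbitrary: B C)
  case (Cons x xs)
  then obtain f where f: "\<And>y. cdual_apply f y = ab_form (map canonical_embedding xs) (\<lambda>xs. B (y # xs))"
    "\<And>z. ab_form (z # map canonical_embedding xs) B = cdual_apply z f"
    using ab_form_Cons[of "map canonical_embedding xs" C B] by auto
  have "ab_form (map canonical_embedding xs) (\<lambda>xs. B (x # xs)) = B (x # xs)"
    using Cons.prems by (intro Cons.IH[of "C * norm x"] bounded_multilinear_Cons) simp
  then show ?case by (simp add: f(1) f(2) cdual_apply_canonical_embedding del: ab_form.simps)
qed simp

text \<open>With \<open>zs\<close> fixed, the scalar form is linear and bounded in
  \<open>\<phi>\<close>, hence given by an element of the bidual.\<close>

lemma ab_form_vector:
  fixes A :: "'a::complex_banach list \<Rightarrow> 'b::complex_banach"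
  assumes A: "bounded_multilinear (length zs) C A"
  obtains w where "\<And>\<phi>. cdual_apply w \<phi> = ab_form zs (\<lambda>xs. cdual_apply \<phi> (A xs))"
proof -
  let ?h = "\<lambda>\<phi>. ab_form zs (\<lambda>xs. cdual_apply \<phi> (A xs))"
  note bd = bounded_multilinear_functional[OF A]
  have "clinear ?h"
    unfolding clinear_def cdual_apply_left_linear
    using ab_form_linear(2)[OF bd bd] ab_form_linear(3)[OF bd] by (simp add: scaleC_complex_def)
  moreover have "cmod (?h \<phi>) \<le> C * prod_list (map norm zs) * norm \<phi>" for \<phi>
    using ab_form_linear(1)[OF bd] by (simp add: mult_ac)
  ultimately show thesis using cdual_of_clinear that by metis
qed

text \<open>Tested on \<open>\<phi>\<close>, the inner limit as a function of the first point is the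
  functional \<open>f\<close> of \<open>ab_form_Cons\<close>. Weak-star convergence of the net to
  \<open>z\<close>, applied to \<open>f\<close>, is therefore the outer limit.\<close>

lemma iterated_limit_ab_form:
  fixes A :: "'a::complex_banach list \<Rightarrow> 'b::complex_banach"
  assumes "bounded_multilinear (length zs) C A" "list_all2 bounded_weak_star_net \<F>s zs"
    and "\<And>\<phi>. cdual_apply w \<phi> = ab_form zs (\<lambda>xs. cdual_apply \<phi> (A xs))"
  shows "iterated_limit \<F>s (\<lambda>xs. canonical_embedding (A xs)) w"
  using assms
proof (induction zs arbitrary: A C \<F>s w)
  case Nil
  then show ?case by (auto intro!: cdual_eqI simp: cdual_apply_canonical_embedding)
next
  case (Cons z zs)
  obtain \<F> \<G>s where \<F>: "\<F>s = \<F> # \<G>s" "bounded_weak_star_net \<F> z"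
    "list_all2 bounded_weak_star_net \<G>s zs"
    using Cons.prems(2) by (auto simp: list_all2_Cons2)
  have Ax: "bounded_multilinear (length zs) (C * norm x) (\<lambda>xs. A (x # xs))" for x
    using Cons.prems(1) by (intro bounded_multilinear_Cons) simp
  have "\<forall>x. \<exists>v. \<forall>\<phi>. cdual_apply v \<phi> = ab_form zs (\<lambda>xs. cdual_apply \<phi> (A (x # xs)))"
    using ab_form_vector[OF Ax] by blast
  from choice[OF this] obtain g
    where g: "\<And>x \<phi>. cdual_apply (g x) \<phi> = ab_form zs (\<lambda>xs. cdual_apply \<phi> (A (x # xs)))" by blast
  have "iterated_limit \<G>s (\<lambda>xs. canonical_embedding (A (x # xs))) (g x)" for x
    by (rule Cons.IH[OF Ax \<F>(3) g])
  moreover have "limitin weak_star_topology g w \<F>"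
    unfolding limitin_weak_star_iff
  proof
    fix \<phi>
    obtain f where f: "\<And>x. cdual_apply f x = ab_form zs (\<lambda>xs. cdual_apply \<phi> (A (x # xs)))"
      "\<And>z. ab_form (z # zs) (\<lambda>xs. cdual_apply \<phi> (A xs)) = cdual_apply z f"
      using ab_form_Cons[of zs] bounded_multilinear_functional[OF Cons.prems(1), of \<phi>] by auto
    have "((\<lambda>x. cdual_apply (canonical_embedding x) f) \<longlongrightarrow> cdual_apply z f) \<F>"
      using \<F>(2) unfolding bounded_weak_star_net_def limitin_weak_star_iff by blast
    then show "((\<lambda>x. cdual_apply (g x) \<phi>) \<longlongrightarrow> cdual_apply w \<phi>) \<F>"
      unfolding Cons.prems(3) f(2) by (simp add: g f(1) cdual_apply_canonical_embedding)
  qed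
  ultimately show ?case unfolding \<F>(1) by auto
qed

section \<open>Uniqueness of the limit and evaluation of the extension\<close>

lemma iterated_limit_unique:
  assumes "\<forall>\<F>\<in>set \<F>s. \<F> \<noteq> bot" "iterated_limit \<F>s G v" "iterated_limit \<F>s G w"
  shows "v = w"
  using assms
proof (induction \<F>s arbitrary: G v w)
  case (Cons \<F> \<F>s)
  obtain g h where g: "\<And>x. iterated_limit \<F>s (\<lambda>xs. G (x # xs)) (g x)" "limitin weak_star_topology g v \<F>"
    and h: "\<And>x. iterated_limit \<F>s (\<lambda>xs. G (x # xs)) (h x)" "limitin weak_star_topology h w \<F>"
    using Cons.prems(2,3) by auto
  have "g = h"
  proof
    fix x show "g x = h x" by (rule Cons.IH[OF _ g(1) h(1)]) (use Cons.prems(1) in auto)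
  qed
  show ?case
  proof (rule cdual_eqI, rule tendsto_unique)
    show "\<F> \<noteq> bot" using Cons.prems(1) by simp
    show "((\<lambda>i. cdual_apply (g i) x) \<longlongrightarrow> cdual_apply v x) \<F>"
      "((\<lambda>i. cdual_apply (g i) x) \<longlongrightarrow> cdual_apply w x) \<F>" for x
      using g(2) h(2) unfolding \<open>g = h\<close> limitin_weak_star_iff by auto
  qed
qed simp

text \<open>The value exists because the limit is the same along all nets. It is unique only because
  suitable nets exist: without them every vector would satisfy the condition vacuously.\<close>

lemma bidual_extension_eq:
  fixes A :: "'a::complex_banach list \<Rightarrow> 'b::complex_banach"
  assumes A: "bounded_multilinear (length zs) C A"
  shows "cdual_apply (bidual_extension A zs) \<phi> = ab_form zs (\<lambda>xs. cdual_apply \<phi> (A xs))"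
proof -
  obtain w where w: "\<And>\<phi>. cdual_apply w \<phi> = ab_form zs (\<lambda>xs. cdual_apply \<phi> (A xs))"
    using ab_form_vector[OF A] by blast
  have "\<forall>z :: 'a cdual cdual. \<exists>\<F>. bounded_weak_star_net \<F> z"
    using bounded_weak_star_net_exists by blast
  from choice[OF this] obtain net
    where net: "\<And>z :: 'a cdual cdual. bounded_weak_star_net (net z) z" by blast
  have nets: "list_all2 bounded_weak_star_net (map net zs) zs"
    by (simp add: list_all2_conv_all_nth net)
  have "bidual_extension A zs = w"
    unfolding bidual_extension_def
  proof (rule the_equality)
    show "\<forall>\<F>s. list_all2 bounded_weak_star_net \<F>s zs \<longrightarrow>
        iterated_limit \<F>s (\<lambda>xs. canonical_embedding (A xs)) w"
      using iterated_limit_ab_form[OF A _ w] by blast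
    fix v assume "\<forall>\<F>s. list_all2 bounded_weak_star_net \<F>s zs \<longrightarrow>
        iterated_limit \<F>s (\<lambda>xs. canonical_embedding (A xs)) v"
    then have "iterated_limit (map net zs) (\<lambda>xs. canonical_embedding (A xs)) v" using nets by blast
    moreover have "iterated_limit (map net zs) (\<lambda>xs. canonical_embedding (A xs)) w"
      by (rule iterated_limit_ab_form[OF A nets w])
    moreover have "\<forall>\<F>\<in>set (map net zs). \<F> \<noteq> bot" using net by (auto simp: bounded_weak_star_net_def)
    ultimately show "v = w" by (intro iterated_limit_unique)
  qed
  then show ?thesis using w by simp
qed

lemma bounded_multilinear_polar_form:
  assumes "P \<in> hom_polynomials m"
  obtains C where "bounded_multilinear m C (polar_form m P)"
  using polar_form_bounded[OF assms] symmetric_multilinear_imp_multilinear[OF polar_form(1)[OF assms]]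
  unfolding bounded_multilinear_def by metis

lemma aron_berner_eq:
  assumes "P \<in> hom_polynomials m"
  shows "cdual_apply (aron_berner m P z) \<phi> =
    ab_form (replicate m z) (\<lambda>xs. cdual_apply \<phi> (polar_form m P xs))"
proof -
  obtain C where "bounded_multilinear m C (polar_form m P)"
    using bounded_multilinear_polar_form[OF assms] by blast
  then show ?thesis unfolding aron_berner_def by (intro bidual_extension_eq) simp
qed

lemma aron_berner_canonical_embedding:
  assumes P: "P \<in> hom_polynomials m"
  shows "aron_berner m P (canonical_embedding x) = canonical_embedding (P x)"
proof (rule cdual_eqI)
  fix \<phi>
  obtain C where C: "bounded_multilinear m C (polar_form m P)"
    using bounded_multilinear_polar_form[OF P] by blast
  show "cdual_apply (aron_berner m P (canonical_embedding x)) \<phi> =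
      cdual_apply (canonical_embedding (P x)) \<phi>"
    using ab_form_canonical_embedding[of "replicate m x" "norm \<phi> * C"]
      bounded_multilinear_functional[OF C, of \<phi>]
    by (simp add: aron_berner_eq[OF P] polar_form(2)[OF P] cdual_apply_canonical_embedding)
qed

subsection \<open>Values of the extension as limits of values of the polynomial\<close>

text \<open>The arguments \<open>us\<close> are already points of the space. The next slot holds
  \<open>z\<close> applied to a functional, so Goldstine's theorem can replace \<open>z\<close>
  there by a point.\<close>

lemma ab_form_append_functional:
  assumes "bounded_multilinear m C B" "length us + Suc k = m"
  obtains f where "\<And>x. cdual_apply f x = ab_form (replicate k z) (\<lambda>xs. B (us @ x # xs))"
    and "ab_form (replicate (Suc k) z) (\<lambda>xs. B (us @ xs)) = cdual_apply z f"
proof -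
  have "\<exists>D. bounded_multilinear (Suc k) D (\<lambda>xs. B (us @ xs))"
    using assms
  proof (induction us arbitrary: m B C)
    case (Cons u us)
    then have "bounded_multilinear (Suc (m - 1)) C B" by auto
    from Cons.IH[OF bounded_multilinear_Cons[OF this, of u]] Cons.prems show ?case by simp
  qed auto
  then obtain D where "bounded_multilinear (Suc (length (replicate k z))) D (\<lambda>xs. B (us @ xs))" by auto
  from ab_form_Cons[OF this] show thesis using that by (metis replicate_Suc)
qed

text \<open>Choosing \<open>x 0, x 1, \<dots>\<close> one after the other, each close to \<open>z\<close> on the functionals
  arising from the earlier ones, makes all \<open>A [x i\<^sub>1, \<dots>, x i\<^sub>m]\<close> with increasing indices
  close to the extension at \<open>z\<close>.\<close>

lemma ab_form_increasing_approximation: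
  fixes z :: "'e::complex_banach cdual cdual" and B :: "'p \<Rightarrow> 'e list \<Rightarrow> complex"
    and n :: nat and d :: real
  assumes "finite \<Phi>" "0 < d" and B: "\<And>\<phi>. bounded_multilinear m (C \<phi>) (B \<phi>)"
  shows "\<exists>x. (\<forall>i. norm (x i) \<le> norm z) \<and>
    (\<forall>is. sorted_wrt (<) is \<longrightarrow> set is \<subseteq> {..<n} \<longrightarrow> length is \<le> m \<longrightarrow>
      (\<forall>\<phi>\<in>\<Phi>. cmod (ab_form (replicate (m - length is) z) (\<lambda>xs. B \<phi> (map x is @ xs)) -
        ab_form (replicate m z) (B \<phi>)) \<le> length is * d))"
proof (induction n)
  case 0
  show ?case by (intro exI[of _ "\<lambda>_. 0"]) auto
next
  case (Suc n)
  let ?V = "\<lambda>x \<phi> is. ab_form (replicate (m - length is) z) (\<lambda>xs. B \<phi> (map x is @ xs))"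
  let ?L = "\<lambda>\<phi>. ab_form (replicate m z) (B \<phi>)"
  obtain x where x: "\<And>i. norm (x i) \<le> norm z"
    and IH: "\<And>is \<phi>. sorted_wrt (<) is \<Longrightarrow> set is \<subseteq> {..<n} \<Longrightarrow> length is \<le> m \<Longrightarrow> \<phi> \<in> \<Phi> \<Longrightarrow>
      cmod (?V x \<phi> is - ?L \<phi>) \<le> length is * d"
    using Suc by blast
  \<comment> \<open>Strictly shorter lists than \<open>m\<close>, since one index is still to be
    appended.\<close>
  define I where "I = {is. set is \<subseteq> {..<n} \<and> length is < m}"
  have "finite I"
    by (rule finite_subset[OF _ finite_lists_length_le[of "{..<n}" m]]) (auto simp: I_def)
  have "\<exists>f. (\<forall>y. cdual_apply f y = ab_form (replicate (m - Suc (length is)) z) (\<lambda>xs. B \<phi> (map x is @ y # xs))) \<and>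
      ?V x \<phi> is = cdual_apply z f" if "is \<in> I" for \<phi> "is"
  proof -
    have "length (map x is) + Suc (m - Suc (length is)) = m" using that by (auto simp: I_def)
    from ab_form_append_functional[OF B this] obtain f where
      "\<And>y. cdual_apply f y = ab_form (replicate (m - Suc (length is)) z) (\<lambda>xs. B \<phi> (map x is @ y # xs))"
      "ab_form (replicate (Suc (m - Suc (length is))) z) (\<lambda>xs. B \<phi> (map x is @ xs)) = cdual_apply z f"
      by metis
    moreover have "Suc (m - Suc (length is)) = m - length is" using that by (auto simp: I_def)
    ultimately show ?thesis by auto
  qed
  then have "\<forall>j. \<exists>f. snd j \<in> I \<longrightarrow>
     (\<forall>y. cdual_apply f y = ab_form (replicate (m - Suc (length (snd j))) z) (\<lambda>xs. B (fst j) (map x (snd j) @ y # xs))) \<and>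
      ?V x (fst j) (snd j) = cdual_apply z f" by blast
  from choice[OF this] obtain f where f: "\<And>\<phi> is y. is \<in> I \<Longrightarrow> cdual_apply (f (\<phi>, is)) y =
      ab_form (replicate (m - Suc (length is)) z) (\<lambda>xs. B \<phi> (map x is @ y # xs))"
    "\<And>\<phi> is. is \<in> I \<Longrightarrow> ?V x \<phi> is = cdual_apply z (f (\<phi>, is))" by fastforce
  \<comment> \<open>The new point imitates \<open>z\<close> on every functional arising from earlier
    points, so appending its index costs one further \<open>d\<close>.\<close>
  obtain y where y: "norm y \<le> norm z"
    "\<And>\<psi>. \<psi> \<in> f ` (\<Phi> \<times> I) \<Longrightarrow> cmod (cdual_apply z \<psi> - cdual_apply \<psi> y) \<le> d"
    using Goldstine[of "f ` (\<Phi> \<times> I)" d z] \<open>finite I\<close> assms(1,2) by auto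
  define x' where "x' = x(n := y)"
  have old: "map x' is = map x is" if "set is \<subseteq> {..<n}" for "is"
    using that by (auto simp: x'_def)
  show ?case
  proof (intro exI conjI allI impI ballI)
    show "norm (x' i) \<le> norm z" for i using x y by (simp add: x'_def)
    fix "is" \<phi> assume "is": "sorted_wrt (<) is" "set is \<subseteq> {..<Suc n}" "length is \<le> m" "\<phi> \<in> \<Phi>"
    show "cmod (?V x' \<phi> is - ?L \<phi>) \<le> length is * d"
    proof (cases "n \<in> set is")
      case False
      then have "set is \<subseteq> {..<n}" using "is"(2) by (auto simp: less_Suc_eq)
      then show ?thesis unfolding old[OF \<open>set is \<subseteq> {..<n}\<close>] by (intro IH "is")
    next
      case True
      then obtain js ks where js: "is = js @ n # ks" by (meson split_list)
      \<comment> \<open>The new index \<open>n\<close> is the largest, so it can only stand last in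
        an increasing list.\<close>
      have "ks = []"
      proof (rule ccontr)
        assume "ks \<noteq> []"
        then have "hd ks \<in> set ks" by simp
        then have "n < hd ks" "hd ks < Suc n" using "is"(1,2) js by (auto simp: sorted_wrt_append)
        then show False by simp
      qed
      have j: "sorted_wrt (<) js" "set js \<subseteq> {..<n}" "js \<in> I" "length js \<le> m"
        using "is"(1-3) js by (auto simp: sorted_wrt_append I_def)
      have "x' n = y" by (simp add: x'_def)
      then have map_is: "map x' is = map x js @ [y]"
        using js \<open>ks = []\<close> old[OF j(2)] by simp
      have "length is = Suc (length js)" using js \<open>ks = []\<close> by simp
      then have "?V x' \<phi> is = cdual_apply (f (\<phi>, js)) y"
        unfolding map_is by (simp add: f(1)[OF j(3)])
      then have "cmod (?V x' \<phi> is - ?V x \<phi> js) \<le> d"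
        using y(2)[of "f (\<phi>, js)"] j(3) "is"(4) by (simp add: f(2)[OF j(3)] norm_minus_commute)
      moreover have "cmod (?V x \<phi> js - ?L \<phi>) \<le> length js * d" using IH j "is"(4) by blast
      ultimately have "cmod (?V x' \<phi> is - ?L \<phi>) \<le> d + length js * d"
        using norm_triangle_ineq[of "?V x' \<phi> is - ?V x \<phi> js" "?V x \<phi> js - ?L \<phi>"] by simp
      then show ?thesis using js \<open>ks = []\<close> by (simp add: algebra_simps)
    qed
  qed
qed

section \<open>Averaging over index lists\<close>

lemma card_distinct_lists_ge:
  assumes "m \<le> n"
  shows "(n - m) ^ m \<le> card {is. length is = m \<and> distinct is \<and> set is \<subseteq> {..<n}}"
proof -
  have "(n - m) ^ m = (\<Prod>i\<in>{n - m + 1..n}. n - m)" using assms by simp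
  also have "\<dots> \<le> \<Prod>{n - m + 1..n}" by (rule prod_mono) auto
  also have "\<dots> = card {is. length is = m \<and> distinct is \<and> set is \<subseteq> {..<n}}"
    using card_lists_distinct_length_eq[of "{..<n}" m] assms by simp
  finally show ?thesis .
qed

text \<open>The proportion of lists with a repetition is at most 1 - (1 - m/n)^m, which tends to 0
  for fixed \<open>m\<close>.\<close>

lemma nondistinct_lists_fraction:
  assumes "0 < (e::real)"
  obtains n where "0 < n"
    "card ({is. set is \<subseteq> {..<n} \<and> length is = m} - {is. length is = m \<and> distinct is \<and> set is \<subseteq> {..<n}})
      \<le> e * real n ^ m"
proof -
  have "(\<lambda>n. (1 - real m / real n) ^ m) \<longlonglongrightarrow> (1 - 0) ^ m"
    by (intro tendsto_intros lim_const_over_n)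
  from tendstoD[OF this assms] have "\<forall>\<^sub>F n in sequentially. dist ((1 - real m / real n) ^ m) 1 < e" by simp
  then have "\<forall>\<^sub>F n in sequentially. dist ((1 - real m / real n) ^ m) 1 < e \<and> Suc m \<le> n"
    by (intro eventually_conj eventually_ge_at_top)
  then obtain n where n: "dist ((1 - real m / real n) ^ m) 1 < e" "Suc m \<le> n"
    by (auto simp: eventually_sequentially)
  let ?L = "{is. set is \<subseteq> {..<n} \<and> length is = m}"
  let ?D = "{is. length is = m \<and> distinct is \<and> set is \<subseteq> {..<n}}"
  have "finite ?L" by (rule finite_lists_length_eq) simp
  moreover have "?D \<subseteq> ?L" by auto
  ultimately have "card (?L - ?D) = card ?L - card ?D" "card ?D \<le> card ?L"
    by (auto intro: card_Diff_subset card_mono finite_subset)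
  then have "real (card (?L - ?D)) = real n ^ m - real (card ?D)"
    using card_lists_length_eq[of "{..<n}" m] by (simp add: of_nat_diff)
  also have "real (n - m) ^ m \<le> real (card ?D)"
    unfolding of_nat_power[symmetric] of_nat_le_iff using card_distinct_lists_ge n(2) by simp
  then have "real n ^ m - real (card ?D) \<le> real n ^ m - real (n - m) ^ m" by simp
  also have "\<dots> = (1 - (1 - real m / real n) ^ m) * real n ^ m"
  proof -
    have "(1 - real m / real n) * real n = real (n - m)" using n(2) by (simp add: field_simps of_nat_diff)
    then show ?thesis by (simp add: left_diff_distrib flip: power_mult_distrib)
  qed
  also have "\<dots> \<le> e * real n ^ m"
    using n(1) by (intro mult_right_mono) (auto simp: dist_real_def)
  finally show thesis using n(2) by (intro that[of n]) auto
qed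

text \<open>The point is the average of the \<open>n\<close> chosen vectors, which stays in the ball
  by convexity. Expanding \<open>P\<close> there gives the average of the symmetric form over all
  n^m index lists: those with distinct entries have values near the extension, and the rest are few
  and uniformly bounded.\<close>

theorem aron_berner_approximation:
  fixes P :: "'e::complex_banach \<Rightarrow> 'f::complex_banach"
  assumes P: "P \<in> hom_polynomials m" and "finite \<Phi>" "0 < e"
  obtains x where "norm x \<le> norm z"
    and "\<And>\<phi>. \<phi> \<in> \<Phi> \<Longrightarrow> cmod (cdual_apply \<phi> (P x) - cdual_apply (aron_berner m P z) \<phi>) \<le> e"
proof -
  let ?A = "polar_form m P"
  note sym = polar_form(1)[OF P]
  note mult = symmetric_multilinear_imp_multilinear[OF sym]
  obtain C where C: "bounded_multilinear m C ?A" using bounded_multilinear_polar_form[OF P] by blast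
  have "0 \<le> C" using C by (simp add: bounded_multilinear_def)
  define B where "B \<phi> xs = cdual_apply \<phi> (?A xs)" for \<phi> xs
  have B: "bounded_multilinear m (norm \<phi> * C) (B \<phi>)" for \<phi>
    unfolding B_def by (rule bounded_multilinear_functional[OF C])
  define L where "L \<phi> = ab_form (replicate m z) (B \<phi>)" for \<phi>
  have L: "cdual_apply (aron_berner m P z) \<phi> = L \<phi>" for \<phi>
    unfolding L_def B_def by (rule aron_berner_eq[OF P])
  \<comment> \<open>\<open>R\<close> bounds the deviation on every list and for all functionals in
    \<open>\<Phi>\<close> at once; \<open>\<eta>\<close> and \<open>d\<close> are chosen to make
    both \<eta> R and m d at most e / 2.\<close>
  define R where "R = (\<Sum>\<phi>\<in>\<Phi>. norm \<phi> * C * norm z ^ m + cmod (L \<phi>))"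
  have "0 \<le> R" unfolding R_def using \<open>0 \<le> C\<close> by (intro sum_nonneg add_nonneg_nonneg) auto
  define \<eta> where "\<eta> = e / (2 * (R + 1))"
  have "0 < \<eta>" using \<open>0 < e\<close> \<open>0 \<le> R\<close> by (simp add: \<eta>_def)
  have "\<eta> * R \<le> e / 2"
  proof -
    have "\<eta> * R \<le> \<eta> * (R + 1)" using \<open>0 < \<eta>\<close> by simp
    also have "\<dots> = e / 2" using \<open>0 \<le> R\<close> by (auto simp: \<eta>_def divide_simps)
    finally show ?thesis .
  qed
  define d where "d = e / (2 * (real m + 1))"
  have "0 < d" using \<open>0 < e\<close> by (simp add: d_def)
  have "real m * d \<le> e / 2"
  proof -
    have "real m * d \<le> (real m + 1) * d" using \<open>0 < d\<close> by simp
    also have "\<dots> = e / 2" by (simp add: d_def divide_simps)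
    finally show ?thesis .
  qed
  let ?Ls = "\<lambda>n. {is. set is \<subseteq> {..<n} \<and> length is = m}"
  let ?D = "\<lambda>n. {is. length is = m \<and> distinct is \<and> set is \<subseteq> {..<n}}"
  obtain n where n: "0 < n" "card (?Ls n - ?D n) \<le> \<eta> * real n ^ m"
    using nondistinct_lists_fraction[OF \<open>0 < \<eta>\<close>] by blast
  have fin: "finite (?Ls n)" by (rule finite_lists_length_eq) simp
  obtain x where x: "\<And>i. norm (x i) \<le> norm z"
    and incr: "\<And>is \<phi>. sorted_wrt (<) is \<Longrightarrow> set is \<subseteq> {..<n} \<Longrightarrow> length is \<le> m \<Longrightarrow> \<phi> \<in> \<Phi> \<Longrightarrow>
      cmod (ab_form (replicate (m - length is) z) (\<lambda>xs. B \<phi> (map x is @ xs)) - L \<phi>) \<le> length is * d"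
    using ab_form_increasing_approximation[where B = B and C = "\<lambda>\<phi>. norm \<phi> * C" and z = z and n = n,
        OF \<open>finite \<Phi>\<close> \<open>0 < d\<close> B]
    unfolding L_def by blast
  have dist: "cmod (B \<phi> (map x is) - L \<phi>) \<le> e / 2" if "is \<in> ?D n" "\<phi> \<in> \<Phi>" for \<phi> "is"
  proof -
    \<comment> \<open>Symmetry is what allows sorting the list, so that control on increasing lists
      covers all distinct ones.\<close>
    have "B \<phi> (map x is) = B \<phi> (map x (sort is))"
      unfolding B_def
      by (rule arg_cong[where f = "cdual_apply \<phi>"], rule symmetric_multilinear_mset_cong[OF sym])
         (use that in auto)
    moreover have "sorted_wrt (<) (sort is)"
      using that by (simp add: strict_sorted_iff)
    ultimately show ?thesis
      using incr[of "sort is" \<phi>] that \<open>real m * d \<le> e / 2\<close> by simp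
  qed
  have other: "cmod (B \<phi> (map x is) - L \<phi>) \<le> R" if "length is = m" "\<phi> \<in> \<Phi>" for \<phi> "is"
  proof -
    have "cmod (B \<phi> (map x is)) \<le> norm \<phi> * C * prod_list (map norm (map x is))"
      using B[of \<phi>] that(1) unfolding bounded_multilinear_def by (metis length_map)
    also have "\<dots> \<le> norm \<phi> * C * norm z ^ m"
    proof (rule mult_left_mono)
      have "prod_list (map norm (map x js)) \<le> norm z ^ length js" for js
        by (induction js) (auto intro!: mult_mono x prod_list_nonneg)
      then show "prod_list (map norm (map x is)) \<le> norm z ^ m" using that(1) by blast
    qed (use \<open>0 \<le> C\<close> in auto)
    finally have "cmod (B \<phi> (map x is) - L \<phi>) \<le> norm \<phi> * C * norm z ^ m + cmod (L \<phi>)"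
      using norm_triangle_ineq4[of "B \<phi> (map x is)" "L \<phi>"] by simp
    also have "\<dots> \<le> R"
      unfolding R_def using that(2) assms(2) \<open>0 \<le> C\<close>
      by (intro member_le_sum[where f = "\<lambda>\<phi>. norm \<phi> * C * norm z ^ m + cmod (L \<phi>)"]) auto
    finally show ?thesis .
  qed
  define c where "c = complex_of_real (1 / real n)"
  define y where "y = c *\<^sub>C (\<Sum>i<n. x i)"
  show thesis
  proof (rule that[of y])
    have "norm (\<Sum>i<n. x i) \<le> real n * norm z"
      using sum_norm_le[of "{..<n}" x "\<lambda>_. norm z"] x by simp
    then show "norm y \<le> norm z"
      using n(1) by (simp add: y_def c_def norm_scaleC norm_divide pos_divide_le_eq mult.commute)
    fix \<phi> assume "\<phi> \<in> \<Phi>"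
    have "P y = c ^ m *\<^sub>C ?A (replicate m (\<Sum>i<n. x i))"
      using multilinear_scaleC[OF mult, of "replicate m (\<Sum>i<n. x i)" c]
      by (simp add: y_def flip: polar_form(2)[OF P])
    also have "?A (replicate m (\<Sum>i<n. x i)) = (\<Sum>is\<in>?Ls n. ?A (map x is))"
      by (rule multilinear_expand[OF mult]) simp
    finally have "cdual_apply \<phi> (P y) = c ^ m * (\<Sum>is\<in>?Ls n. B \<phi> (map x is))"
      by (simp add: cdual_apply_scaleC cdual_apply_simps B_def)
    moreover have "c ^ m * (\<Sum>is\<in>?Ls n. L \<phi>) = L \<phi>"
      using n(1) card_lists_length_eq[of "{..<n}" m] by (simp add: c_def power_divide)
    ultimately have "cdual_apply \<phi> (P y) - L \<phi> = c ^ m * (\<Sum>is\<in>?Ls n. B \<phi> (map x is) - L \<phi>)"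
      by (simp add: sum_subtractf right_diff_distrib)
    then have "cmod (cdual_apply \<phi> (P y) - L \<phi>) = (1 / real n ^ m) * cmod (\<Sum>is\<in>?Ls n. B \<phi> (map x is) - L \<phi>)"
      by (simp add: norm_mult norm_power c_def norm_divide power_divide)
    also have "\<dots> \<le> (1 / real n ^ m) * (real n ^ m * e)"
    proof (rule mult_left_mono)
      have "cmod (\<Sum>is\<in>?Ls n. B \<phi> (map x is) - L \<phi>) \<le> (\<Sum>is\<in>?Ls n. cmod (B \<phi> (map x is) - L \<phi>))"
        by (rule norm_sum)
      \<comment> \<open>Every list is charged e / 2, and a list with a repetition an additional
        \<open>R\<close>.\<close>
      also have "\<dots> \<le> (\<Sum>is\<in>?Ls n. e / 2 + (if is \<in> ?Ls n - ?D n then R else 0))"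
      proof (rule sum_mono)
        fix "is" assume "is \<in> ?Ls n"
        then show "cmod (B \<phi> (map x is) - L \<phi>) \<le> e / 2 + (if is \<in> ?Ls n - ?D n then R else 0)"
          using dist[OF _ \<open>\<phi> \<in> \<Phi>\<close>, of "is"] other[OF _ \<open>\<phi> \<in> \<Phi>\<close>, of "is"] \<open>0 < e\<close> by auto
      qed
      also have "\<dots> = real n ^ m * (e / 2) + card (?Ls n - ?D n) * R"
      proof -
        have "(\<Sum>is\<in>?Ls n. if is \<in> ?Ls n - ?D n then R else 0) = (\<Sum>is\<in>?Ls n - ?D n. R)"
          using fin by (intro sum.mono_neutral_cong_right) auto
        then show ?thesis
          using card_lists_length_eq[of "{..<n}" m] by (simp add: sum.distrib)
      qed
      also have "card (?Ls n - ?D n) * R \<le> (\<eta> * real n ^ m) * R"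
        using n(2) \<open>0 \<le> R\<close> by (rule mult_right_mono)
      also have "(\<eta> * real n ^ m) * R = real n ^ m * (\<eta> * R)" by simp
      also have "\<dots> \<le> real n ^ m * (e / 2)" using \<open>\<eta> * R \<le> e / 2\<close> by (intro mult_left_mono) auto
      finally show "cmod (\<Sum>is\<in>?Ls n. B \<phi> (map x is) - L \<phi>) \<le> real n ^ m * e" by (simp add: mult.commute)
    qed simp
    also have "\<dots> = e" using n(1) by simp
    finally show "cmod (cdual_apply \<phi> (P y) - cdual_apply (aron_berner m P z) \<phi>) \<le> e" by (simp add: L)
  qed
qed

section \<open>Comparison of the images of the two unit balls\<close>

lemma aron_berner_in_compact:
  fixes P :: "'a::complex_banach \<Rightarrow> 'b::complex_banach"
  assumes P: "P \<in> hom_polynomials m" and "compact S" "P ` cball 0 1 \<subseteq> S" "norm z \<le> 1"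
  shows "aron_berner m P z \<in> canonical_embedding ` S"
proof -
  let ?w = "aron_berner m P z"
  define f where "f = (\<lambda>(\<phi>, d :: real). {v. cmod (cdual_apply \<phi> v - cdual_apply ?w \<phi>) \<le> d})"
  \<comment> \<open>The approximation theorem satisfies any finite set of these closed constraints
    by a value of \<open>P\<close>, which lies in \<open>S\<close>. A common point meets them all
    with every positive tolerance, so its embedding is the value of the extension.\<close>
  have "S \<inter> \<Inter> (f ` (UNIV \<times> {0<..})) \<noteq> {}"
  proof (rule compact_imp_fip_image[OF \<open>compact S\<close>])
    have "closed {v. cmod (cdual_apply \<phi> v - c) \<le> d}" for \<phi> c d
      by (intro closed_Collect_le continuous_intros
          bounded_linear.continuous_on[OF bounded_linear_cdual_apply])
    then show "closed (f i)" for i by (simp add: f_def case_prod_unfold)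
    fix X :: "('b cdual \<times> real) set" assume X: "finite X" "X \<subseteq> UNIV \<times> {0<..}"
    \<comment> \<open>The smallest tolerance among the constraints, with 1 as default when there are
      none.\<close>
    define d where "d = (if X = {} then 1 else Min (snd ` X))"
    have "0 < d"
      using X Min_in[of "snd ` X"] by (auto simp: d_def)
    obtain x where x: "norm x \<le> norm z"
      "\<And>\<phi>. \<phi> \<in> fst ` X \<Longrightarrow> cmod (cdual_apply \<phi> (P x) - cdual_apply ?w \<phi>) \<le> d"
      using aron_berner_approximation[OF P, of "fst ` X" d z] X(1) \<open>0 < d\<close> by auto
    have "P x \<in> S" using assms(3,4) x(1) by auto
    moreover have "P x \<in> f i" if "i \<in> X" for i
    proof -
      have "d \<le> snd i" using X(1) that by (auto simp: d_def)
      then show ?thesis using x(2)[of "fst i"] that by (simp add: f_def case_prod_unfold)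
    qed
    ultimately show "S \<inter> \<Inter> (f ` X) \<noteq> {}" by blast
  qed
  then obtain v where v: "v \<in> S" "\<And>\<phi> d. 0 < d \<Longrightarrow> v \<in> f (\<phi>, d)" by blast
  have "cdual_apply (canonical_embedding v) \<phi> = cdual_apply ?w \<phi>" for \<phi>
  proof -
    have "cmod (cdual_apply \<phi> v - cdual_apply ?w \<phi>) \<le> 0"
      by (rule field_le_epsilon) (use v(2) in \<open>simp add: f_def\<close>)
    then show ?thesis by (simp add: cdual_apply_canonical_embedding)
  qed
  then have "canonical_embedding v = ?w" by (rule cdual_eqI)
  with v(1) show ?thesis by (rule rev_image_eqI[OF _ sym])
qed

text \<open>The constant is preserved because the compact set can be taken to be the hull itself,
  and the embedding carries it into the hull of the embedded sequence with the same
  coefficients.\<close>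

lemma p_bounded_aron_berner:
  fixes P :: "'a::complex_banach \<Rightarrow> 'b::complex_banach"
  assumes P: "P \<in> hom_polynomials m" and "1 \<le> p" "p_bounded p c (P ` cball 0 1)"
  shows "p_bounded p c (aron_berner m P ` cball 0 1)"
proof -
  obtain y :: "nat \<Rightarrow> 'b" where y: "lp_le p c y" "P ` cball 0 1 \<subseteq> p_hull p y"
    using assms(3) by (auto simp: p_bounded_def)
  let ?y = "\<lambda>n. canonical_embedding (y n)"
  have "aron_berner m P ` cball 0 1 \<subseteq> canonical_embedding ` p_hull p y"
    using aron_berner_in_compact[OF P compact_p_hull[OF \<open>1 \<le> p\<close> y(1)] y(2)] by auto
  also have "\<dots> \<subseteq> p_hull p ?y"
  proof safe
    fix s assume "s \<in> p_hull p y"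
    then obtain \<alpha> where \<alpha>: "dual_ball p \<alpha>" "((\<lambda>i. \<alpha> i *\<^sub>C y i) has_sum s) UNIV" by (rule p_hullE)
    show "canonical_embedding s \<in> p_hull p ?y"
      using has_sum_bounded_linear[OF bounded_linear_canonical_embedding \<alpha>(2)] \<alpha>(1)
      by (intro p_hullI) (simp_all add: clinear_scaleC[OF clinear_canonical_embedding])
  qed
  finally show ?thesis
    unfolding p_bounded_def using lp_le_mono[OF y(1) assms(2), of c ?y] by auto
qed

lemma p_bounded_of_aron_berner:
  assumes P: "P \<in> hom_polynomials m" and "1 \<le> p" "0 < e"
    and "p_bounded p c (aron_berner m P ` cball 0 1)"
  shows "p_bounded p (c + e) (P ` cball 0 1)"
proof (rule p_bounded_bidual[OF assms(2,3)])
  have "canonical_embedding ` P ` cball 0 1 \<subseteq> aron_berner m P ` cball 0 1"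
    using aron_berner_canonical_embedding[OF P, symmetric] by (auto simp: image_iff)
  then show "p_bounded p c (canonical_embedding ` P ` cball 0 1)"
    using p_bounded_mono[OF assms(4,2)] by blast
qed

theorem proposition2p4:
  fixes P :: "'e::complex_banach \<Rightarrow> 'f::complex_banach"
    and p :: real and m :: nat
  assumes "1 \<le> p" and "P \<in> hom_polynomials m"
  shows "(p_compact p P \<longleftrightarrow> p_compact p (aron_berner m P)) \<and>
    kappa_p p P = kappa_p p (aron_berner m P)"
proof
  have up: "p_bounded p c (aron_berner m P ` cball 0 1)" if "p_bounded p c (P ` cball 0 1)" for c
    using p_bounded_aron_berner assms that by blast
  have down: "p_bounded p (c + e) (P ` cball 0 1)"
    if "0 < e" "p_bounded p c (aron_berner m P ` cball 0 1)" for c e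
    using p_bounded_of_aron_berner assms that by blast
  show "p_compact p P \<longleftrightarrow> p_compact p (aron_berner m P)"
    unfolding p_compact_def relatively_p_compact_iff[OF assms(1)]
    using up down[OF zero_less_one] by blast
  show "kappa_p p P = kappa_p p (aron_berner m P)"
    unfolding kappa_p_def
  proof (rule antisym)
    show "m_p p (P ` cball 0 1) \<le> m_p p (aron_berner m P ` cball 0 1)"
      using down by (intro m_p_le[OF assms(1)])
    show "m_p p (aron_berner m P ` cball 0 1) \<le> m_p p (P ` cball 0 1)"
    proof (rule m_p_le[OF assms(1)])
      fix c e :: real assume "0 < e" "p_bounded p c (P ` cball 0 1)"
      then show "p_bounded p (c + e) (aron_berner m P ` cball 0 1)"
        by (intro p_bounded_mono[OF up assms(1)]) auto
    qed
  qed
qed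

end
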